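(* For every $\gamma\in C^{\infty}(S^2,\wedge^{0,1})$, the orbit map $\Psi_\gamma:G\to L_{k-1}^p(S^2,\wedge^{0,1})$ defined by $\Psi_\gamma(\phi)=\phi^*(\gamma)$ is of class $C^{\infty}$.
   Context: $S^2$ is the Riemann sphere, $\wedge^{0,1}=\wedge^{0,1}_{S^2}\to S^2$ is the complex line bundle of $(0,1)$-forms on $S^2$, and $G=\mathbf{PSL}(2,\mathbf C)$ is the group of biholomorphic automorphisms of $S^2$ (a Lie group), acting on sections of $\wedge^{0,1}$ by pull-back. $L_{k-1}^p(S^2,\wedge^{0,1})$ is the Banach space of Sobolev $L_{k-1}^p$-sections of $\wedge^{0,1}$, where $k$ is a positive integer and $p$ a Sobolev exponent with $k-2/p>1$. *)

theory Defs
  imports "HOL-Complex_Analysis.Complex_Analysis"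
begin

section \<open>The Riemann sphere and its automorphism group\<close>

datatype riemann_sphere = Point complex | Infinity

text \<open>The two standard holomorphic charts: the coordinate \<open>z\<close> around \<open>0\<close> and the
  coordinate \<open>w = 1/z\<close> around \<open>\<infinity>\<close>; both have image \<open>\<complex>\<close>.\<close>

datatype rs_chart = Z_chart | W_chart

fun rs_param :: "rs_chart \<Rightarrow> complex \<Rightarrow> riemann_sphere" where
  "rs_param Z_chart z = Point z"
| "rs_param W_chart w = (if w = 0 then Infinity else Point (inverse w))"

definition rs_dom :: "rs_chart \<Rightarrow> riemann_sphere set" where
  "rs_dom i = range (rs_param i)"

text \<open>Inverse of \<^const>\<open>rs_param\<close>; the values at \<open>(Z_chart, Infinity)\<close> and
  \<open>(W_chart, Point 0)\<close>, outside the chart domains, are irrelevant.\<close>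

fun rs_coord :: "rs_chart \<Rightarrow> riemann_sphere \<Rightarrow> complex" where
  "rs_coord Z_chart (Point z) = z"
| "rs_coord Z_chart Infinity = 0"
| "rs_coord W_chart (Point z) = inverse z"
| "rs_coord W_chart Infinity = 0"

definition local_rep :: "rs_chart \<Rightarrow> rs_chart \<Rightarrow> (riemann_sphere \<Rightarrow> riemann_sphere) \<Rightarrow> complex \<Rightarrow> complex" where
  "local_rep i j F = (\<lambda>u. rs_coord j (F (rs_param i u)))"

definition local_dom :: "rs_chart \<Rightarrow> rs_chart \<Rightarrow> (riemann_sphere \<Rightarrow> riemann_sphere) \<Rightarrow> complex set" where
  "local_dom i j F = {u. F (rs_param i u) \<in> rs_dom j}"

text \<open>Openness of the sets \<^const>\<open>local_dom\<close> together with holomorphy of the local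
  representatives contains the continuity of \<open>F\<close>.\<close>

definition holomorphic_rs :: "(riemann_sphere \<Rightarrow> riemann_sphere) \<Rightarrow> bool" where
  "holomorphic_rs F \<longleftrightarrow>
    (\<forall>i j. open (local_dom i j F) \<and> local_rep i j F holomorphic_on local_dom i j F)"

definition biholomorphic_rs :: "(riemann_sphere \<Rightarrow> riemann_sphere) \<Rightarrow> bool" where
  "biholomorphic_rs F \<longleftrightarrow> bij F \<and> holomorphic_rs F \<and> holomorphic_rs (inv F)"

definition mat22 :: "complex \<Rightarrow> complex \<Rightarrow> complex \<Rightarrow> complex \<Rightarrow> complex^2^2" where
  "mat22 a b c d = vector [vector [a, b], vector [c, d]]"

fun moebius_map :: "complex^2^2 \<Rightarrow> riemann_sphere \<Rightarrow> riemann_sphere" where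
  "moebius_map A (Point z) =
     (if A$2$1 * z + A$2$2 = 0 then Infinity
      else Point ((A$1$1 * z + A$1$2) / (A$2$1 * z + A$2$2)))"
| "moebius_map A Infinity = (if A$2$1 = 0 then Infinity else Point (A$1$1 / A$2$1))"

lemma rs_dom_Z: "rs_dom Z_chart = - {Infinity}"
  unfolding rs_dom_def by (auto simp: image_iff) (metis riemann_sphere.exhaust)

lemma rs_dom_W: "rs_dom W_chart = - {Point 0}"
proof -
  have "x \<in> range (rs_param W_chart)" if "x \<noteq> Point 0" for x
  proof (cases x)
    case (Point z)
    then have "x = rs_param W_chart (inverse z)" using that by auto
    then show ?thesis by blast
  next
    case Infinity
    then have "x = rs_param W_chart 0" by simp
    then show ?thesis by blast
  qed
  then show ?thesis unfolding rs_dom_def by (auto split: if_splits)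
qed

lemma rs_coord_param [simp]: "rs_coord i (rs_param i u) = u"
  by (cases i) auto

lemma rs_param_coord: "x \<in> rs_dom i \<Longrightarrow> rs_param i (rs_coord i x) = x"
  unfolding rs_dom_def by auto

lemma mat22_nth [simp]:
  "mat22 a b c d $ 1 $ 1 = a" "mat22 a b c d $ 1 $ 2 = b"
  "mat22 a b c d $ 2 $ 1 = c" "mat22 a b c d $ 2 $ 2 = d"
  by (simp_all add: mat22_def)

lemma mat22_eta: "mat22 (A$1$1) (A$1$2) (A$2$1) (A$2$2) = A"
  by (simp add: vec_eq_iff forall_2)

lemma det_mat22 [simp]: "det (mat22 a b c d) = a * d - b * c"
  by (simp add: det_2)

lemma moebius_rep_aux:
  fixes a b c d :: complex
  assumes "a * d - b * c \<noteq> 0"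
  shows "local_dom Z_chart Z_chart (moebius_map (mat22 a b c d)) = {u. c * u + d \<noteq> 0}"
    and "local_dom Z_chart W_chart (moebius_map (mat22 a b c d)) = {u. a * u + b \<noteq> 0}"
    and "local_dom W_chart Z_chart (moebius_map (mat22 a b c d)) = {u. c + d * u \<noteq> 0}"
    and "local_dom W_chart W_chart (moebius_map (mat22 a b c d)) = {u. a + b * u \<noteq> 0}"
    and "\<And>u. c * u + d \<noteq> 0 \<Longrightarrow> local_rep Z_chart Z_chart (moebius_map (mat22 a b c d)) u = (a * u + b) / (c * u + d)"
    and "\<And>u. a * u + b \<noteq> 0 \<Longrightarrow> local_rep Z_chart W_chart (moebius_map (mat22 a b c d)) u = (c * u + d) / (a * u + b)"
    and "\<And>u. c + d * u \<noteq> 0 \<Longrightarrow> local_rep W_chart Z_chart (moebius_map (mat22 a b c d)) u = (a + b * u) / (c + d * u)"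
    and "\<And>u. a + b * u \<noteq> 0 \<Longrightarrow> local_rep W_chart W_chart (moebius_map (mat22 a b c d)) u = (c + d * u) / (a + b * u)"
proof -
  have n1: "\<not> (a * u + b = 0 \<and> c * u + d = 0)" for u
  proof
    assume h: "a * u + b = 0 \<and> c * u + d = 0"
    have "a * d - b * c = a * (c * u + d) - c * (a * u + b)" by (simp add: algebra_simps)
    with h assms show False by simp
  qed
  have n2: "\<not> (a + b * u = 0 \<and> c + d * u = 0)" for u
  proof
    assume h: "a + b * u = 0 \<and> c + d * u = 0"
    have "a * d - b * c = d * (a + b * u) - b * (c + d * u)" by (simp add: algebra_simps)
    with h assms show False by simp
  qed
  have e: "u \<noteq> 0 \<Longrightarrow> x * inverse u + y = (x + y * u) / u" for u x y :: complex
    by (simp add: field_simps)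
  show "local_dom Z_chart Z_chart (moebius_map (mat22 a b c d)) = {u. c * u + d \<noteq> 0}"
    by (auto simp: local_dom_def rs_dom_Z)
  show "local_dom Z_chart W_chart (moebius_map (mat22 a b c d)) = {u. a * u + b \<noteq> 0}"
    using n1 by (auto simp: local_dom_def rs_dom_W)
  show "local_dom W_chart Z_chart (moebius_map (mat22 a b c d)) = {u. c + d * u \<noteq> 0}"
    by (auto simp: local_dom_def rs_dom_Z e)
  show "local_dom W_chart W_chart (moebius_map (mat22 a b c d)) = {u. a + b * u \<noteq> 0}"
    using n2[of 0] n2 by (auto simp: local_dom_def rs_dom_W e)
  show "local_rep Z_chart Z_chart (moebius_map (mat22 a b c d)) u = (a * u + b) / (c * u + d)"
    if "c * u + d \<noteq> 0" for u using that by (simp add: local_rep_def)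
  show "local_rep Z_chart W_chart (moebius_map (mat22 a b c d)) u = (c * u + d) / (a * u + b)"
    if "a * u + b \<noteq> 0" for u using that by (simp add: local_rep_def)
  show "local_rep W_chart Z_chart (moebius_map (mat22 a b c d)) u = (a + b * u) / (c + d * u)"
    if "c + d * u \<noteq> 0" for u using that by (simp add: local_rep_def e)
  show "local_rep W_chart W_chart (moebius_map (mat22 a b c d)) u = (c + d * u) / (a + b * u)"
    if "a + b * u \<noteq> 0" for u using that by (simp add: local_rep_def e)
qed

lemma open_affine_nz: "open {u::complex. a * u + b \<noteq> 0}" "open {u::complex. a + b * u \<noteq> 0}"
  by (auto intro!: open_Collect_neq continuous_intros)

lemma holomorphic_rs_moebius:
  assumes "det A \<noteq> 0"
  shows "holomorphic_rs (moebius_map A)"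
proof -
  define a b c d where "a = A$1$1" and "b = A$1$2" and "c = A$2$1" and "d = A$2$2"
  have A: "A = mat22 a b c d" by (simp add: a_def b_def c_def d_def mat22_eta)
  have nz: "a * d - b * c \<noteq> 0" using assms by (simp add: A)
  note R = moebius_rep_aux[OF nz]
  have *: "open (local_dom i j (moebius_map A)) \<and>
      local_rep i j (moebius_map A) holomorphic_on local_dom i j (moebius_map A)" for i j
    unfolding A
    by (cases i; cases j)
       (simp_all add: R(1-4) open_affine_nz,
        (rule holomorphic_transform[rotated], rule R(5-8)[symmetric], simp, auto intro!: holomorphic_intros)+)
  then show ?thesis by (simp add: holomorphic_rs_def)
qed

lemma holomorphic_rs_compose:
  assumes F: "holomorphic_rs F" and G: "holomorphic_rs G"
  shows "holomorphic_rs (G \<circ> F)"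
proof -
  have "\<exists>U. open U \<and> u \<in> U \<and> U \<subseteq> local_dom i j (G \<circ> F) \<and> local_rep i j (G \<circ> F) holomorphic_on U"
    if u: "u \<in> local_dom i j (G \<circ> F)" for i j u
  proof -
    obtain k where k: "F (rs_param i u) \<in> rs_dom k"
      using rs_dom_Z rs_dom_W by (metis ComplI riemann_sphere.distinct(1) singletonD)
    define U where "U = {v \<in> local_dom i k F. local_rep i k F v \<in> local_dom k j G}"
    have hF: "local_rep i k F holomorphic_on local_dom i k F" and oF: "open (local_dom i k F)"
      and hG: "local_rep k j G holomorphic_on local_dom k j G" and oG: "open (local_dom k j G)"
      using F G by (auto simp: holomorphic_rs_def)
    have "U = local_dom i k F \<inter> local_rep i k F -` local_dom k j G" by (auto simp: U_def)
    then have "open U"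
      using continuous_open_preimage[OF holomorphic_on_imp_continuous_on[OF hF] oF oG] by simp
    moreover have eq: "rs_param k (local_rep i k F v) = F (rs_param i v)" if "v \<in> local_dom i k F" for v
      using that by (auto simp: local_dom_def local_rep_def rs_param_coord)
    moreover have "u \<in> U" "U \<subseteq> local_dom i j (G \<circ> F)"
      using u k eq by (auto simp: U_def local_dom_def)
    moreover have "local_rep i j (G \<circ> F) holomorphic_on U"
    proof (rule holomorphic_transform)
      show "(local_rep k j G \<circ> local_rep i k F) holomorphic_on U"
        by (rule holomorphic_on_compose_gen[OF holomorphic_on_subset[OF hF] hG]) (auto simp: U_def)
      show "(local_rep k j G \<circ> local_rep i k F) v = local_rep i j (G \<circ> F) v" if "v \<in> U" for v
        using that eq by (auto simp: U_def local_rep_def)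
    qed
    ultimately show ?thesis by blast
  qed
  note * = this
  have "open (local_dom i j (G \<circ> F))" for i j
    by (subst open_subopen) (use * in blast)
  moreover have "local_rep i j (G \<circ> F) holomorphic_on local_dom i j (G \<circ> F)" for i j
    unfolding holomorphic_on_def
    by (meson * at_within_open field_differentiable_at_within holomorphic_on_imp_differentiable_at)
  ultimately show ?thesis by (simp add: holomorphic_rs_def)
qed

lemma moebius_compose:
  assumes "det A \<noteq> 0" "det B \<noteq> 0"
  shows "moebius_map A (moebius_map B x) = moebius_map (A ** B) x"
proof -
  define a b c d where "a = A$1$1" and "b = A$1$2" and "c = A$2$1" and "d = A$2$2"
  define a' b' c' d' where "a' = B$1$1" and "b' = B$1$2" and "c' = B$2$1" and "d' = B$2$2"
  have A: "A = mat22 a b c d" by (simp add: a_def b_def c_def d_def mat22_eta)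
  have B: "B = mat22 a' b' c' d'" by (simp add: a'_def b'_def c'_def d'_def mat22_eta)
  have nz: "a * d - b * c \<noteq> 0" "a' * d' - b' * c' \<noteq> 0" using assms by (simp_all add: A B)
  have AB: "A ** B = mat22 (a*a' + b*c') (a*b' + b*d') (c*a' + d*c') (c*b' + d*d')"
    by (simp add: A B vec_eq_iff forall_2 matrix_matrix_mult_def sum_2)
  have key: "moebius_map A (if q = 0 then Infinity else Point (p / q)) =
      (if c * p + d * q = 0 then Infinity else Point ((a * p + b * q) / (c * p + d * q)))"
    if "p \<noteq> 0 \<or> q \<noteq> 0" for p q :: complex
  proof (cases "q = 0")
    case True
    with that show ?thesis by (auto simp: A)
  next
    case False
    then have "c * (p / q) + d = (c * p + d * q) / q" "a * (p / q) + b = (a * p + b * q) / q"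
      by (simp_all add: field_simps)
    with False show ?thesis by (auto simp: A)
  qed
  show ?thesis
  proof (cases x)
    case (Point z)
    have ne: "a' * z + b' \<noteq> 0 \<or> c' * z + d' \<noteq> 0"
    proof (rule ccontr)
      assume h: "\<not> ?thesis"
      have "a' * d' - b' * c' = a' * (c' * z + d') - c' * (a' * z + b')" by (simp add: algebra_simps)
      with h nz show False by simp
    qed
    have "moebius_map A (moebius_map B x) =
        moebius_map A (if c' * z + d' = 0 then Infinity else Point ((a' * z + b') / (c' * z + d')))"
      by (simp only: Point B moebius_map.simps mat22_nth)
    also note key[OF ne]
    also have "c * (a' * z + b') + d * (c' * z + d') = (c*a' + d*c') * z + (c*b' + d*d')"
      by (simp add: algebra_simps)
    also have "a * (a' * z + b') + b * (c' * z + d') = (a*a' + b*c') * z + (a*b' + b*d')"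
      by (simp add: algebra_simps)
    finally show ?thesis by (simp only: Point AB moebius_map.simps mat22_nth)
  next
    case Infinity
    have ne: "a' \<noteq> 0 \<or> c' \<noteq> 0" using nz by auto
    have "moebius_map A (moebius_map B x) = moebius_map A (if c' = 0 then Infinity else Point (a' / c'))"
      by (simp only: Infinity B moebius_map.simps mat22_nth)
    also note key[OF ne]
    finally show ?thesis by (simp only: Infinity AB moebius_map.simps mat22_nth)
  qed
qed

lemma moebius_scalar: "k \<noteq> 0 \<Longrightarrow> moebius_map (mat22 (k*a) (k*b) (k*c) (k*d)) = moebius_map (mat22 a b c d)"
proof
  fix x assume k: "k \<noteq> 0"
  have e: "k * p * z + k * q = k * (p * z + q)" for p q z by (simp add: algebra_simps)
  show "moebius_map (mat22 (k*a) (k*b) (k*c) (k*d)) x = moebius_map (mat22 a b c d) x"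
    using k by (cases x) (simp_all add: e)
qed

lemma moebius_id: "moebius_map (mat22 1 0 0 1) x = x"
  by (cases x) auto

definition adj22 :: "complex^2^2 \<Rightarrow> complex^2^2" where
  "adj22 A = mat22 (A$2$2) (- A$1$2) (- A$2$1) (A$1$1)"

lemma det_adj22 [simp]: "det (adj22 A) = det A"
  by (simp add: adj22_def det_2)

lemma moebius_adj22:
  assumes "det A \<noteq> 0"
  shows "moebius_map (adj22 A) (moebius_map A x) = x" "moebius_map A (moebius_map (adj22 A) x) = x"
proof -
  have s: "moebius_map (mat22 (det A) 0 0 (det A)) x = x"
    using moebius_scalar[of "det A" 1 0 0 1] assms by (simp add: moebius_id)
  have "adj22 A ** A = mat22 (det A) 0 0 (det A)" "A ** adj22 A = mat22 (det A) 0 0 (det A)"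
    by (simp_all add: adj22_def det_2 vec_eq_iff forall_2 matrix_matrix_mult_def sum_2 algebra_simps)
  with s assms show "moebius_map (adj22 A) (moebius_map A x) = x" "moebius_map A (moebius_map (adj22 A) x) = x"
    by (simp_all add: moebius_compose)
qed

lemma bij_moebius: "det A \<noteq> 0 \<Longrightarrow> bij (moebius_map A)"
  by (rule o_bij[of "moebius_map (adj22 A)"]) (auto simp: moebius_adj22)

lemma inv_moebius: "det A \<noteq> 0 \<Longrightarrow> inv (moebius_map A) = moebius_map (adj22 A)"
  by (rule inv_equality) (auto simp: moebius_adj22)

lemma moebius_normalize:
  assumes "det A \<noteq> 0"
  shows "\<exists>B. det B = 1 \<and> moebius_map B = moebius_map A"
proof -
  define k where "k = inverse (csqrt (det A))"
  have k: "k \<noteq> 0" "k * k * det A = 1"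
    using assms power2_csqrt[of "det A"] by (auto simp: k_def field_simps power2_eq_square)
  have "det (mat22 (k*A$1$1) (k*A$1$2) (k*A$2$1) (k*A$2$2)) = 1"
    using k(2) by (simp add: det_2 algebra_simps)
  moreover have "moebius_map (mat22 (k*A$1$1) (k*A$1$2) (k*A$2$1) (k*A$2$2)) = moebius_map A"
    using k(1) by (simp add: moebius_scalar mat22_eta)
  ultimately show ?thesis by blast
qed

typedef psl2c = "{F. \<exists>A :: complex^2^2. det A = 1 \<and> F = moebius_map A}"
  morphisms psl_map Abs_psl2c
  by (rule exI[of _ "moebius_map (mat22 1 0 0 1)"]) (force intro: exI[of _ "mat22 1 0 0 1"])

setup_lifting type_definition_psl2c

lemma holomorphic_rs_psl_map: "holomorphic_rs (psl_map \<phi>)"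
  using psl_map[of \<phi>] holomorphic_rs_moebius by auto

text \<open>The Moebius transformations are exactly the biholomorphic automorphisms of the sphere.\<close>

lemma biholomorphic_moebius: "det A \<noteq> 0 \<Longrightarrow> biholomorphic_rs (moebius_map A)"
  by (simp add: biholomorphic_rs_def bij_moebius holomorphic_rs_moebius inv_moebius)

lemma biholomorphic_fix_Infinity:
  assumes G: "holomorphic_rs G" and inj: "inj G" and fix_inf: "G Infinity = Infinity"
  shows "\<exists>A. det A \<noteq> 0 \<and> G = moebius_map A"
proof -
  define f where "f = local_rep Z_chart Z_chart G"
  define g where "g = local_rep W_chart W_chart G"
  have Gf: "G (Point z) = Point (f z)" for z
  proof -
    have "G (Point z) \<noteq> G Infinity" using injD[OF inj, of "Point z" Infinity] by auto
    then have "G (Point z) \<noteq> Infinity" by (simp add: fix_inf)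
    then show ?thesis by (cases "G (Point z)") (auto simp: f_def local_rep_def)
  qed
  have "local_dom Z_chart Z_chart G = UNIV" by (auto simp: local_dom_def rs_dom_Z Gf)
  then have f: "f holomorphic_on UNIV" using G unfolding holomorphic_rs_def f_def by metis
  have inj_f: "inj f"
    using injD[OF inj] Gf by (metis injI riemann_sphere.inject(1))
  define D where "D = local_dom W_chart W_chart G"
  have D: "open D" "g holomorphic_on D" "0 \<in> D"
    using G fix_inf by (auto simp: holomorphic_rs_def D_def g_def) (simp add: local_dom_def rs_dom_W)
  have g0: "g 0 = 0" by (simp add: g_def local_rep_def fix_inf)
  have gw: "g w = inverse (f (inverse w))" if "w \<noteq> 0" for w
    using that by (simp add: g_def local_rep_def Gf)
  have "inj_on g D"
  proof (rule inj_onI)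
    fix v w assume h: "v \<in> D" "w \<in> D" "g v = g w"
    have "G (rs_param W_chart v) = rs_param W_chart (g v)" "G (rs_param W_chart w) = rs_param W_chart (g w)"
      using h(1,2) unfolding D_def local_dom_def g_def local_rep_def
      by (simp_all only: rs_param_coord mem_Collect_eq)
    then have "rs_param W_chart v = rs_param W_chart w"
      using h(3) by - (rule injD[OF inj], simp only:)
    then have "rs_coord W_chart (rs_param W_chart v) = rs_coord W_chart (rs_param W_chart w)" by (rule arg_cong)
    then show "v = w" by (simp only: rs_coord_param)
  qed
  then have g'0: "deriv g 0 \<noteq> 0"
    using holomorphic_injective_imp_regular[OF D(2,1)] D(3) by blast
  define e where "e = norm (deriv g 0) / 2"
  have e: "e > 0" using g'0 by (simp add: e_def)
  have "(g has_field_derivative deriv g 0) (at 0)"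
    using D by (simp add: holomorphic_derivI)
  then have "((\<lambda>w. g w / w) \<longlongrightarrow> deriv g 0) (at 0)"
    by (simp add: has_field_derivative_iff g0)
  then have "\<forall>\<^sub>F w in at 0. dist (g w / w) (deriv g 0) < e"
    using e by (rule tendstoD)
  then obtain r where r: "r > 0" "\<And>w. w \<noteq> 0 \<Longrightarrow> norm w < r \<Longrightarrow> dist (g w / w) (deriv g 0) < e"
    unfolding eventually_at by force
  have "norm (f z) \<le> (1 / e) * norm z ^ 1" if z: "2 / r \<le> norm z" for z
  proof -
    have z0: "z \<noteq> 0" using z r(1) by (auto simp: field_simps)
    define w where "w = inverse z"
    have w: "w \<noteq> 0" "norm w < r"
    proof -
      have "0 < 2 / r" using r(1) by simp
      then have "inverse (norm z) \<le> inverse (2 / r)" using z by (intro le_imp_inverse_le)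
      also have "\<dots> < r" using r(1) by simp
      finally show "norm w < r" by (simp add: w_def norm_inverse)
    qed (use z0 in \<open>simp add: w_def\<close>)
    have fz: "g w = inverse (f z)" using gw[OF w(1)] by (simp add: w_def)
    have "norm (deriv g 0) \<le> norm (g w / w) + dist (g w / w) (deriv g 0)"
      using norm_triangle_sub[of "deriv g 0" "g w / w"] by (simp add: dist_norm norm_minus_commute)
    then have "e \<le> norm (g w / w)" using r(2)[OF w] unfolding e_def by (simp add: field_simps)
    then have le: "e * norm w \<le> norm (g w)" using w by (simp add: norm_divide field_simps)
    then have "g w \<noteq> 0" using e w by (auto simp: mult_le_0_iff)
    then have "norm (f z) > 0" using fz by auto
    moreover have "norm (g w) = 1 / norm (f z)" "norm w = 1 / norm z"
      using fz by (simp_all add: w_def norm_inverse inverse_eq_divide norm_divide)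
    ultimately have "e / norm z \<le> 1 / norm (f z)" using le by simp
    then have "e \<le> norm z / norm (f z)" using z0 by (simp add: pos_divide_le_eq)
    then have "e * norm (f z) \<le> norm z" using \<open>norm (f z) > 0\<close> by (simp add: pos_le_divide_eq)
    then show ?thesis using e by (simp add: pos_le_divide_eq mult.commute)
  qed
  note Liouville_polynomial[OF f this]
  then  have poly: "f z = (\<Sum>k\<le>1. (deriv ^^ k) f 0 / fact k * z ^ k)" for z .
  define p q where "p = deriv f 0" and "q = f 0"
  have fz: "f z = p * z + q" for z using poly[of z] by (simp add: p_def q_def)
  have "p \<noteq> 0"
  proof
    assume "p = 0"
    then have "f 0 = f 1" using fz[of 0] fz[of 1] by simp
    then show False using injD[OF inj_f] by fastforce
  qed
  moreover have "G x = moebius_map (mat22 p q 0 1) x" for x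
    by (cases x) (simp_all add: Gf fz fix_inf)
  ultimately show ?thesis by (intro exI[of _ "mat22 p q 0 1"]) auto
qed

theorem range_psl_map: "range psl_map = {F. biholomorphic_rs F}"
proof (intro set_eqI iffI)
  fix F assume "F \<in> range psl_map"
  then obtain A where "det A = 1" "F = moebius_map A" using psl_map by auto
  then show "F \<in> {F. biholomorphic_rs F}" by (simp add: biholomorphic_moebius)
next
  fix F assume "F \<in> {F. biholomorphic_rs F}"
  then have F: "holomorphic_rs F" "inj F" by (auto simp: biholomorphic_rs_def bij_def)
  obtain B where B: "det B \<noteq> 0" "moebius_map B (F Infinity) = Infinity"
  proof (cases "F Infinity")
    case (Point z)
    then show ?thesis using that[of "mat22 0 1 1 (- z)"] by simp
  next
    case Infinity
    then show ?thesis using that[of "mat22 1 0 0 1"] by simp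
  qed
  define G where "G = moebius_map B \<circ> F"
  have "holomorphic_rs G" "inj G" "G Infinity = Infinity"
    using F B bij_moebius[OF B(1)]
    by (auto simp: G_def holomorphic_rs_compose holomorphic_rs_moebius bij_def inj_compose)
  then obtain A where A: "det A \<noteq> 0" "G = moebius_map A" using biholomorphic_fix_Infinity by blast
  have "F x = moebius_map (adj22 B ** A) x" for x
  proof -
    have "F x = moebius_map (adj22 B) (G x)" by (simp add: G_def moebius_adj22 B)
    then show ?thesis using A B by (simp add: moebius_compose)
  qed
  then have "F = moebius_map (adj22 B ** A)" by blast
  moreover have "det (adj22 B ** A) \<noteq> 0" using A B by (simp add: det_mul)
  ultimately obtain M where "det M = 1" "F = moebius_map M" using moebius_normalize by metis
  then show "F \<in> range psl_map"
    by (metis (mono_tags, lifting) Abs_psl2c_inverse mem_Collect_eq rangeI)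
qed


section \<open>The Lie group structure of PSL(2,C)\<close>

text \<open>\<open>PSL(2,\<complex>) = PGL(2,\<complex>)\<close> is the open subset \<open>det \<noteq> 0\<close> of the projective space
  \<open>\<complex>\<P>\<^sup>3\<close> of nonzero 2 by 2 matrices up to scalars, and carries the corresponding manifold
  structure. The four affine
  charts of \<open>\<complex>\<P>\<^sup>3\<close> (one matrix entry normalised to \<open>1\<close>) give its atlas; it is
  recorded by the inverses of the chart maps, defined on open subsets of \<open>\<complex>\<^sup>3\<close>.\<close>

definition psl_of :: "complex^2^2 \<Rightarrow> psl2c" where
  "psl_of A = Abs_psl2c (moebius_map A)"

definition psl_affine :: "(complex \<times> complex \<times> complex \<Rightarrow> complex^2^2) set" where
  "psl_affine =
    {\<lambda>(x, y, t). mat22 1 x y t, \<lambda>(x, y, t). mat22 x 1 y t,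
     \<lambda>(x, y, t). mat22 x y 1 t, \<lambda>(x, y, t). mat22 x y t 1}"

definition psl_chart_dom ::
    "(complex \<times> complex \<times> complex \<Rightarrow> complex^2^2) \<Rightarrow> (complex \<times> complex \<times> complex) set" where
  "psl_chart_dom m = {v. det (m v) \<noteq> 0}"

lemma psl_map_psl_of: "det A \<noteq> 0 \<Longrightarrow> psl_map (psl_of A) = moebius_map A"
  unfolding psl_of_def by (rule Abs_psl2c_inverse) (metis (mono_tags, lifting) mem_Collect_eq moebius_normalize)

lemma moebius_eq_iff:
  assumes "det A \<noteq> 0" "det B \<noteq> 0"
  shows "moebius_map A = moebius_map B \<longleftrightarrow>
    (\<exists>k. k \<noteq> 0 \<and> A = mat22 (k*B$1$1) (k*B$1$2) (k*B$2$1) (k*B$2$2))"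
proof
  assume eq: "moebius_map A = moebius_map B"
  define M where "M = adj22 B ** A"
  have dM: "det M \<noteq> 0" using assms by (simp add: M_def det_mul)
  have M: "moebius_map M x = x" for x
    using assms eq by (simp add: M_def moebius_compose[symmetric] moebius_adj22)
  have "M$2$1 = 0" using M[of Infinity] by (auto split: if_splits)
  moreover have "M$1$2 = 0" using M[of "Point 0"] by (auto split: if_splits)
  moreover have "M$1$1 = M$2$2"
    using M[of "Point 1"] calculation dM by (auto simp: det_2 split: if_splits)
  ultimately have "M = mat22 (M$1$1) 0 0 (M$1$1)" "M$1$1 \<noteq> 0"
    using dM by (simp_all add: vec_eq_iff forall_2 det_2)
  then obtain \<mu> where M': "M = mat22 \<mu> 0 0 \<mu>" and \<mu>: "\<mu> \<noteq> 0" by blast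
  have "B ** M = (B ** adj22 B) ** A" by (simp add: M_def matrix_mul_assoc)
  also have "B ** adj22 B = mat22 (det B) 0 0 (det B)"
    by (simp add: adj22_def det_2 vec_eq_iff forall_2 matrix_matrix_mult_def sum_2 algebra_simps)
  finally have e: "B ** mat22 \<mu> 0 0 \<mu> = mat22 (det B) 0 0 (det B) ** A"
    by (simp only: M')
  have ent: "det B * A$i$j = B$i$j * \<mu>" for i j
    using arg_cong[OF e, of "\<lambda>X. X$i$j"] exhaust_2[of i] exhaust_2[of j]
    by (auto simp: matrix_matrix_mult_def sum_2)
  have f: "A$i$j = \<mu>/det B*B$i$j" for i j
  proof -
    have "A$i$j = (det B * A$i$j) / det B" using assms(2) by simp
    then show ?thesis by (simp only: ent) simp
  qed
  have "A = mat22 (\<mu>/det B*B$1$1) (\<mu>/det B*B$1$2) (\<mu>/det B*B$2$1) (\<mu>/det B*B$2$2)"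
    unfolding f[symmetric] by (rule mat22_eta[symmetric])
  then show "\<exists>k. k \<noteq> 0 \<and> A = mat22 (k*B$1$1) (k*B$1$2) (k*B$2$1) (k*B$2$2)"
    using \<mu> assms(2) by (intro exI[of _ "\<mu> / det B"] conjI) auto
next
  assume "\<exists>k. k \<noteq> 0 \<and> A = mat22 (k*B$1$1) (k*B$1$2) (k*B$2$1) (k*B$2$2)"
  then obtain k where "k \<noteq> 0" "A = mat22 (k*B$1$1) (k*B$1$2) (k*B$2$1) (k*B$2$2)" by blast
  then show "moebius_map A = moebius_map B" by (simp add: moebius_scalar mat22_eta)
qed

lemma open_psl_chart_dom: "m \<in> psl_affine \<Longrightarrow> open (psl_chart_dom m)"
  unfolding psl_affine_def psl_chart_dom_def
  by (auto simp: case_prod_beta intro!: open_Collect_neq continuous_intros)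

lemma inj_on_psl_chart: "m \<in> psl_affine \<Longrightarrow> inj_on (\<lambda>v. psl_of (m v)) (psl_chart_dom m)"
proof (rule inj_onI)
  fix v w assume m: "m \<in> psl_affine" and v: "v \<in> psl_chart_dom m" "w \<in> psl_chart_dom m"
    and eq: "psl_of (m v) = psl_of (m w)"
  have nz: "det (m v) \<noteq> 0" "det (m w) \<noteq> 0" using v by (auto simp: psl_chart_dom_def)
  then have "moebius_map (m v) = moebius_map (m w)" using eq psl_map_psl_of by metis
  then obtain k where k:
    "m v = mat22 (k*m w$1$1) (k*m w$1$2) (k*m w$2$1) (k*m w$2$2)"
    using moebius_eq_iff[OF nz] by blast
  then have e: "k*m w$1$1 = m v$1$1" "k*m w$1$2 = m v$1$2" "k*m w$2$1 = m v$2$1" "k*m w$2$2 = m v$2$2"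
    by (simp_all only: k mat22_nth)
  obtain x y t x' y' t' where vw: "v = (x, y, t)" "w = (x', y', t')" by (metis prod_cases3)
  from m consider "m = (\<lambda>(x, y, t). mat22 1 x y t)" | "m = (\<lambda>(x, y, t). mat22 x 1 y t)"
    | "m = (\<lambda>(x, y, t). mat22 x y 1 t)" | "m = (\<lambda>(x, y, t). mat22 x y t 1)"
    unfolding psl_affine_def by blast
  then show "v = w" by cases (use e in \<open>simp_all add: vw\<close>)
qed

lemma psl_charts_cover: "(\<Union>m\<in>psl_affine. (\<lambda>v. psl_of (m v)) ` psl_chart_dom m) = UNIV"
proof -
  have "\<exists>m\<in>psl_affine. \<phi> \<in> (\<lambda>v. psl_of (m v)) ` psl_chart_dom m" for \<phi>
  proof -
    obtain A where A: "det A = 1" "psl_map \<phi> = moebius_map A" using psl_map by auto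
    define a b c d where "a = A$1$1" and "b = A$1$2" and "c = A$2$1" and "d = A$2$2"
    have Aeq: "A = mat22 a b c d" by (simp add: a_def b_def c_def d_def mat22_eta)
    have dt: "a * d - b * c = 1" using A(1) by (simp add: Aeq)
    have *: "\<phi> \<in> (\<lambda>v. psl_of (m v)) ` psl_chart_dom m"
      if "k \<noteq> 0" "m v = mat22 (k*a) (k*b) (k*c) (k*d)" for m v k
    proof -
      have "det (m v) = k * k * (a * d - b * c)" by (simp add: that algebra_simps)
      then have nz: "det (m v) \<noteq> 0" using dt that by simp
      have "psl_map (psl_of (m v)) = psl_map \<phi>"
        using nz that A(2) by (simp add: psl_map_psl_of moebius_scalar Aeq)
      then have "\<phi> = psl_of (m v)" by (simp add: psl_map_inject)
      with nz show ?thesis by (auto simp: psl_chart_dom_def)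
    qed
    have "a \<noteq> 0 \<or> b \<noteq> 0" using dt by auto
    then show ?thesis
    proof
      assume "a \<noteq> 0"
      then have "\<phi> \<in> (\<lambda>v. psl_of ((\<lambda>(x, y, t). mat22 1 x y t) v)) ` psl_chart_dom (\<lambda>(x, y, t). mat22 1 x y t)"
        by (intro *[of "inverse a" _ "(inverse a*b, inverse a*c, inverse a*d)"]) auto
      then show ?thesis unfolding psl_affine_def by blast
    next
      assume "b \<noteq> 0"
      then have "\<phi> \<in> (\<lambda>v. psl_of ((\<lambda>(x, y, t). mat22 x 1 y t) v)) ` psl_chart_dom (\<lambda>(x, y, t). mat22 x 1 y t)"
        by (intro *[of "inverse b" _ "(inverse b*a, inverse b*c, inverse b*d)"]) auto
      then show ?thesis unfolding psl_affine_def by blast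
    qed
  qed
  then show ?thesis by blast
qed


section \<open>Smooth maps into a (semi)normed space of functions\<close>

text \<open>Frechet calculus for maps from open subsets of a finite-dimensional space into the
  normed space obtained from a subspace \<open>V\<close> with a seminorm \<open>N\<close> by identifying elements
  at \<open>N\<close>-distance \<open>0\<close>. (For Sobolev spaces: functions instead of their classes modulo
  null sets.)\<close>

definition has_frechet_derivative_in ::
    "'b set \<Rightarrow> ('b \<Rightarrow> real) \<Rightarrow> ('a::euclidean_space \<Rightarrow> 'b::real_vector) \<Rightarrow> ('a \<Rightarrow> 'b) \<Rightarrow> 'a \<Rightarrow> bool" where
  "has_frechet_derivative_in V N f D x \<longleftrightarrow>
     linear D \<and> range D \<subseteq> V \<and> (\<exists>C. \<forall>h. N (D h) \<le> C * norm h) \<and>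
     ((\<lambda>h. N (f (x + h) - f x - D h) / norm h) \<longlongrightarrow> 0) (at 0)"

text \<open>As the domain is finite-dimensional, the derivative \<open>x \<mapsto> f' x\<close> is of class \<open>C\<^sup>n\<close> for
  the operator norm iff \<open>x \<mapsto> f' x h\<close> is of class \<open>C\<^sup>n\<close> for every vector \<open>h\<close>.\<close>

fun Ck_into :: "nat \<Rightarrow> 'b set \<Rightarrow> ('b \<Rightarrow> real) \<Rightarrow> 'a set \<Rightarrow> ('a::euclidean_space \<Rightarrow> 'b::real_vector) \<Rightarrow> bool" where
  "Ck_into 0 V N S f \<longleftrightarrow>
     f ` S \<subseteq> V \<and> (\<forall>x\<in>S. ((\<lambda>y. N (f y - f x)) \<longlongrightarrow> 0) (at x within S))"
| "Ck_into (Suc n) V N S f \<longleftrightarrow>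
     f ` S \<subseteq> V \<and>
     (\<exists>f'. (\<forall>x\<in>S. has_frechet_derivative_in V N f (f' x) x) \<and>
           (\<forall>h. Ck_into n V N S (\<lambda>x. f' x h)))"

definition smooth_into :: "'b set \<Rightarrow> ('b \<Rightarrow> real) \<Rightarrow> 'a set \<Rightarrow> ('a::euclidean_space \<Rightarrow> 'b::real_vector) \<Rightarrow> bool" where
  "smooth_into V N S f \<longleftrightarrow> (\<forall>n. Ck_into n V N S f)"

abbreviation smooth_on :: "'a set \<Rightarrow> ('a::euclidean_space \<Rightarrow> 'b::real_normed_vector) \<Rightarrow> bool" where
  "smooth_on \<equiv> smooth_into UNIV norm"

lemma has_frechet_derivative_in_UNIV:
  "has_frechet_derivative_in UNIV norm f D x \<longleftrightarrow> (f has_derivative D) (at x)"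
proof -
  have "bounded_linear D \<longleftrightarrow> linear D \<and> (\<exists>C. \<forall>h. norm (D h) \<le> C * norm h)"
    by (auto simp: bounded_linear_def bounded_linear_axioms_def linear_def mult.commute)
  then show ?thesis
    by (auto simp: has_frechet_derivative_in_def has_derivative_at)
qed

lemma Ck_into_0_UNIV: "Ck_into 0 UNIV norm S f \<longleftrightarrow> continuous_on S f"
  by (simp add: continuous_on_def tendsto_norm_zero_iff LIM_zero_iff)

definition smooth_on_PSL :: "'b set \<Rightarrow> ('b \<Rightarrow> real) \<Rightarrow> (psl2c \<Rightarrow> 'b::real_vector) \<Rightarrow> bool" where
  "smooth_on_PSL V N \<Psi> \<longleftrightarrow>
     (\<forall>m\<in>psl_affine. smooth_into V N (psl_chart_dom m) (\<lambda>v. \<Psi> (psl_of (m v))))"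


section \<open>Sections of the bundle of (0,1)-forms\<close>

text \<open>A section of the bundle is given by its coefficients in the two charts: it equals
  \<open>f Z_chart\<close> times the conjugate of \<open>dz\<close>, and \<open>f W_chart\<close> times the conjugate of \<open>dw\<close>.
  Since \<open>w = 1/z\<close>, \<open>cnj dw = - cnj dz / (cnj z)\<^sup>2\<close>, which is the gluing condition.\<close>

typedef form01 =
  "{f :: rs_chart \<Rightarrow> complex \<Rightarrow> complex. \<forall>z. z \<noteq> 0 \<longrightarrow> f Z_chart z = - f W_chart (inverse z) / (cnj z)\<^sup>2}"
  morphisms coeff Abs_form01
  by (rule exI[of _ "\<lambda>_ _. 0"]) simp

setup_lifting type_definition_form01

instantiation form01 :: real_vector
begin

lift_definition zero_form01 :: form01 is "\<lambda>_ _. 0" by simp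
lift_definition plus_form01 :: "form01 \<Rightarrow> form01 \<Rightarrow> form01" is "\<lambda>f g i u. f i u + g i u"
  by (simp add: field_simps)
lift_definition minus_form01 :: "form01 \<Rightarrow> form01 \<Rightarrow> form01" is "\<lambda>f g i u. f i u - g i u"
  by (simp add: field_simps)
lift_definition uminus_form01 :: "form01 \<Rightarrow> form01" is "\<lambda>f i u. - f i u"
  by (simp add: field_simps)
lift_definition scaleR_form01 :: "real \<Rightarrow> form01 \<Rightarrow> form01" is "\<lambda>r f i u. r *\<^sub>R f i u"
  by (simp add: scaleR_conv_of_real)

instance
  by standard (transfer; simp add: fun_eq_iff algebra_simps)+

end

definition smooth_form :: "form01 \<Rightarrow> bool" where
  "smooth_form \<gamma> \<longleftrightarrow> (\<forall>i. smooth_on UNIV (coeff \<gamma> i))"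

text \<open>If \<open>F\<close> is the local representative of a holomorphic \<open>\<phi>\<close> in the charts \<open>i\<close>, \<open>j\<close> (with
  coordinates \<open>u\<close>, \<open>v\<close>), then the pull-back of \<open>f j \<sqdot> cnj dv\<close> is
  \<open>(f j \<circ> F) \<sqdot> cnj F' \<sqdot> cnj du\<close>. The target chart \<open>j\<close> may be any one containing the image
  point, see \<open>coeff_pullback\<close> below.\<close>

definition pullback_coeff ::
    "(riemann_sphere \<Rightarrow> riemann_sphere) \<Rightarrow> (rs_chart \<Rightarrow> complex \<Rightarrow> complex) \<Rightarrow> rs_chart \<Rightarrow> complex \<Rightarrow> complex" where
  "pullback_coeff \<phi> f i u =
    (let j = (if \<phi> (rs_param i u) = Infinity then W_chart else Z_chart)
     in f j (local_rep i j \<phi> u) * cnj (deriv (local_rep i j \<phi>) u))"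

lemma pullback_coeff_chart:
  assumes hol: "holomorphic_rs \<phi>"
    and f: "\<And>z. z \<noteq> 0 \<Longrightarrow> f Z_chart z = - f W_chart (inverse z) / (cnj z)\<^sup>2"
    and u: "\<phi> (rs_param i u) \<in> rs_dom j"
  shows "pullback_coeff \<phi> f i u = f j (local_rep i j \<phi> u) * cnj (deriv (local_rep i j \<phi>) u)"
proof (cases "\<phi> (rs_param i u)")
  case Infinity
  then have "j = W_chart" using u by (cases j) (auto simp: rs_dom_Z)
  with Infinity show ?thesis by (simp add: pullback_coeff_def)
next
  case (Point z)
  show ?thesis
  proof (cases j)
    case Z_chart
    with Point show ?thesis by (simp add: pullback_coeff_def)
  next
    case W_chart
    have z: "z \<noteq> 0" using u Point W_chart by (auto simp: rs_dom_W)
    define F where "F = local_rep i Z_chart \<phi>"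
    define D where "D = local_dom i Z_chart \<phi>"
    have D: "open D" "F holomorphic_on D" "u \<in> D"
      using hol Point by (auto simp: holomorphic_rs_def F_def D_def) (simp add: local_dom_def rs_dom_Z)
    have Fu: "F u = z" by (simp add: F_def local_rep_def Point)
    have eq: "local_rep i W_chart \<phi> v = inverse (F v)" if "v \<in> D" for v
      using that by (cases "\<phi> (rs_param i v)") (auto simp: D_def local_dom_def rs_dom_Z local_rep_def F_def)
    have dF: "(F has_field_derivative deriv F u) (at u)"
      using D by (simp add: holomorphic_derivI)
    have "((\<lambda>v. inverse (F v)) has_field_derivative - (deriv F u) / z\<^sup>2) (at u)"
      using dF z Fu by (auto intro!: derivative_eq_intros simp: field_simps power2_eq_square)
    then have "(local_rep i W_chart \<phi> has_field_derivative - (deriv F u) / z\<^sup>2) (at u)"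
      by (rule has_field_derivative_transform_within_open[OF _ D(1,3)]) (simp add: eq)
    then have dW: "deriv (local_rep i W_chart \<phi>) u = - (deriv F u) / z\<^sup>2" by (rule DERIV_imp_deriv)
    have "pullback_coeff \<phi> f i u = f Z_chart z * cnj (deriv F u)"
      by (simp add: pullback_coeff_def Point Fu[unfolded F_def] F_def)
    also have "\<dots> = f W_chart (inverse z) * cnj (- (deriv F u) / z\<^sup>2)"
      by (simp add: f[OF z])
    finally show ?thesis by (simp add: W_chart dW eq D(3) Fu)
  qed
qed

lemma pullback_coeff_glue:
  assumes hol: "holomorphic_rs \<phi>"
    and f: "\<And>z. z \<noteq> 0 \<Longrightarrow> f Z_chart z = - f W_chart (inverse z) / (cnj z)\<^sup>2"
    and z: "z \<noteq> 0"
  shows "pullback_coeff \<phi> f Z_chart z = - pullback_coeff \<phi> f W_chart (inverse z) / (cnj z)\<^sup>2"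
proof -
  obtain j where j: "\<phi> (rs_param Z_chart z) \<in> rs_dom j"
    using rs_dom_Z rs_dom_W by (metis ComplI riemann_sphere.distinct(1) singletonD)
  have same: "rs_param W_chart (inverse v) = rs_param Z_chart v" if "v \<noteq> 0" for v
    using that by simp
  define H where "H = local_rep W_chart j \<phi>"
  have H: "local_rep Z_chart j \<phi> v = H (inverse v)" if "v \<noteq> 0" for v
    using same[OF that] by (simp add: local_rep_def H_def)
  have "(H has_field_derivative deriv H (inverse z)) (at (inverse z))"
  proof (rule holomorphic_derivI)
    show "H holomorphic_on local_dom W_chart j \<phi>" "open (local_dom W_chart j \<phi>)"
      using hol by (auto simp: holomorphic_rs_def H_def)
    show "inverse z \<in> local_dom W_chart j \<phi>"
      using j same[OF z] by (simp only: local_dom_def mem_Collect_eq)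
  qed
  then have "((\<lambda>v. H (inverse v)) has_field_derivative deriv H (inverse z) * (- inverse (z\<^sup>2))) (at z)"
  proof (rule DERIV_chain2)
    show "(inverse has_field_derivative - inverse (z\<^sup>2)) (at z)"
      using DERIV_inverse[OF z, of UNIV] by (simp add: numeral_2_eq_2)
  qed
  then have "(local_rep Z_chart j \<phi> has_field_derivative deriv H (inverse z) * (- inverse (z\<^sup>2))) (at z)"
    by (rule has_field_derivative_transform_within_open[where S = "- {0}"]) (use z H in auto)
  then have "deriv (local_rep Z_chart j \<phi>) z = deriv H (inverse z) * (- inverse (z\<^sup>2))"
    by (rule DERIV_imp_deriv)
  moreover have "pullback_coeff \<phi> f Z_chart z = f j (H (inverse z)) * cnj (deriv (local_rep Z_chart j \<phi>) z)"
    using pullback_coeff_chart[OF hol f j] H[OF z] by simp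
  moreover have "pullback_coeff \<phi> f W_chart (inverse z) = f j (H (inverse z)) * cnj (deriv H (inverse z))"
    using pullback_coeff_chart[OF hol f, of W_chart "inverse z" j] j same[OF z] by (simp add: H_def)
  ultimately show ?thesis by (simp add: field_simps)
qed

lift_definition pullback :: "psl2c \<Rightarrow> form01 \<Rightarrow> form01" is pullback_coeff
  by (intro CollectI allI impI pullback_coeff_glue) (auto simp: holomorphic_rs_moebius)

lemma coeff_pullback:
  assumes "psl_map \<phi> (rs_param i u) \<in> rs_dom j"
  shows "coeff (pullback \<phi> \<gamma>) i u =
    coeff \<gamma> j (local_rep i j (psl_map \<phi>) u) * cnj (deriv (local_rep i j (psl_map \<phi>)) u)"
  unfolding pullback.rep_eq
  using coeff[of \<gamma>] by (intro pullback_coeff_chart holomorphic_rs_psl_map assms) auto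


section \<open>Sobolev spaces of sections\<close>

definition partial_x :: "(complex \<Rightarrow> 'b::real_normed_vector) \<Rightarrow> complex \<Rightarrow> 'b" where
  "partial_x f z = frechet_derivative f (at z) 1"

definition partial_y :: "(complex \<Rightarrow> 'b::real_normed_vector) \<Rightarrow> complex \<Rightarrow> 'b" where
  "partial_y f z = frechet_derivative f (at z) \<i>"

definition test_function :: "complex set \<Rightarrow> (complex \<Rightarrow> real) \<Rightarrow> bool" where
  "test_function \<Omega> \<phi> \<longleftrightarrow>
     smooth_on UNIV \<phi> \<and> compact (closure {z. \<phi> z \<noteq> 0}) \<and> closure {z. \<phi> z \<noteq> 0} \<subseteq> \<Omega>"

definition locally_integrable_on :: "(complex \<Rightarrow> complex) \<Rightarrow> complex set \<Rightarrow> bool" where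
  "locally_integrable_on f \<Omega> \<longleftrightarrow> (\<forall>K. compact K \<and> K \<subseteq> \<Omega> \<longrightarrow> set_integrable lebesgue K f)"

text \<open>\<open>g\<close> is the weak (distributional) derivative \<open>\<partial>\<^sub>x\<^sup>a \<partial>\<^sub>y\<^sup>b f\<close> on the open set \<open>\<Omega>\<close>.\<close>

definition weak_derivative ::
    "complex set \<Rightarrow> nat \<times> nat \<Rightarrow> (complex \<Rightarrow> complex) \<Rightarrow> (complex \<Rightarrow> complex) \<Rightarrow> bool" where
  "weak_derivative \<Omega> = (\<lambda>(a, b) f g.
     locally_integrable_on f \<Omega> \<and> locally_integrable_on g \<Omega> \<and>
     (\<forall>\<phi>. test_function \<Omega> \<phi> \<longrightarrow>
        (LINT z:\<Omega>|lebesgue. (partial_x ^^ a) ((partial_y ^^ b) \<phi>) z *\<^sub>R f z) =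
        (- 1) ^ (a + b) * (LINT z:\<Omega>|lebesgue. \<phi> z *\<^sub>R g z)))"

definition Lp_on :: "real \<Rightarrow> complex set \<Rightarrow> (complex \<Rightarrow> complex) set" where
  "Lp_on p \<Omega> = {f. set_borel_measurable lebesgue \<Omega> f \<and>
                   set_integrable lebesgue \<Omega> (\<lambda>z. norm (f z) powr p)}"

definition Lp_norm :: "real \<Rightarrow> complex set \<Rightarrow> (complex \<Rightarrow> complex) \<Rightarrow> real" where
  "Lp_norm p \<Omega> f = (LINT z:\<Omega>|lebesgue. norm (f z) powr p) powr (1 / p)"

definition sobolev_fun :: "nat \<Rightarrow> real \<Rightarrow> complex set \<Rightarrow> (complex \<Rightarrow> complex) set" where
  "sobolev_fun m p \<Omega> =
     {f. \<forall>a b. a + b \<le> m \<longrightarrow> (\<exists>g \<in> Lp_on p \<Omega>. weak_derivative \<Omega> (a, b) f g)}"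

text \<open>Weak derivatives are unique up to null sets, which do not affect \<^const>\<open>Lp_norm\<close>.\<close>

definition sobolev_fun_norm :: "nat \<Rightarrow> real \<Rightarrow> complex set \<Rightarrow> (complex \<Rightarrow> complex) \<Rightarrow> real" where
  "sobolev_fun_norm m p \<Omega> f =
     (\<Sum>\<alpha>\<in>{(a, b). a + b \<le> m}. Lp_norm p \<Omega> (SOME g. weak_derivative \<Omega> \<alpha> f g))"

text \<open>The space of sections with \<open>m\<close> derivatives in \<open>L\<^sup>p\<close> over the compact sphere, with its norm
  computed in a finite cover by relatively compact coordinate discs, here \<open>|z| < 2\<close> and
  \<open>|w| < 2\<close>. A different choice of such a cover gives the same space and an equivalent norm.\<close>

definition sobolev_forms :: "nat \<Rightarrow> real \<Rightarrow> form01 set" where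
  "sobolev_forms m p = {\<gamma>. \<forall>i. coeff \<gamma> i \<in> sobolev_fun m p (ball 0 2)}"

definition sobolev_norm :: "nat \<Rightarrow> real \<Rightarrow> form01 \<Rightarrow> real" where
  "sobolev_norm m p \<gamma> = (\<Sum>i\<in>{Z_chart, W_chart}. sobolev_fun_norm m p (ball 0 2) (coeff \<gamma> i))"

end

theory Submission
  imports Defs
begin

text \<open>In the charts, \<open>\<phi>\<^sup>*\<gamma>\<close> has the coefficients \<open>(f \<circ> F) \<sqdot> cnj F'\<close> with \<open>F\<close> a quotient of affine
  functions, so they are jointly smooth in the matrix entries and the coordinate \<open>u\<close>. For any family
  of forms with jointly smooth coefficients, the difference quotients in the parameter, and all their
  \<open>u\<close>-derivatives, converge uniformly on compact sets of \<open>u\<close>, because derivatives in the parameter and in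
  \<open>u\<close> commute. The Sobolev norm of a smooth form is bounded by the suprema of its classical
  derivatives over the discs \<open>|u| \<le> 2\<close>, so the family is differentiable in the Sobolev norm; its
  derivative is again such a family, and induction gives smoothness.\<close>

section \<open>Calculus of maps of class \<open>C\<^sup>n\<close>\<close>

text \<open>\<open>sobolev_norm\<close> is built from \<open>SOME g. weak_derivative ...\<close>, so
  nothing can be estimated for a smooth form until the chosen function is known to agree almost
  everywhere with a classical derivative. This forces two classical facts: integration by parts
  (classical derivatives are weak derivatives) and the fundamental lemma of the calculus of
  variations (weak derivatives are unique up to null sets). Afterwards the seminorm enters only
  through its nonnegativity and the upper bound \<open>sobolev_norm_le\<close>. Continuity,
  boundedness of the derivative and the first-order remainder then become sup estimates for finitely
  many classical derivatives over a closed disc, and compactness of the disc supplies the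
  uniformity. The remainder must also be small uniformly in the direction \<open>h\<close>; as the
  parameter space is finite-dimensional, this reduces to the basis directions. The calculus of C^n
  maps is organised by the functions \<open>dir_deriv f h\<close> with \<open>h\<close> fixed,
  matching the recursion of \<open>Ck_into\<close>.\<close>

definition Ck_on :: "nat \<Rightarrow> 'a set \<Rightarrow> ('a::euclidean_space \<Rightarrow> 'b::real_normed_vector) \<Rightarrow> bool" where
  "Ck_on n W f \<longleftrightarrow> Ck_into n UNIV norm W f"

text \<open>The direction precedes the point, so that \<open>dir_deriv f h\<close> is again a
  function of the point and can be iterated. It is total; at points of non-differentiability its
  value is unspecified.\<close>

definition dir_deriv :: "('a::real_normed_vector \<Rightarrow> 'b::real_normed_vector) \<Rightarrow> 'a \<Rightarrow> 'a \<Rightarrow> 'b" where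
  "dir_deriv f h x = frechet_derivative f (at x) h"

lemma dir_deriv_eq: "(f has_derivative f') (at x) \<Longrightarrow> dir_deriv f h x = f' h"
  by (simp add: dir_deriv_def frechet_derivative_at[symmetric])

lemma dir_deriv_works: "f differentiable (at x) \<Longrightarrow> (f has_derivative (\<lambda>h. dir_deriv f h x)) (at x)"
  by (simp add: dir_deriv_def frechet_derivative_works[symmetric])

lemma dir_deriv_cong_open:
  assumes "open W" "x \<in> W" "\<And>y. y \<in> W \<Longrightarrow> f y = g y"
  shows "dir_deriv f h x = dir_deriv g h x"
proof -
  have "(f has_derivative D) (at x) \<longleftrightarrow> (g has_derivative D) (at x)" for D
    using has_derivative_transform_within_open[OF _ assms(1,2)] assms(3) by metis
  then show ?thesis by (simp add: dir_deriv_def frechet_derivative_def)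
qed

lemma Ck_on_0: "Ck_on 0 W f \<longleftrightarrow> continuous_on W f"
  unfolding Ck_on_def by (rule Ck_into_0_UNIV)

lemma Ck_on_Suc_iff_derivative:
  "Ck_on (Suc n) W f \<longleftrightarrow>
     (\<exists>f'. (\<forall>x\<in>W. (f has_derivative f' x) (at x)) \<and> (\<forall>h. Ck_on n W (\<lambda>x. f' x h)))"
  unfolding Ck_on_def Ck_into.simps has_frechet_derivative_in_UNIV by blast

lemma Ck_on_cong:
  assumes "open W"
  shows "\<lbrakk>Ck_on n W f; \<And>x. x \<in> W \<Longrightarrow> f x = g x\<rbrakk> \<Longrightarrow> Ck_on n W g"
proof (induction n arbitrary: f g)
  case 0
  then show ?case using continuous_on_cong[of W W f g] by (simp only: Ck_on_0)
next
  case (Suc n)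
  then obtain f' where f': "\<And>x. x \<in> W \<Longrightarrow> (f has_derivative f' x) (at x)" "\<And>h. Ck_on n W (\<lambda>x. f' x h)"
    unfolding Ck_on_Suc_iff_derivative by blast
  then have "(g has_derivative f' x) (at x)" if "x \<in> W" for x
    using has_derivative_transform_within_open[OF f'(1)[OF that] assms that] Suc.prems(2) by blast
  with f'(2) show ?case by (auto simp: Ck_on_Suc_iff_derivative)
qed

text \<open>Uniqueness of the derivative replaces the existentially quantified family by the
  canonical \<open>dir_deriv\<close>. The two agree on \<open>W\<close> only, so regularity is
  transferred with \<open>Ck_on_cong\<close>, which needs \<open>W\<close> open.\<close>

lemma Ck_on_Suc:
  assumes "open W"
  shows "Ck_on (Suc n) W f \<longleftrightarrow> (\<forall>x\<in>W. f differentiable (at x)) \<and> (\<forall>h. Ck_on n W (dir_deriv f h))"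
proof
  assume "Ck_on (Suc n) W f"
  then obtain f' where f': "\<And>x. x \<in> W \<Longrightarrow> (f has_derivative f' x) (at x)" "\<And>h. Ck_on n W (\<lambda>x. f' x h)"
    unfolding Ck_on_Suc_iff_derivative by blast
  have "Ck_on n W (dir_deriv f h)" for h
    using f'(1) by (intro Ck_on_cong[OF assms f'(2)[of h]]) (metis dir_deriv_eq)
  with f'(1) show "(\<forall>x\<in>W. f differentiable (at x)) \<and> (\<forall>h. Ck_on n W (dir_deriv f h))"
    unfolding differentiable_def by blast
next
  assume *: "(\<forall>x\<in>W. f differentiable (at x)) \<and> (\<forall>h. Ck_on n W (dir_deriv f h))"
  then show "Ck_on (Suc n) W f"
    by (auto simp: Ck_on_Suc_iff_derivative intro!: exI[of _ "\<lambda>x h. dir_deriv f h x"] dir_deriv_works)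
qed

lemma Ck_on_SucI:
  assumes "open W" "\<And>x. x \<in> W \<Longrightarrow> (f has_derivative f' x) (at x)" "\<And>h. Ck_on n W (\<lambda>x. f' x h)"
  shows "Ck_on (Suc n) W f"
  using assms by (auto simp: Ck_on_Suc_iff_derivative)

lemma Ck_on_SucD:
  assumes "Ck_on (Suc n) W f" "open W"
  shows "\<And>x. x \<in> W \<Longrightarrow> (f has_derivative (\<lambda>h. dir_deriv f h x)) (at x)" "Ck_on n W (dir_deriv f h)"
  using assms by (auto simp: Ck_on_Suc intro: dir_deriv_works)

lemma Ck_on_imp_continuous_on: "\<lbrakk>Ck_on n W f; open W\<rbrakk> \<Longrightarrow> continuous_on W f"
  by (cases n) (auto simp only: Ck_on_0 Ck_on_Suc differentiable_imp_continuous_within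
      intro!: continuous_at_imp_continuous_on)

lemma Ck_on_mono_Suc: "\<lbrakk>Ck_on (Suc n) W f; open W\<rbrakk> \<Longrightarrow> Ck_on n W f"
proof (induction n arbitrary: f)
  case 0
  then show ?case using Ck_on_imp_continuous_on by (simp only: Ck_on_0)
next
  case (Suc n)
  note D = Ck_on_SucD[OF Suc.prems]
  show ?case by (rule Ck_on_SucI[OF Suc.prems(2) D(1) Suc.IH[OF D(2) Suc.prems(2)]])
qed

text \<open>The local derivatives need no gluing: \<open>Ck_on_Suc\<close> expresses them all
  through the one globally defined function \<open>dir_deriv f h\<close>.\<close>

lemma Ck_on_local:
  assumes "open W"
  shows "(\<And>x. x \<in> W \<Longrightarrow> \<exists>U. open U \<and> x \<in> U \<and> Ck_on n U f) \<Longrightarrow> Ck_on n W f"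
proof (induction n arbitrary: f)
  case 0
  then have "\<exists>U. open U \<and> x \<in> U \<and> continuous_on U f" if "x \<in> W" for x
    using that unfolding Ck_on_0 by blast
  then show ?case unfolding Ck_on_0
    by (intro continuous_at_imp_continuous_on ballI) (meson continuous_on_eq_continuous_at)
next
  case (Suc n)
  show ?case
    unfolding Ck_on_Suc[OF assms]
  proof (intro conjI ballI allI Suc.IH)
    fix x assume "x \<in> W"
    then obtain U where U: "open U" "x \<in> U" "Ck_on (Suc n) U f" using Suc.prems by metis
    then show "f differentiable at x" by (simp add: Ck_on_Suc)
  next
    fix h x assume "x \<in> W"
    then obtain U where U: "open U" "x \<in> U" "Ck_on (Suc n) U f" using Suc.prems by metis
    then have "Ck_on n U (dir_deriv f h)" by (simp add: Ck_on_Suc)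
    with U show "\<exists>U. open U \<and> x \<in> U \<and> Ck_on n U (dir_deriv f h)" by blast
  qed
qed

lemma Ck_on_const [simp, intro]: "Ck_on n W (\<lambda>x. c)"
proof (induction n arbitrary: c)
  case 0
  then show ?case by (simp only: Ck_on_0 continuous_on_const)
next
  case (Suc n)
  then show ?case by (auto simp: Ck_on_Suc_iff_derivative intro!: exI[of _ "\<lambda>x h. 0"])
qed

lemma Ck_on_bounded_linear:
  assumes W: "open W" and L: "bounded_linear L"
  shows "Ck_on n W f \<Longrightarrow> Ck_on n W (\<lambda>x. L (f x))"
proof (induction n arbitrary: f)
  case 0
  then show ?case unfolding Ck_on_0 by (rule bounded_linear.continuous_on[OF L])
next
  case (Suc n)
  note D = Ck_on_SucD[OF Suc.prems W]
  show ?case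
    by (rule Ck_on_SucI[OF W bounded_linear.has_derivative[OF L D(1)]]) (auto intro: Suc.IH D)
qed

lemma Ck_on_ident [intro]:
  assumes "open W" shows "Ck_on n W (\<lambda>x. x)"
  by (cases n) (auto simp only: Ck_on_0 continuous_on_id intro!: Ck_on_SucI[OF assms has_derivative_ident])

lemma Ck_on_linear: "\<lbrakk>open W; bounded_linear L\<rbrakk> \<Longrightarrow> Ck_on n W L"
  using Ck_on_bounded_linear[of W L n "\<lambda>x. x"] Ck_on_ident by blast

lemma Ck_on_add:
  assumes W: "open W"
  shows "\<lbrakk>Ck_on n W f; Ck_on n W g\<rbrakk> \<Longrightarrow> Ck_on n W (\<lambda>x. f x + g x)"
proof (induction n arbitrary: f g)
  case 0
  then show ?case unfolding Ck_on_0 by (rule continuous_on_add)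
next
  case (Suc n)
  note D = Ck_on_SucD[OF Suc.prems(1) W] Ck_on_SucD[OF Suc.prems(2) W]
  show ?case
    by (rule Ck_on_SucI[OF W has_derivative_add[OF D(1,3)]]) (auto intro: Suc.IH D)
qed

text \<open>In the product rule each term keeps one factor undifferentiated; that factor is lowered
  from order \<open>Suc n\<close> to \<open>n\<close> before the induction hypothesis
  applies.\<close>

lemma Ck_on_bilinear:
  assumes W: "open W" and B: "bounded_bilinear B"
  shows "\<lbrakk>Ck_on n W f; Ck_on n W g\<rbrakk> \<Longrightarrow> Ck_on n W (\<lambda>x. B (f x) (g x))"
proof (induction n arbitrary: f g)
  case 0
  then show ?case unfolding Ck_on_0 by (rule bounded_bilinear.continuous_on[OF B])
next
  case (Suc n)
  note D = Ck_on_SucD[OF Suc.prems(1) W] Ck_on_SucD[OF Suc.prems(2) W]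
  show ?case
    by (rule Ck_on_SucI[OF W bounded_bilinear.FDERIV[OF B D(1,3)]])
       (auto intro!: Ck_on_add[OF W] Suc.IH D Ck_on_mono_Suc[OF Suc.prems(1) W] Ck_on_mono_Suc[OF Suc.prems(2) W]
        )
qed

lemmas Ck_on_mult = Ck_on_bilinear[OF _ bounded_bilinear_mult]
lemmas Ck_on_scaleR = Ck_on_bilinear[OF _ bounded_bilinear_scaleR]

lemma Ck_on_minus: "\<lbrakk>open W; Ck_on n W f\<rbrakk> \<Longrightarrow> Ck_on n W (\<lambda>x. - f x)"
  by (rule Ck_on_bounded_linear[OF _ bounded_linear_minus[OF bounded_linear_ident]])

lemma Ck_on_diff: "\<lbrakk>open W; Ck_on n W f; Ck_on n W g\<rbrakk> \<Longrightarrow> Ck_on n W (\<lambda>x. f x - g x)"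
  using Ck_on_add[of W n f "\<lambda>x. - g x"] Ck_on_minus by auto

lemma Ck_on_power:
  fixes f :: "'a::euclidean_space \<Rightarrow> 'b::real_normed_algebra_1"
  shows "\<lbrakk>open W; Ck_on n W f\<rbrakk> \<Longrightarrow> Ck_on n W (\<lambda>x. f x ^ m)"
  by (induction m) (auto intro: Ck_on_mult)

lemma Ck_on_sum:
  assumes "open W" "\<And>i. i \<in> I \<Longrightarrow> Ck_on n W (f i)"
  shows "Ck_on n W (\<lambda>x. \<Sum>i\<in>I. f i x)"
  using assms(2) by (induction I rule: infinite_finite_induct) (auto intro: Ck_on_add[OF assms(1)])

text \<open>The chain rule produces the derivative of \<open>f\<close> in the direction
  \<open>dir_deriv g h x\<close>, which varies with \<open>x\<close>, whereas the induction
  hypothesis covers fixed directions only. Expanding this direction in \<open>Basis\<close> leaves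
  scalar coefficients times \<open>dir_deriv f b (g x)\<close> with \<open>b\<close> fixed; this is
  why the middle space is Euclidean.\<close>

lemma Ck_on_compose:
  fixes g :: "'a::euclidean_space \<Rightarrow> 'c::euclidean_space" and f :: "'c \<Rightarrow> 'b::real_normed_vector"
  assumes W: "open W" and V: "open V" and gW: "g ` W \<subseteq> V"
  shows "\<lbrakk>Ck_on n V f; Ck_on n W g\<rbrakk> \<Longrightarrow> Ck_on n W (\<lambda>x. f (g x))"
proof (induction n arbitrary: f)
  case 0
  then show ?case unfolding Ck_on_0 using gW by (auto intro: continuous_on_compose2)
next
  case (Suc n)
  note D = Ck_on_SucD[OF Suc.prems(1) V] Ck_on_SucD[OF Suc.prems(2) W]
  have "((\<lambda>x. f (g x)) has_derivative (\<lambda>h. \<Sum>b\<in>Basis. (dir_deriv g h x \<bullet> b) *\<^sub>R dir_deriv f b (g x))) (at x)"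
    if x: "x \<in> W" for x
  proof -
    have fd: "(f has_derivative (\<lambda>h. dir_deriv f h (g x))) (at (g x))" using x gW by (intro D) auto
    then have "linear (\<lambda>h. dir_deriv f h (g x))" by (rule has_derivative_linear)
    then have "(\<Sum>b\<in>Basis. (k \<bullet> b) *\<^sub>R dir_deriv f b (g x)) = dir_deriv f k (g x)" for k
      using linear_sum[of "\<lambda>h. dir_deriv f h (g x)" "\<lambda>b. (k \<bullet> b) *\<^sub>R b" Basis]
      using linear_cmul[OF \<open>linear (\<lambda>h. dir_deriv f h (g x))\<close>] by (simp add: euclidean_representation)
    with has_derivative_compose[OF D(3)[OF x] fd] show ?thesis by simp
  qed
  then show ?case
    by (rule Ck_on_SucI[OF W])
       (auto intro!: Ck_on_sum[OF W] Ck_on_scaleR[OF W] Suc.IH D Ck_on_mono_Suc[OF Suc.prems(2) W]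
         Ck_on_bounded_linear[OF W bounded_linear_inner_left])
qed

lemma Ck_on_inverse:
  fixes f :: "'a::euclidean_space \<Rightarrow> 'b::real_normed_div_algebra"
  assumes W: "open W" and nz: "\<And>x. x \<in> W \<Longrightarrow> f x \<noteq> 0"
  shows "Ck_on n W f \<Longrightarrow> Ck_on n W (\<lambda>x. inverse (f x))"
proof (induction n)
  case 0
  then show ?case unfolding Ck_on_0 using nz by (intro continuous_intros) auto
next
  case (Suc n)
  note D = Ck_on_SucD[OF Suc.prems(1) W]
  note IH = Suc.IH[OF Ck_on_mono_Suc[OF Suc.prems W]]
  \<comment> \<open>The sign is kept as a factor \<open>-1\<close> so that the derivative is a pure
    product and \<open>Ck_on_mult\<close> applies; the simp rules that would absorb it are switched
    off below.\<close>
  have "((\<lambda>x. inverse (f x)) has_derivative (\<lambda>h. -1 * (inverse (f x) * dir_deriv f h x * inverse (f x)))) (at x)"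
    if "x \<in> W" for x
    using Deriv.has_derivative_inverse[OF nz[OF that] D(1)[OF that]] by simp
  then show ?case
    by (rule Ck_on_SucI[OF W]) (auto intro!: Ck_on_mult[OF W] IH D simp del: mult_minus1 mult_minus_left mult_1)
qed

lemma smooth_on_def: "smooth_on W f \<longleftrightarrow> (\<forall>n. Ck_on n W f)"
  unfolding Ck_on_def by (rule smooth_into_def)

lemma smooth_onI: "(\<And>n. Ck_on n W f) \<Longrightarrow> smooth_on W f"
  and smooth_onD: "smooth_on W f \<Longrightarrow> Ck_on n W f"
  by (auto simp only: smooth_on_def)

lemma smooth_on_imp_differentiable: "\<lbrakk>smooth_on W f; open W; x \<in> W\<rbrakk> \<Longrightarrow> f differentiable (at x)"
  using smooth_onD Ck_on_Suc by metis

lemma smooth_on_imp_continuous_on: "\<lbrakk>smooth_on W f; open W\<rbrakk> \<Longrightarrow> continuous_on W f"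
  using smooth_onD Ck_on_imp_continuous_on by metis

lemma smooth_on_dir_deriv: "\<lbrakk>smooth_on W f; open W\<rbrakk> \<Longrightarrow> smooth_on W (dir_deriv f h)"
  by (rule smooth_onI) (metis smooth_onD Ck_on_Suc)

text \<open>A class of differentiable functions closed under directional derivatives, up to equality
  on \<open>W\<close>, consists of smooth functions: closure lets every order be peeled off by
  induction.\<close>

lemma smooth_on_coinduct:
  assumes W: "open W" and P: "P f"
    and step: "\<And>f. P f \<Longrightarrow> (\<forall>x\<in>W. f differentiable (at x)) \<and> (\<forall>h. \<exists>g. P g \<and> (\<forall>x\<in>W. dir_deriv f h x = g x))"
  shows "smooth_on W f"
proof -
  have "P f \<Longrightarrow> Ck_on n W f" for n f
  proof (induction n arbitrary: f)
    case 0
    then show ?case unfolding Ck_on_0 using step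
      by (intro continuous_at_imp_continuous_on ballI differentiable_imp_continuous_within) auto
  next
    case (Suc n)
    then show ?case unfolding Ck_on_Suc[OF W] using step Ck_on_cong[OF W] by metis
  qed
  with P show ?thesis by (intro smooth_onI)
qed

text \<open>The second difference is symmetric in \<open>h\<close> and \<open>k\<close>, whence the symmetry of second derivatives.\<close>

lemma second_difference_approx:
  assumes W: "open W" "x \<in> W" and f: "\<And>y. y \<in> W \<Longrightarrow> f differentiable (at y)"
    and fk: "dir_deriv f k differentiable (at x)" and e: "e > 0"
  obtains d where "d > 0"
    "\<And>s. \<lbrakk>0 < s; s < d\<rbrakk> \<Longrightarrow> norm (f (x + s *\<^sub>R h + s *\<^sub>R k) - f (x + s *\<^sub>R h) - f (x + s *\<^sub>R k) + f x
       - s\<^sup>2 *\<^sub>R dir_deriv (dir_deriv f k) h x) \<le> e * s\<^sup>2"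
proof -
  define g where "g = dir_deriv f k"
  define L where "L v = dir_deriv g v x" for v
  \<comment> \<open>All points used below lie within \<open>s * M\<close> of \<open>x\<close>; the
    summand 1 keeps \<open>M\<close> positive when \<open>h = k = 0\<close>.\<close>
  define M where "M = norm h + norm k + 1"
  have M: "M > 0" "norm h + norm k \<le> M" by (auto simp: M_def add_nonneg_pos)
  have L: "(g has_derivative L) (at x)"
    using dir_deriv_works[OF fk] by (simp add: g_def L_def[abs_def])
  then have linL: "linear L" by (rule has_derivative_linear)
  have "e / (2 * M) > 0" using e M by simp
  then have "\<exists>d>0. \<forall>y. norm (y - x) < d \<longrightarrow> norm (g y - g x - L (y - x)) \<le> e / (2 * M) * norm (y - x)"
    using L unfolding has_derivative_at_alt by blast
  then obtain d1 where d1: "d1 > 0" "\<And>y. norm (y - x) < d1 \<Longrightarrow> norm (g y - g x - L (y - x)) \<le> e / (2 * M) * norm (y - x)"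
    by blast
  obtain d0 where d0: "d0 > 0" "ball x d0 \<subseteq> W" using W openE by blast
  define d where "d = min d0 d1 / M"
  have "d > 0" using d0 d1 M by (simp add: d_def)
  moreover have "norm (f (x + s *\<^sub>R h + s *\<^sub>R k) - f (x + s *\<^sub>R h) - f (x + s *\<^sub>R k) + f x
       - s\<^sup>2 *\<^sub>R dir_deriv (dir_deriv f k) h x) \<le> e * s\<^sup>2" if s: "0 < s" "s < d" for s
  proof -
    have sM: "s * M < d0" "s * M < d1" using s M by (auto simp: d_def field_simps)
    define p where "p c t = c *\<^sub>R h + t *\<^sub>R k" for c t :: real
    have np: "norm (p c t) \<le> s * M" if "c \<in> {0, s}" "t \<in> {0..s}" for c t
    proof -
      have "norm (p c t) \<le> s * norm h + s * norm k"
        unfolding p_def using that s by (intro norm_triangle_mono) (auto intro: mult_right_mono)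
      also have "\<dots> \<le> s * M" using s M by (simp flip: distrib_left)
      finally show ?thesis .
    qed
    have bd: "norm (g (x + p c t) - g x - L (p c t)) \<le> e / 2 * s" if "c \<in> {0, s}" "t \<in> {0..s}" for c t
    proof -
      have "norm (g (x + p c t) - g x - L (p c t)) \<le> e / (2 * M) * norm (p c t)"
        using d1(2)[of "x + p c t"] np[OF that] sM by simp
      also have "\<dots> \<le> e / (2 * M) * (s * M)" using np[OF that] e M by (intro mult_left_mono) auto
      finally show ?thesis using M by (simp add: field_simps)
    qed
    have fd: "((\<lambda>t. f (x + p c t)) has_vector_derivative g (x + p c t)) (at t within {0..s})"
      if "c \<in> {0, s}" "t \<in> {0..s}" for c t
    proof -
      have "x + p c t \<in> W" using np[OF that] sM d0 by (auto simp: dist_norm subset_iff)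
      from dir_deriv_works[OF f[OF this]]
      have D: "(f has_derivative (\<lambda>h. dir_deriv f h (x + p c t))) (at (x + p c t))" .
      have "((\<lambda>t. x + p c t) has_derivative (\<lambda>r. r *\<^sub>R k)) (at t within {0..s})"
        unfolding p_def by (auto intro!: derivative_eq_intros)
      from has_derivative_compose[OF this D]
      have "((\<lambda>t. f (x + p c t)) has_derivative (\<lambda>r. dir_deriv f (r *\<^sub>R k) (x + p c t))) (at t within {0..s})" .
      then show ?thesis
        using linear_cmul[OF has_derivative_linear[OF D]] by (simp add: has_vector_derivative_def g_def)
    qed
    \<comment> \<open>The mean value inequality is applied in the direction \<open>k\<close> only.
      The derivative of \<open>G\<close> is
      \<open>g (x + p s t) - g (x + p 0 t) - s *\<^sub>R L h\<close>, and differentiability of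
      \<open>g\<close> at the single point \<open>x\<close> bounds it by \<open>e * s\<close>; over
      an interval of length \<open>s\<close> this gives \<open>e * s\<^sup>2\<close>.\<close>
    define G where "G t = f (x + p s t) - f (x + p 0 t) - (t * s) *\<^sub>R L h" for t
    have "norm (G s - G 0) \<le> (e * s) * norm (s - 0)"
    proof (rule differentiable_bound[of "{0..s}" G "\<lambda>t r. r *\<^sub>R (g (x + p s t) - g (x + p 0 t) - s *\<^sub>R L h)"])
      fix t assume t: "t \<in> {0..s}"
      have "(G has_vector_derivative (g (x + p s t) - g (x + p 0 t) - s *\<^sub>R L h)) (at t within {0..s})"
        unfolding G_def
      proof (rule has_vector_derivative_diff)
        show "((\<lambda>t. f (x + p s t) - f (x + p 0 t)) has_vector_derivative g (x + p s t) - g (x + p 0 t)) (at t within {0..s})"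
          by (intro has_vector_derivative_diff fd) (use t s in auto)
        show "((\<lambda>t. (t * s) *\<^sub>R L h) has_vector_derivative s *\<^sub>R L h) (at t within {0..s})"
          by (auto intro!: derivative_eq_intros simp: has_vector_derivative_def)
      qed
      then show "(G has_derivative (\<lambda>r. r *\<^sub>R (g (x + p s t) - g (x + p 0 t) - s *\<^sub>R L h))) (at t within {0..s})"
        by (simp add: has_vector_derivative_def)
      have "L (p s t) - L (p 0 t) = s *\<^sub>R L h"
        by (simp add: p_def linear_add[OF linL] linear_cmul[OF linL])
      then have "g (x + p s t) - g (x + p 0 t) - s *\<^sub>R L h
          = (g (x + p s t) - g x - L (p s t)) - (g (x + p 0 t) - g x - L (p 0 t))"
        by (simp add: algebra_simps)
      also have "norm \<dots> \<le> e / 2 * s + e / 2 * s"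
        by (rule order_trans[OF norm_triangle_ineq4 add_mono]; rule bd) (use t in auto)
      finally have "norm (g (x + p s t) - g (x + p 0 t) - s *\<^sub>R L h) \<le> e * s" by simp
      then show "onorm (\<lambda>r. r *\<^sub>R (g (x + p s t) - g (x + p 0 t) - s *\<^sub>R L h)) \<le> e * s"
        by (intro onorm_le) (auto simp: mult.commute intro: mult_left_mono)
    qed (use s in auto)
    moreover have "G s - G 0 = f (x + s *\<^sub>R h + s *\<^sub>R k) - f (x + s *\<^sub>R h) - f (x + s *\<^sub>R k) + f x - s\<^sup>2 *\<^sub>R L h"
      by (simp add: G_def p_def algebra_simps power2_eq_square)
    ultimately show ?thesis using s by (simp add: L_def g_def power2_eq_square)
  qed
  ultimately show ?thesis using that by blast
qed

lemma dir_deriv_commute: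
  assumes f: "Ck_on 2 W f" and W: "open W" "x \<in> W"
  shows "dir_deriv (dir_deriv f h) k x = dir_deriv (dir_deriv f k) h x"
proof -
  have f1: "f differentiable (at y)" if "y \<in> W" for y
    using f W that by (simp add: numeral_2_eq_2 Ck_on_Suc)
  have f2: "dir_deriv f h differentiable (at x)" for h
    using f W by (simp add: numeral_2_eq_2 Ck_on_Suc)
  define A B where "A = dir_deriv (dir_deriv f k) h x" and "B = dir_deriv (dir_deriv f h) k x"
  have "norm (A - B) \<le> 2 * e" if e: "e > 0" for e
  proof -
    obtain d1 where d1: "d1 > 0" "\<And>s. \<lbrakk>0 < s; s < d1\<rbrakk> \<Longrightarrow> norm (f (x + s *\<^sub>R h + s *\<^sub>R k) - f (x + s *\<^sub>R h) - f (x + s *\<^sub>R k) + f x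
       - s\<^sup>2 *\<^sub>R A) \<le> e * s\<^sup>2"
      using second_difference_approx[OF W f1 f2 e] unfolding A_def by metis
    obtain d2 where d2: "d2 > 0" "\<And>s. \<lbrakk>0 < s; s < d2\<rbrakk> \<Longrightarrow> norm (f (x + s *\<^sub>R k + s *\<^sub>R h) - f (x + s *\<^sub>R k) - f (x + s *\<^sub>R h) + f x
       - s\<^sup>2 *\<^sub>R B) \<le> e * s\<^sup>2"
      using second_difference_approx[OF W f1 f2 e] unfolding B_def by metis
    define s where "s = min d1 d2 / 2"
    have s: "0 < s" "s < d1" "s < d2" using d1 d2 by (auto simp: s_def)
    define D where "D = f (x + s *\<^sub>R h + s *\<^sub>R k) - f (x + s *\<^sub>R h) - f (x + s *\<^sub>R k) + f x"
    have D1: "norm (D - s\<^sup>2 *\<^sub>R A) \<le> e * s\<^sup>2" using d1 s by (simp add: D_def)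
    have "D = f (x + s *\<^sub>R k + s *\<^sub>R h) - f (x + s *\<^sub>R k) - f (x + s *\<^sub>R h) + f x"
      by (simp add: D_def algebra_simps)
    then have D2: "norm (D - s\<^sup>2 *\<^sub>R B) \<le> e * s\<^sup>2" using d2 s by simp
    have "s\<^sup>2 * norm (A - B) = norm (s\<^sup>2 *\<^sub>R (A - B))" by simp
    also have "s\<^sup>2 *\<^sub>R (A - B) = (D - s\<^sup>2 *\<^sub>R B) - (D - s\<^sup>2 *\<^sub>R A)" by (simp add: algebra_simps)
    also have "norm \<dots> \<le> e * s\<^sup>2 + e * s\<^sup>2" using D1 D2 by (intro order_trans[OF norm_triangle_ineq4]) auto
    finally have "s\<^sup>2 * norm (A - B) \<le> s\<^sup>2 * (2 * e)" by (simp add: algebra_simps)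
    then show ?thesis using s by simp
  qed
  then have "norm (A - B) \<le> e" if "e > 0" for e using that[THEN half_gt_zero] by fastforce
  then have "norm (A - B) \<le> 0" by (metis dense_ge)
  then show ?thesis by (simp add: A_def B_def)
qed

section \<open>Test functions and the fundamental lemma of the calculus of variations\<close>

text \<open>For \<open>p = 1\<close> this is the classical flat function exp(-1/t). The polynomial
  factor in 1/t makes the family closed under differentiation.\<close>

definition flat_fun :: "real poly \<Rightarrow> real \<Rightarrow> real" where
  "flat_fun p t = (if t > 0 then poly p (1 / t) * exp (- (1 / t)) else 0)"

lemma poly_mult_exp_neg_tendsto_0: "((\<lambda>s. poly p s * exp (- s)) \<longlongrightarrow> (0::real)) at_top"
proof -
  have "((\<lambda>s. \<Sum>i\<le>degree p. Polynomial.coeff p i * (s ^ i / exp s)) \<longlongrightarrow> (\<Sum>i\<le>degree p. Polynomial.coeff p i * 0)) at_top"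
    by (intro tendsto_intros tendsto_power_div_exp_0)
  then show ?thesis
    by (simp add: poly_altdef sum_divide_distrib exp_minus field_simps)
qed

text \<open>With s = 1/t one has d/dt = -s^2 d/ds, and d/ds (p e^(-s)) = (p' - p) e^(-s); this gives
  the polynomial s^2 (p - p'), where \<open>[:0, 0, 1:]\<close> is s^2. At 0 the right difference
  quotient is s p(s) e^(-s), which tends to 0 as s grows.\<close>

lemma flat_fun_has_derivative:
  "(flat_fun p has_field_derivative flat_fun ([:0, 0, 1:] * (p - pderiv p)) t) (at t)"
proof -
  consider "t > 0" | "t < 0" | "t = 0" by linarith
  then show ?thesis
  proof cases
    case 1
    have "((\<lambda>t. poly p (1 / t) * exp (- (1 / t))) has_field_derivative flat_fun ([:0, 0, 1:] * (p - pderiv p)) t) (at t)"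
      using 1 by (auto intro!: derivative_eq_intros DERIV_chain2[OF poly_DERIV] simp: flat_fun_def field_simps power2_eq_square)
    then show ?thesis
      by (rule has_field_derivative_transform_within_open[where S = "{0<..}"]) (use 1 in \<open>auto simp: flat_fun_def\<close>)
  next
    case 2
    have "((\<lambda>t. 0) has_field_derivative flat_fun ([:0, 0, 1:] * (p - pderiv p)) t) (at t)"
      using 2 by (auto simp: flat_fun_def)
    then show ?thesis
      by (rule has_field_derivative_transform_within_open[where S = "{..<0}"]) (use 2 in \<open>auto simp: flat_fun_def\<close>)
  next
    case 3
    have "((\<lambda>h. flat_fun p h / h) \<longlongrightarrow> 0) (at_right 0)"
    proof -
      have "((\<lambda>h. poly (pCons 0 p) (inverse h) * exp (- inverse h)) \<longlongrightarrow> 0) (at_right 0)"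
        by (rule filterlim_compose[OF poly_mult_exp_neg_tendsto_0 filterlim_inverse_at_top_right])
      then show ?thesis
        by (rule Lim_transform_eventually) (auto simp: eventually_at_right_less flat_fun_def field_simps intro!: eventually_at_rightI[of 0 1])
    qed
    moreover have "((\<lambda>h. flat_fun p h / h) \<longlongrightarrow> 0) (at_left 0)"
      by (rule tendsto_eventually) (auto simp: flat_fun_def intro!: eventually_at_leftI[of "-1" 0])
    ultimately show ?thesis
      using 3 by (auto simp: has_field_derivative_iff flat_fun_def filterlim_split_at)
  qed
qed

lemma smooth_on_flat_fun: "smooth_on UNIV (flat_fun p)"
proof (rule smooth_on_coinduct[where P = "\<lambda>f. \<exists>p. f = flat_fun p"])
  fix f :: "real \<Rightarrow> real" assume "\<exists>p. f = flat_fun p"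
  then obtain p where f: "f = flat_fun p" by blast
  define q where "q = [:0, 0, 1:] * (p - pderiv p)"
  have D: "(f has_field_derivative flat_fun q t) (at t)" for t
    unfolding f q_def by (rule flat_fun_has_derivative)
  have "dir_deriv f h t = flat_fun (smult h q) t" for h t
    using dir_deriv_eq[OF D[unfolded has_field_derivative_def]] by (simp add: flat_fun_def)
  then show "(\<forall>x\<in>UNIV. f differentiable at x) \<and> (\<forall>h. \<exists>g. (\<exists>p. g = flat_fun p) \<and> (\<forall>x\<in>UNIV. dir_deriv f h x = g x))"
    using D by (metis field_differentiable_imp_differentiable field_differentiable_def)
qed auto

text \<open>One factor exp(-1/t) for each side of the box, with t the signed distance to that side.
  Every factor is below 1, whence the strict bound that makes the powers of
  \<open>1 - \<beta> z\<close> tend to 0 inside the box.\<close>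

lemma exists_box_bump:
  obtains \<beta> :: "complex \<Rightarrow> real"
  where "smooth_on UNIV \<beta>" "\<And>z. z \<in> box a b \<Longrightarrow> 0 < \<beta> z \<and> \<beta> z < 1" "\<And>z. z \<notin> box a b \<Longrightarrow> \<beta> z = 0"
proof -
  define e where "e = flat_fun 1"
  have e: "e t > 0 \<longleftrightarrow> t > 0" "e t \<ge> 0" "e t < 1" "e t = 0 \<longleftrightarrow> t \<le> 0" for t by (auto simp: e_def flat_fun_def)
  define \<beta> where "\<beta> z = e (Re z - Re a) * e (Re b - Re z) * (e (Im z - Im a) * e (Im b - Im z))" for z
  have e_comp: "Ck_on n UNIV (\<lambda>z::complex. e (g z))" if "Ck_on n UNIV g" for g n
    unfolding e_def by (rule Ck_on_compose[OF open_UNIV open_UNIV _ smooth_onD[OF smooth_on_flat_fun] that]) simp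
  have "Ck_on n UNIV (\<lambda>z. Re z - Re a)" "Ck_on n UNIV (\<lambda>z. Re b - Re z)"
    "Ck_on n UNIV (\<lambda>z. Im z - Im a)" "Ck_on n UNIV (\<lambda>z. Im b - Im z)" for n
    by (intro Ck_on_diff Ck_on_const Ck_on_linear[OF _ bounded_linear_Re] Ck_on_linear[OF _ bounded_linear_Im] open_UNIV)+
  then have "smooth_on UNIV \<beta>" unfolding \<beta>_def
    by (intro smooth_onI Ck_on_mult e_comp) auto
  moreover have "0 < \<beta> z \<and> \<beta> z < 1" if "z \<in> box a b" for z
  proof -
    have lt: "x * y < 1" if "x < 1" "y < 1" "0 \<le> x" "0 \<le> y" for x y :: real
      using mult_strict_mono[of x 1 y 1] that by simp
    show ?thesis using that unfolding \<beta>_def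
      by (auto simp: in_box_complex_iff e intro!: mult_pos_pos lt mult_nonneg_nonneg)
  qed
  moreover have "\<beta> z = 0" if "z \<notin> box a b" for z
    using that by (auto simp: \<beta>_def in_box_complex_iff e not_less)
  ultimately show ?thesis using that by blast
qed

lemma test_function_box_approx:
  assumes "cbox a b \<subseteq> \<Omega>"
  obtains \<phi> :: "nat \<Rightarrow> complex \<Rightarrow> real"
  where "\<And>n. test_function \<Omega> (\<phi> n)" "\<And>n z. \<bar>\<phi> n z\<bar> \<le> indicator (cbox a b) z" 
    "\<And>z. (\<lambda>n. \<phi> n z) \<longlonglongrightarrow> indicator (box a b) z"
proof -
  obtain \<beta> :: "complex \<Rightarrow> real" where \<beta>: "smooth_on UNIV \<beta>"
    "\<And>z. z \<in> box a b \<Longrightarrow> 0 < \<beta> z \<and> \<beta> z < 1" "\<And>z. z \<notin> box a b \<Longrightarrow> \<beta> z = 0"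
    using exists_box_bump by blast
  \<comment> \<open>a polynomial in the bump function \<open>\<beta>\<close>, with \<open>0 < \<beta> < 1\<close> on the box, tending to 1 there\<close>
  define \<phi> where "\<phi> n z = 1 - (1 - \<beta> z) ^ n" for n z
  have "Ck_on k UNIV (\<phi> n)" for k n
    unfolding \<phi>_def[abs_def] by (intro Ck_on_diff Ck_on_power smooth_onD[OF \<beta>(1)]) auto
  then have sm: "smooth_on UNIV (\<phi> n)" for n
    by (rule smooth_onI)
  have sub: "{z. \<phi> n z \<noteq> 0} \<subseteq> cbox a b" for n
    using \<beta>(3) box_subset_cbox by (force simp: \<phi>_def)
  then have cl: "closure {z. \<phi> n z \<noteq> 0} \<subseteq> cbox a b" for n
    by (meson closed_cbox closure_minimal)
  then have "compact (closure {z. \<phi> n z \<noteq> 0})" for n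
    by (meson bounded_cbox bounded_subset closed_closure compact_eq_bounded_closed)
  with sm cl assms have "test_function \<Omega> (\<phi> n)" for n
    by (auto simp: test_function_def)
  moreover have "\<bar>\<phi> n z\<bar> \<le> indicator (cbox a b) z" for n z
  proof (cases "z \<in> box a b")
    case True
    then have "0 \<le> (1 - \<beta> z) ^ n" "(1 - \<beta> z) ^ n \<le> 1" using \<beta>(2) by (auto intro!: power_le_one simp: less_imp_le)
    then show ?thesis using True box_subset_cbox by (auto simp: \<phi>_def indicator_def)
  qed (use \<beta>(3) in \<open>auto simp: \<phi>_def\<close>)
  moreover have "(\<lambda>n. \<phi> n z) \<longlonglongrightarrow> indicator (box a b) z" for z
  proof (cases "z \<in> box a b")
    case True
    then have "(\<lambda>n. 1 - (1 - \<beta> z) ^ n) \<longlonglongrightarrow> 1 - 0"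
      using \<beta>(2)[OF True] by (intro tendsto_intros LIMSEQ_power_zero) auto
    then show ?thesis using True by (simp add: \<phi>_def)
  qed (use \<beta>(3) in \<open>auto simp: \<phi>_def\<close>)
  ultimately show ?thesis using that by blast
qed

section \<open>Vanishing of functions whose integrals vanish on boxes or against test
  functions\<close>

lemma sigma_finite_lebesgue: "sigma_finite_measure (lebesgue :: 'a::euclidean_space measure)"
proof
  have "\<exists>n. x \<in> cball 0 (real n)" for x :: 'a
    using real_arch_simple[of "norm x"] by simp
  then have "(\<Union>n. cball (0::'a) (real n)) = UNIV" by blast
  then show "\<exists>A::'a set set. countable A \<and> A \<subseteq> sets lebesgue \<and> \<Union>A = space lebesgue \<and> (\<forall>a\<in>A. emeasure lebesgue a \<noteq> \<infinity>)"
    by (intro exI[of _ "range (\<lambda>n. cball (0::'a) (real n))"] conjI)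
       (auto, metis emeasure_lborel_cball_finite infinity_ennreal_def less_irrefl)
qed

text \<open>A pi-lambda argument: open boxes are stable under intersection and generate the Borel
  sets, and the vanishing total integral \<open>k0\<close> provides the complement step. Once the
  integrals over all measurable sets vanish, uniqueness of densities applies.\<close>

lemma AE_zero_if_box_integrals_zero:
  fixes k :: "'a::euclidean_space \<Rightarrow> 'b::{banach, second_countable_topology}"
  assumes k: "integrable lebesgue k" and k0: "integral\<^sup>L lebesgue k = 0"
    and box: "\<And>c d. set_lebesgue_integral lebesgue (box c d) k = 0"
  shows "AE z in lebesgue. k z = 0"
proof -
  have si: "set_integrable lebesgue A k" if "A \<in> sets lebesgue" for A
    using k that unfolding set_integrable_def by (rule integrable_mult_indicator[rotated])
  have borel: "set_lebesgue_integral lebesgue A k = 0" if A: "A \<in> sets borel" for A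
  proof -
    have "Int_stable (range (\<lambda>(c, d). box c d :: 'a set))"
      by (auto simp: Int_stable_def box_Int_box)
    moreover have "range (\<lambda>(c, d). box c d :: 'a set) \<subseteq> Pow UNIV" by auto
    moreover have "A \<in> sigma_sets UNIV (range (\<lambda>(c, d). box c d))"
      using A unfolding borel_eq_box by simp
    ultimately show ?thesis
    proof (induction rule: sigma_sets_induct_disjoint)
      case (basic A) then show ?case using box by auto
    next
      case empty then show ?case by (simp add: set_lebesgue_integral_def)
    next
      case (compl A)
      then have "A \<in> sets borel" unfolding borel_eq_box by simp
      then have A: "A \<in> sets lebesgue" by simp
      have "set_lebesgue_integral lebesgue (UNIV - A \<union> A) k
          = set_lebesgue_integral lebesgue (UNIV - A) k + set_lebesgue_integral lebesgue A k"
        using A by (intro set_integral_Un si) auto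
      then show ?case using compl k0 by (simp add: set_lebesgue_integral_def)
    next
      case (union F)
      then have "F i \<in> sets borel" for i unfolding borel_eq_box by auto
      then have F: "F i \<in> sets lebesgue" for i by simp
      have "set_lebesgue_integral lebesgue (\<Union>i. F i) k = (\<Sum>i. set_lebesgue_integral lebesgue (F i) k)"
        using F union.hyps(1) by (intro lebesgue_integral_countable_add si) (auto simp: disjoint_family_on_def)
      then show ?case using union by simp
    qed
  qed
  \<comment> \<open>A Lebesgue set is a Borel set up to a subset of a null set, which does not
    change the integral.\<close>
  have "set_lebesgue_integral lebesgue A k = 0" if A: "A \<in> sets lebesgue" for A
  proof -
    obtain S N N' where S: "A = S \<union> N" "N \<subseteq> N'" "N' \<in> null_sets lborel" "S \<in> sets lborel"
      using completionE[OF A[unfolded sets_completion]] by metis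
    have "N' \<in> null_sets lebesgue" using S(3) by (rule null_sets_completionI)
    then have "AE z in lebesgue. z \<notin> N'" by (rule AE_not_in)
    then have "AE z in lebesgue. indicat_real A z *\<^sub>R k z = indicat_real S z *\<^sub>R k z"
      by eventually_elim (use S in \<open>auto simp: indicator_def\<close>)
    moreover have "S \<in> sets lebesgue" using S(4) by simp
    ultimately have "set_lebesgue_integral lebesgue A k = set_lebesgue_integral lebesgue S k"
      using si[OF A] si[OF \<open>S \<in> sets lebesgue\<close>] unfolding set_lebesgue_integral_def set_integrable_def
      by (intro integral_cong_AE) auto
    with borel[of S] S(4) show ?thesis by simp
  qed
  with k show ?thesis
    by (intro sigma_finite_measure.density_zero[OF sigma_finite_lebesgue])
qed

text \<open>Test functions approximating the indicator of a box turn the hypothesis into vanishing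
  box integrals. Since \<open>h\<close> is only locally integrable,
  \<open>AE_zero_if_box_integrals_zero\<close> is applied to \<open>h\<close> cut off to one box at
  a time; countably many closed boxes then exhaust the open set.\<close>

lemma AE_zero_if_test_integrals_zero:
  assumes \<Omega>: "open \<Omega>" and h: "locally_integrable_on h \<Omega>"
    and test: "\<And>\<phi>. test_function \<Omega> \<phi> \<Longrightarrow> (LINT z:\<Omega>|lebesgue. \<phi> z *\<^sub>R h z) = 0"
  shows "AE z in lebesgue. z \<in> \<Omega> \<longrightarrow> h z = 0"
proof -
  have box: "set_lebesgue_integral lebesgue (box a b) h = 0" if ab: "cbox a b \<subseteq> \<Omega>" for a b
  proof -
    obtain \<phi> :: "nat \<Rightarrow> complex \<Rightarrow> real" where \<phi>: "\<And>n. test_function \<Omega> (\<phi> n)"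
      "\<And>n z. \<bar>\<phi> n z\<bar> \<le> indicator (cbox a b) z" "\<And>z. (\<lambda>n. \<phi> n z) \<longlonglongrightarrow> indicator (box a b) z"
      using test_function_box_approx[OF ab] by metis
    have int: "integrable lebesgue (\<lambda>z. indicator (cbox a b) z *\<^sub>R h z)"
      using h ab compact_cbox unfolding locally_integrable_on_def set_integrable_def by blast
    \<comment> \<open>\<open>\<phi> n\<close> vanishes off the closed box, so its indicator may be
      inserted freely; \<open>h\<close> restricted to the closed box is then an integrable
      dominating function.\<close>
    have eq: "indicator \<Omega> z *\<^sub>R \<phi> n z *\<^sub>R h z = \<phi> n z *\<^sub>R (indicat_real (cbox a b) z *\<^sub>R h z)" for n z
      using \<phi>(2)[of n z] ab by (auto simp: indicator_def split: if_splits)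
    have meas: "\<phi> n \<in> borel_measurable lebesgue" for n
    proof -
      have "continuous_on UNIV (\<phi> n)"
        using \<phi>(1) smooth_on_imp_continuous_on[of UNIV "\<phi> n"] by (auto simp: test_function_def)
      then show ?thesis by (simp add: borel_measurable_continuous_onI measurable_completion)
    qed
    have "(\<lambda>n. integral\<^sup>L lebesgue (\<lambda>z. \<phi> n z *\<^sub>R (indicat_real (cbox a b) z *\<^sub>R h z)))
      \<longlonglongrightarrow> integral\<^sup>L lebesgue (\<lambda>z. indicator (box a b) z *\<^sub>R (indicat_real (cbox a b) z *\<^sub>R h z))"
    proof (rule integral_dominated_convergence[where w = "\<lambda>z. norm (indicat_real (cbox a b) z *\<^sub>R h z)"])
      show "integrable lebesgue (\<lambda>z. norm (indicat_real (cbox a b) z *\<^sub>R h z))" using int by (rule integrable_norm)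
      show "AE z in lebesgue. norm (\<phi> n z *\<^sub>R indicat_real (cbox a b) z *\<^sub>R h z) \<le> norm (indicat_real (cbox a b) z *\<^sub>R h z)" for n
      proof (intro AE_I2)
        fix z
        have "\<bar>\<phi> n z\<bar> \<le> 1" using \<phi>(2)[of n z] by (rule order_trans) (simp add: indicator_def)
        then show "norm (\<phi> n z *\<^sub>R indicat_real (cbox a b) z *\<^sub>R h z) \<le> norm (indicat_real (cbox a b) z *\<^sub>R h z)"
          unfolding norm_scaleR[of "\<phi> n z"] by (intro mult_left_le_one_le) auto
      qed
      show "AE z in lebesgue. (\<lambda>n. \<phi> n z *\<^sub>R indicat_real (cbox a b) z *\<^sub>R h z) \<longlonglongrightarrow> indicat_real (box a b) z *\<^sub>R indicat_real (cbox a b) z *\<^sub>R h z"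
        by (intro AE_I2 tendsto_intros \<phi>)
      show "(\<lambda>z. indicat_real (box a b) z *\<^sub>R indicat_real (cbox a b) z *\<^sub>R h z) \<in> borel_measurable lebesgue"
        by (intro borel_measurable_scaleR borel_measurable_integrable[OF int] borel_measurable_indicator) simp
      show "(\<lambda>z. \<phi> n z *\<^sub>R indicat_real (cbox a b) z *\<^sub>R h z) \<in> borel_measurable lebesgue" for n
        by (intro borel_measurable_scaleR borel_measurable_integrable[OF int] meas)
    qed
    moreover have "integral\<^sup>L lebesgue (\<lambda>z. \<phi> n z *\<^sub>R (indicat_real (cbox a b) z *\<^sub>R h z)) = 0" for n
      using test[OF \<phi>(1), of n] unfolding set_lebesgue_integral_def eq .
    ultimately have "integral\<^sup>L lebesgue (\<lambda>z. indicator (box a b) z *\<^sub>R (indicat_real (cbox a b) z *\<^sub>R h z)) = 0"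
      by (simp add: LIMSEQ_const_iff)
    moreover have "indicator (box a b) z *\<^sub>R (indicat_real (cbox a b) z *\<^sub>R h z) = indicator (box a b) z *\<^sub>R h z" for z
      using box_subset_cbox[of a b] by (auto simp: indicator_def)
    ultimately show ?thesis by (simp only: set_lebesgue_integral_def)
  qed
  have AE_box: "AE z in lebesgue. z \<in> box a b \<longrightarrow> h z = 0" if ab: "cbox a b \<subseteq> \<Omega>" for a b
  proof -
    define k where "k z = indicat_real (box a b) z *\<^sub>R h z" for z
    have "integrable lebesgue (\<lambda>z. indicat_real (cbox a b) z *\<^sub>R h z)"
      using h ab compact_cbox unfolding locally_integrable_on_def set_integrable_def by blast
    then have "integrable lebesgue (\<lambda>z. indicat_real (box a b) z *\<^sub>R (indicat_real (cbox a b) z *\<^sub>R h z))"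
      by (rule integrable_mult_indicator[rotated]) simp
    moreover have "indicat_real (box a b) z *\<^sub>R (indicat_real (cbox a b) z *\<^sub>R h z) = k z" for z
      using box_subset_cbox[of a b] by (auto simp: indicator_def k_def)
    ultimately have "integrable lebesgue k" by (simp only:)
    moreover have "integral\<^sup>L lebesgue k = 0"
      using box[OF ab] by (simp add: set_lebesgue_integral_def k_def[abs_def])
    moreover have "set_lebesgue_integral lebesgue (box c d) k = 0" for c d
    proof -
      obtain a' b' where ab': "box a b \<inter> box c d = box a' b'" by (rule that[OF box_Int_box])
      have "set_lebesgue_integral lebesgue (box c d) k = set_lebesgue_integral lebesgue (box a' b') h"
        unfolding set_lebesgue_integral_def k_def ab'[symmetric]
        by (intro Bochner_Integration.integral_cong) (auto simp: indicator_def)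
      also have "\<dots> = 0"
      \<comment> \<open>If the intersection is empty, \<open>cbox a' b'\<close> may be a degenerate
        box that is not contained in \<Omega>, so the result for boxes inside \<Omega> cannot be
        used.\<close>
      proof (cases "box a' b' = {}")
        case False
        then have "cbox a' b' = closure (box a' b')" by (simp add: closure_box)
        also have "\<dots> \<subseteq> cbox a b" unfolding ab'[symmetric]
          by (rule closure_minimal) (use box_subset_cbox[of a b] in auto)
        finally show ?thesis using ab box by blast
      qed (simp add: set_lebesgue_integral_def)
      finally show ?thesis .
    qed
    ultimately have "AE z in lebesgue. k z = 0" by (rule AE_zero_if_box_integrals_zero)
    then show ?thesis by eventually_elim (auto simp: k_def indicator_def split: if_splits)
  qed
  \<comment> \<open>The countable cover below uses closed boxes; their frontiers are null
    sets.\<close>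
  have AE_cbox: "AE z in lebesgue. z \<in> cbox a b \<longrightarrow> h z = 0" if "cbox a b \<subseteq> \<Omega>" for a b
  proof -
    have "cbox a b - box a b \<in> null_sets lebesgue"
      by (simp add: negligible_frontier_interval flip: negligible_iff_null_sets)
    then have "AE z in lebesgue. z \<notin> cbox a b - box a b" by (rule AE_not_in)
    with AE_box[OF that] show ?thesis by eventually_elim blast
  qed
  obtain \<D> where \<D>: "countable \<D>" "\<D> \<subseteq> Pow \<Omega>" "\<And>X. X \<in> \<D> \<Longrightarrow> \<exists>a b. X = cbox a b" "\<Union>\<D> = \<Omega>"
    using open_countable_Union_open_cbox[OF \<Omega>] by metis
  have "AE z in lebesgue. \<forall>X\<in>\<D>. z \<in> X \<longrightarrow> h z = 0"
    unfolding AE_ball_countable[OF \<D>(1)] using \<D>(2,3) AE_cbox by (metis Pow_iff subsetD)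
  then show ?thesis by eventually_elim (use \<D>(4) in blast)
qed

section \<open>Weak derivatives of smooth functions and Sobolev norms\<close>

text \<open>Dominated convergence works with sequences, so the derivative is needed as a limit along
  the steps \<open>1 / real (Suc n)\<close>.\<close>

lemma has_vector_derivative_imp_sequence:
  assumes "(g has_vector_derivative v) (at 0)"
  shows "(\<lambda>n. real (Suc n) *\<^sub>R (g (1 / real (Suc n)) - g 0)) \<longlonglongrightarrow> v"
proof -
  have "((\<lambda>t. (g t - g 0 - t *\<^sub>R v) /\<^sub>R norm t) \<longlongrightarrow> 0) (at 0)"
    using assms by (simp add: has_vector_derivative_def has_derivative_def)
  then have "((\<lambda>t. norm ((g t - g 0 - t *\<^sub>R v) /\<^sub>R norm t)) \<longlongrightarrow> 0) (at 0)"
    by (rule tendsto_norm_zero)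
  then have "((\<lambda>t. norm ((g t - g 0 - t *\<^sub>R v) /\<^sub>R t)) \<longlongrightarrow> 0) (at 0)" by simp
  then have "((\<lambda>t. (g t - g 0 - t *\<^sub>R v) /\<^sub>R t) \<longlongrightarrow> 0) (at 0)" by (rule tendsto_norm_zero_cancel)
  moreover have "filterlim (\<lambda>n. 1 / real (Suc n)) (at 0) sequentially"
    unfolding filterlim_at using LIMSEQ_Suc[OF lim_1_over_n] by auto
  ultimately have "((\<lambda>n. (g (1 / real (Suc n)) - g 0 - (1 / real (Suc n)) *\<^sub>R v) /\<^sub>R (1 / real (Suc n))) \<longlonglongrightarrow> 0)"
    by (rule filterlim_compose)
  then have "(\<lambda>n. (real (Suc n) *\<^sub>R (g (1 / real (Suc n)) - g 0) - v)) \<longlonglongrightarrow> 0"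
    by (simp add: scaleR_diff_right del: of_nat_Suc)
  then show ?thesis by (simp add: LIM_zero_iff del: of_nat_Suc)
qed

lemma dir_deriv_eq_0:
  assumes "x \<notin> closure {x. f x \<noteq> 0}"
  shows "dir_deriv f h x = 0"
proof -
  have "dir_deriv f h x = dir_deriv (\<lambda>_. 0) h x"
    by (rule dir_deriv_cong_open[where W = "- closure {x. f x \<noteq> 0}"])
      (use assms closure_subset[of "{x. f x \<noteq> 0}"] in auto)
  then show ?thesis by (simp add: dir_deriv_def)
qed

lemma has_vector_derivative_along_line:
  assumes "f differentiable (at (x + t *\<^sub>R h))"
  shows "((\<lambda>t. f (x + t *\<^sub>R h)) has_vector_derivative dir_deriv f h (x + t *\<^sub>R h)) (at t within A)"
proof -
  note D = dir_deriv_works[OF assms]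
  have "((\<lambda>t. x + t *\<^sub>R h) has_derivative (\<lambda>r. r *\<^sub>R h)) (at t within A)"
    by (auto intro!: derivative_eq_intros)
  from has_derivative_compose[OF this D]
  have "((\<lambda>t. f (x + t *\<^sub>R h)) has_derivative (\<lambda>r. dir_deriv f (r *\<^sub>R h) (x + t *\<^sub>R h))) (at t within A)" .
  then show ?thesis
    using linear_cmul[OF has_derivative_linear[OF D]] by (simp add: has_vector_derivative_def)
qed

lemma norm_diff_le_along_line:
  assumes "\<And>t. t \<in> {0..s} \<Longrightarrow> f differentiable (at (x + t *\<^sub>R h))"
    and "\<And>t. t \<in> {0..s} \<Longrightarrow> norm (dir_deriv f h (x + t *\<^sub>R h)) \<le> B" and s: "0 \<le> s"
  shows "norm (f (x + s *\<^sub>R h) - f x) \<le> B * s"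
proof -
  have "norm (f (x + s *\<^sub>R h) - f (x + 0 *\<^sub>R h)) \<le> B * norm (s - 0)"
  proof (rule differentiable_bound[of "{0..s}" "\<lambda>t. f (x + t *\<^sub>R h)" "\<lambda>t r. r *\<^sub>R dir_deriv f h (x + t *\<^sub>R h)"])
    show "((\<lambda>t. f (x + t *\<^sub>R h)) has_derivative (\<lambda>r. r *\<^sub>R dir_deriv f h (x + t *\<^sub>R h))) (at t within {0..s})"
      if "t \<in> {0..s}" for t
      using has_vector_derivative_along_line[OF assms(1)[OF that]] by (simp add: has_vector_derivative_def)
    show "onorm (\<lambda>r. r *\<^sub>R dir_deriv f h (x + t *\<^sub>R h)) \<le> B" if "t \<in> {0..s}" for t
      using assms(2)[OF that] by (intro onorm_le) (auto simp: mult.commute[of B] intro: mult_left_mono)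
  qed (use s in auto)
  with s show ?thesis by simp
qed

lemma integrable_lborel_compact_support:
  fixes f :: "'a::euclidean_space \<Rightarrow> 'b::{banach, second_countable_topology}"
  assumes "continuous_on UNIV f" "compact K" "\<And>x. x \<notin> K \<Longrightarrow> f x = 0"
  shows "integrable lborel f"
proof -
  have "integrable lborel (\<lambda>x. indicator K x *\<^sub>R f x)"
    using assms by (intro borel_integrable_compact) (auto intro: continuous_on_subset)
  moreover have "indicator K x *\<^sub>R f x = f x" for x using assms(3) by (auto simp: indicator_def)
  ultimately show ?thesis by simp
qed

text \<open>The integrals of the difference quotients vanish by translation invariance.\<close>

lemma integral_dir_deriv_compact_support:
  fixes \<psi> :: "'a::euclidean_space \<Rightarrow> 'b::euclidean_space"
  assumes \<psi>: "Ck_on 1 UNIV \<psi>" and K: "compact (closure {x. \<psi> x \<noteq> 0})"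
  shows "integral\<^sup>L lborel (dir_deriv \<psi> h) = 0"
proof -
  define K where "K = closure {x. \<psi> x \<noteq> 0}"
  have diff: "\<psi> differentiable (at x)" for x using \<psi> by (simp add: Ck_on_Suc)
  have cont: "continuous_on UNIV \<psi>" "continuous_on UNIV (dir_deriv \<psi> h)"
    using \<psi> Ck_on_imp_continuous_on[OF \<psi>] by (auto simp: Ck_on_Suc Ck_on_0)
  have "bounded (dir_deriv \<psi> h ` K)"
    using K cont by (intro compact_imp_bounded compact_continuous_image) (auto simp: K_def intro: continuous_on_subset)
  then obtain B where B: "B > 0" "\<And>x. x \<in> K \<Longrightarrow> norm (dir_deriv \<psi> h x) \<le> B"
    by (auto simp: bounded_pos)
  have out: "\<psi> x = 0" "dir_deriv \<psi> h x = 0" if "x \<notin> K" for x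
    using that closure_subset[of "{x. \<psi> x \<noteq> 0}"] dir_deriv_eq_0[of x \<psi>] by (auto simp: K_def)
  have B': "norm (dir_deriv \<psi> h x) \<le> B" for x using B out by (cases "x \<in> K") auto
  define D where "D n x = real (Suc n) *\<^sub>R (\<psi> (x + (1 / real (Suc n)) *\<^sub>R h) - \<psi> x)" for n x
  have D_bound: "norm (D n x) \<le> B" for n x
  proof -
    have "norm (\<psi> (x + (1 / real (Suc n)) *\<^sub>R h) - \<psi> x) \<le> B * (1 / real (Suc n))"
      by (rule norm_diff_le_along_line) (auto intro: diff B')
    then have "real (Suc n) * norm (\<psi> (x + (1 / real (Suc n)) *\<^sub>R h) - \<psi> x) \<le> B"
      by (simp add: field_simps del: of_nat_Suc)
    then show ?thesis by (simp only: D_def norm_scaleR abs_of_nat)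
  qed
  \<comment> \<open>Every step has length at most \<open>norm h\<close>, so all difference quotients
    vanish off this one compact set, and \<open>B\<close> times its indicator dominates the whole
    sequence.\<close>
  define K' where "K' = {x - y | x y. x \<in> K \<and> y \<in> cball 0 (norm h)}"
  have K': "compact K'" unfolding K'_def using K by (intro compact_differences) (auto simp: K_def)
  have D_out: "D n x = 0" if "x \<notin> K'" for n x
  proof -
    have *: "x + y \<notin> K" if "norm y \<le> norm h" for y
    proof
      assume "x + y \<in> K"
      then have "x + y - y \<in> K'" unfolding K'_def using that by (intro CollectI exI[of _ "x + y"] exI[of _ y]) auto
      then show False using \<open>x \<notin> K'\<close> by simp
    qed
    have "norm ((1 / real (Suc n)) *\<^sub>R h) \<le> norm h"
      unfolding norm_scaleR by (intro mult_left_le_one_le) auto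
    with *[of 0] *[of "(1 / real (Suc n)) *\<^sub>R h"] out show ?thesis by (simp add: D_def del: of_nat_Suc)
  qed
  have int\<psi>: "integrable lborel \<psi>"
    by (rule integrable_lborel_compact_support[OF cont(1) K]) (rule out(1), simp add: K_def)
  then have [measurable]: "\<psi> \<in> borel_measurable borel" by auto
  have shift: "integrable lborel (\<lambda>x. \<psi> (x + c))" "integral\<^sup>L lborel (\<lambda>x. \<psi> (x + c)) = integral\<^sup>L lborel \<psi>" for c
    using int\<psi> integral_distr[of "(+) c" lborel borel \<psi>] integrable_distr_eq[of "(+) c" lborel borel \<psi>]
    by (simp_all add: lborel_distr_plus add.commute)
  have D0: "integral\<^sup>L lborel (D n) = 0" for n
    unfolding D_def by (simp add: shift int\<psi> del: of_nat_Suc)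
  have "(\<lambda>n. integral\<^sup>L lborel (D n)) \<longlonglongrightarrow> integral\<^sup>L lborel (dir_deriv \<psi> h)"
  proof (rule integral_dominated_convergence[where w = "\<lambda>x. indicator K' x *\<^sub>R B"])
    show "dir_deriv \<psi> h \<in> borel_measurable lborel"
      using cont(2) by (simp add: borel_measurable_continuous_onI)
    show "D n \<in> borel_measurable lborel" for n unfolding D_def by measurable
    show "integrable lborel (\<lambda>x. indicator K' x *\<^sub>R B)"
      using K' by (intro borel_integrable_compact) auto
    show "AE x in lborel. (\<lambda>n. D n x) \<longlonglongrightarrow> dir_deriv \<psi> h x"
      using has_vector_derivative_imp_sequence[OF has_vector_derivative_along_line[of \<psi> _ 0 h]] diff
      by (intro AE_I2) (simp add: D_def del: of_nat_Suc)
    show "AE x in lborel. norm (D n x) \<le> indicator K' x *\<^sub>R B" for n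
      using D_bound D_out by (intro AE_I2) (auto simp: indicator_def)
  qed
  then show ?thesis by (simp add: D0 LIMSEQ_const_iff)
qed

lemma test_function_dir_deriv:
  assumes "test_function \<Omega> \<phi>"
  shows "test_function \<Omega> (dir_deriv \<phi> h)"
proof -
  have sub: "closure {z. dir_deriv \<phi> h z \<noteq> 0} \<subseteq> closure {z. \<phi> z \<noteq> 0}"
    by (rule closure_minimal) (use dir_deriv_eq_0[of _ \<phi> h] in auto)
  then have "compact (closure {z. dir_deriv \<phi> h z \<noteq> 0})"
    using assms bounded_subset[OF compact_imp_bounded sub]
    by (simp add: compact_eq_bounded_closed test_function_def)
  moreover have "smooth_on UNIV (dir_deriv \<phi> h)"
    using assms unfolding test_function_def by (intro smooth_on_dir_deriv) auto
  ultimately show ?thesis using assms sub unfolding test_function_def by (intro conjI) auto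
qed

text \<open>The product of \<open>\<phi>\<close> and \<open>f\<close> inherits compact support from
  \<open>\<phi>\<close>, so the integral of its derivative vanishes; the product rule splits that
  integral into the two sides.\<close>

lemma integral_by_parts_dir_deriv:
  assumes \<phi>: "test_function \<Omega> \<phi>" and f: "smooth_on UNIV (f :: complex \<Rightarrow> complex)"
  shows "(LINT z:\<Omega>|lebesgue. dir_deriv \<phi> h z *\<^sub>R f z) = - (LINT z:\<Omega>|lebesgue. \<phi> z *\<^sub>R dir_deriv f h z)"
proof -
  define K where "K = closure {z. \<phi> z \<noteq> 0}"
  have K: "compact K" "K \<subseteq> \<Omega>" and sm\<phi>: "smooth_on UNIV \<phi>" using \<phi> by (auto simp: test_function_def K_def)
  have out: "\<phi> z = 0" "dir_deriv \<phi> h z = 0" if "z \<notin> K" for z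
    using that closure_subset[of "{z. \<phi> z \<noteq> 0}"] dir_deriv_eq_0[of z \<phi>] by (auto simp: K_def)
  \<comment> \<open>Passes to \<open>lborel\<close> on the whole plane, where
    \<open>integral_dir_deriv_compact_support\<close> is stated; support in \<open>K\<close>, a
    subset of \<Omega>, makes the restriction harmless.\<close>
  have toL: "(LINT z:\<Omega>|lebesgue. g z) = integral\<^sup>L lborel g" if "\<And>z. z \<notin> K \<Longrightarrow> g z = 0" "continuous_on UNIV g" for g :: "complex \<Rightarrow> complex"
  proof -
    have "indicator \<Omega> z *\<^sub>R g z = g z" for z using that(1) K(2) by (auto simp: indicator_def)
    then show ?thesis using that(2)
      by (simp add: set_lebesgue_integral_def integral_completion borel_measurable_continuous_onI)
  qed
  define \<psi> where "\<psi> z = \<phi> z *\<^sub>R f z" for z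
  have \<psi>: "Ck_on n UNIV \<psi>" for n
    unfolding \<psi>_def by (intro Ck_on_scaleR smooth_onD sm\<phi> f) auto
  have "closure {z. \<psi> z \<noteq> 0} \<subseteq> K"
    unfolding K_def by (intro closure_mono) (auto simp: \<psi>_def)
  then have "compact (closure {z. \<psi> z \<noteq> 0})"
    using bounded_subset[OF compact_imp_bounded[OF K(1)]] by (simp add: compact_eq_bounded_closed)
  from integral_dir_deriv_compact_support[OF \<psi> this]
  have 0: "integral\<^sup>L lborel (dir_deriv \<psi> h) = 0" .
  have "dir_deriv \<psi> h z = dir_deriv \<phi> h z *\<^sub>R f z + \<phi> z *\<^sub>R dir_deriv f h z" for z
    using dir_deriv_eq[OF has_derivative_scaleR[OF dir_deriv_works dir_deriv_works], of \<phi> z f h]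
      smooth_on_imp_differentiable[OF sm\<phi>, of z] smooth_on_imp_differentiable[OF f, of z]
    by (simp add: \<psi>_def[abs_def])
  then have eq: "dir_deriv \<psi> h = (\<lambda>z. dir_deriv \<phi> h z *\<^sub>R f z + \<phi> z *\<^sub>R dir_deriv f h z)" by blast
  have cont: "continuous_on UNIV (\<lambda>z. dir_deriv \<phi> h z *\<^sub>R f z)" "continuous_on UNIV (\<lambda>z. \<phi> z *\<^sub>R dir_deriv f h z)"
    by (intro continuous_on_scaleR smooth_on_imp_continuous_on smooth_on_dir_deriv sm\<phi> f open_UNIV)+
  have "integrable lborel (\<lambda>z. dir_deriv \<phi> h z *\<^sub>R f z)" "integrable lborel (\<lambda>z. \<phi> z *\<^sub>R dir_deriv f h z)"
    using out by (auto intro!: integrable_lborel_compact_support[OF _ K(1)] cont)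
  then have "integral\<^sup>L lborel (dir_deriv \<psi> h)
      = integral\<^sup>L lborel (\<lambda>z. dir_deriv \<phi> h z *\<^sub>R f z) + integral\<^sup>L lborel (\<lambda>z. \<phi> z *\<^sub>R dir_deriv f h z)"
    unfolding eq by (rule Bochner_Integration.integral_add)
  with 0 show ?thesis using out cont by (simp add: toL eq_neg_iff_add_eq_0)
qed

section \<open>Classical mixed partial derivatives as weak derivatives\<close>

lemma partial_x_eq_dir_deriv: "partial_x f = dir_deriv f 1"
  and partial_y_eq_dir_deriv: "partial_y f = dir_deriv f \<i>"
  by (auto simp: partial_x_def partial_y_def dir_deriv_def)

text \<open>\<open>D\<close> and \<open>D'\<close> are the same operator at two value types, since
  \<open>f\<close> is complex and \<open>\<phi>\<close> real. The second conclusion makes the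
  differentiated \<open>\<phi>\<close> admissible again, so that two directions can be treated one
  after the other.\<close>

lemma integral_by_parts_iterated:
  fixes h :: complex
  defines "D \<equiv> \<lambda>g z. dir_deriv g h z" and "D' \<equiv> \<lambda>g z. dir_deriv g h z"
  assumes \<phi>: "test_function \<Omega> \<phi>"
  shows "smooth_on UNIV f \<Longrightarrow> (LINT z:\<Omega>|lebesgue. (D' ^^ a) \<phi> z *\<^sub>R f z) =
    (- 1) ^ a * (LINT z:\<Omega>|lebesgue. \<phi> z *\<^sub>R (D ^^ a) f z :: complex)"
    and "test_function \<Omega> ((D' ^^ a) \<phi>)"
proof -
  have test: "test_function \<Omega> ((D' ^^ a) \<phi>)" for a
  proof (induction a)
    case (Suc a)
    then show ?case using test_function_dir_deriv[of \<Omega> "(D' ^^ a) \<phi>" h] by (simp add: D'_def)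
  qed (simp add: \<phi>)
  show "smooth_on UNIV f \<Longrightarrow> (LINT z:\<Omega>|lebesgue. (D' ^^ a) \<phi> z *\<^sub>R f z) =
      (- 1) ^ a * (LINT z:\<Omega>|lebesgue. \<phi> z *\<^sub>R (D ^^ a) f z)"
  proof (induction a arbitrary: f)
    case (Suc a)
    have "(LINT z:\<Omega>|lebesgue. (D' ^^ Suc a) \<phi> z *\<^sub>R f z) = - (LINT z:\<Omega>|lebesgue. (D' ^^ a) \<phi> z *\<^sub>R D f z)"
      using integral_by_parts_dir_deriv[OF test Suc.prems, of a h] by (simp add: D_def D'_def)
    also have "\<dots> = - ((- 1) ^ a * (LINT z:\<Omega>|lebesgue. \<phi> z *\<^sub>R (D ^^ a) (D f) z))"
      unfolding D_def by (subst Suc.IH[unfolded D_def]) (auto intro: smooth_on_dir_deriv Suc.prems)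
    finally show ?case by (simp only: funpow_Suc_right o_apply power_Suc mult_minus_left mult_1_left)
  qed simp
  show "test_function \<Omega> ((D' ^^ a) \<phi>)" by (rule test)
qed

text \<open>The order is opposite to that on test functions in \<open>weak_derivative\<close>: there
  \<open>partial_x\<close> is outermost, hence is moved onto \<open>f\<close> first and ends up
  innermost. With this choice integration by parts needs no interchange of derivatives.\<close>

definition mixed_partial :: "nat \<Rightarrow> nat \<Rightarrow> (complex \<Rightarrow> complex) \<Rightarrow> complex \<Rightarrow> complex" where
  "mixed_partial a b f = (partial_y ^^ b) ((partial_x ^^ a) f)"

lemma smooth_on_partial_x_iter: "smooth_on UNIV f \<Longrightarrow> smooth_on UNIV ((partial_x ^^ a) f)"
  and smooth_on_partial_y_iter: "smooth_on UNIV f \<Longrightarrow> smooth_on UNIV ((partial_y ^^ a) f)"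
  for f :: "complex \<Rightarrow> complex"
  by (induction a) (auto simp: partial_x_eq_dir_deriv partial_y_eq_dir_deriv intro: smooth_on_dir_deriv)

lemma smooth_on_mixed_partial: "smooth_on UNIV f \<Longrightarrow> smooth_on UNIV (mixed_partial a b f)"
  unfolding mixed_partial_def by (intro smooth_on_partial_x_iter smooth_on_partial_y_iter)

lemma locally_integrable_on_continuous:
  assumes "continuous_on UNIV f" shows "locally_integrable_on f \<Omega>"
  unfolding locally_integrable_on_def set_integrable_def
proof (intro allI impI)
  fix K assume "compact K \<and> K \<subseteq> \<Omega>"
  then have "integrable lborel (\<lambda>x. indicator K x *\<^sub>R f x)"
    using assms by (intro borel_integrable_compact) (auto intro: continuous_on_subset)
  then show "integrable lebesgue (\<lambda>x. indicator K x *\<^sub>R f x)"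
    by (simp add: integrable_completion borel_measurable_integrable)
qed

lemma weak_derivative_mixed_partial:
  assumes f: "smooth_on UNIV f"
  shows "weak_derivative \<Omega> (a, b) f (mixed_partial a b f)"
proof -
  have "(LINT z:\<Omega>|lebesgue. (partial_x ^^ a) ((partial_y ^^ b) \<phi>) z *\<^sub>R f z) =
        (- 1) ^ (a + b) * (LINT z:\<Omega>|lebesgue. \<phi> z *\<^sub>R mixed_partial a b f z)" if \<phi>: "test_function \<Omega> \<phi>" for \<phi>
    using integral_by_parts_iterated(1)[OF integral_by_parts_iterated(2)[OF \<phi>, of b \<i>] f, of a 1]
      integral_by_parts_iterated(1)[OF \<phi> smooth_on_partial_x_iter[OF f, of a], of b \<i>]
    by (simp add: mixed_partial_def partial_x_eq_dir_deriv[abs_def] partial_y_eq_dir_deriv[abs_def] power_add)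
  then show ?thesis
    unfolding weak_derivative_def
    by (auto intro!: locally_integrable_on_continuous smooth_on_imp_continuous_on smooth_on_mixed_partial f)
qed

lemma test_function_mult_integrable:
  assumes \<phi>: "test_function \<Omega> \<phi>" and g: "locally_integrable_on g \<Omega>"
  shows "set_integrable lebesgue \<Omega> (\<lambda>z. \<phi> z *\<^sub>R g z)"
proof -
  define K where "K = closure {z. \<phi> z \<noteq> 0}"
  have K: "compact K" "K \<subseteq> \<Omega>" and sm: "smooth_on UNIV \<phi>" using \<phi> by (auto simp: test_function_def K_def)
  have out: "\<phi> z = 0" if "z \<notin> K" for z
    using that closure_subset[of "{z. \<phi> z \<noteq> 0}"] by (auto simp: K_def)
  have cont: "continuous_on UNIV \<phi>" using sm by (rule smooth_on_imp_continuous_on) auto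
  then have "bounded (\<phi> ` K)"
    using K by (intro compact_imp_bounded compact_continuous_image) (auto intro: continuous_on_subset)
  then obtain B where "B > 0" "\<And>z. z \<in> K \<Longrightarrow> norm (\<phi> z) \<le> B" by (auto simp: bounded_pos)
  then have B: "norm (\<phi> z) \<le> B" for z using out by (cases "z \<in> K") auto
  have int: "integrable lebesgue (\<lambda>z. indicator K z *\<^sub>R g z)"
    using g K by (auto simp: locally_integrable_on_def set_integrable_def)
  have "integrable lebesgue (\<lambda>z. \<phi> z *\<^sub>R (indicat_real K z *\<^sub>R g z))"
  proof (rule Bochner_Integration.integrable_bound)
    show "integrable lebesgue (\<lambda>z. B *\<^sub>R (indicat_real K z *\<^sub>R g z))" using int by (rule integrable_scaleR_right)
    show "(\<lambda>z. \<phi> z *\<^sub>R (indicat_real K z *\<^sub>R g z)) \<in> borel_measurable lebesgue"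
      using cont by (intro borel_measurable_scaleR borel_measurable_integrable[OF int])
        (simp add: borel_measurable_continuous_onI measurable_completion)
    show "AE z in lebesgue. norm (\<phi> z *\<^sub>R (indicat_real K z *\<^sub>R g z)) \<le> norm (B *\<^sub>R (indicat_real K z *\<^sub>R g z))"
    proof (intro AE_I2)
      fix z
      have "\<bar>\<phi> z\<bar> \<le> \<bar>B\<bar>" using B[of z] by auto
      then show "norm (\<phi> z *\<^sub>R (indicat_real K z *\<^sub>R g z)) \<le> norm (B *\<^sub>R (indicat_real K z *\<^sub>R g z))"
        unfolding norm_scaleR[of "\<phi> z"] norm_scaleR[of B] by (rule mult_right_mono) simp
    qed
  qed
  moreover have "\<phi> z *\<^sub>R (indicat_real K z *\<^sub>R g z) = indicat_real \<Omega> z *\<^sub>R \<phi> z *\<^sub>R g z" for z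
    using K(2) out by (auto simp: indicator_def)
  ultimately show ?thesis by (simp only: set_integrable_def)
qed

text \<open>The difference of two candidates integrates to 0 against every test function.
  Integrability of each product with a test function is what permits splitting the integral of the
  difference.\<close>

lemma weak_derivative_unique:
  assumes \<Omega>: "open \<Omega>" and g: "weak_derivative \<Omega> \<alpha> f g" and g': "weak_derivative \<Omega> \<alpha> f g'"
  shows "AE z in lebesgue. z \<in> \<Omega> \<longrightarrow> g z = g' z"
proof -
  obtain a b where \<alpha>: "\<alpha> = (a, b)" by force
  have li: "locally_integrable_on g \<Omega>" "locally_integrable_on g' \<Omega>"
    using g g' by (auto simp: weak_derivative_def \<alpha>)
  have "AE z in lebesgue. z \<in> \<Omega> \<longrightarrow> g z - g' z = 0"
  proof (rule AE_zero_if_test_integrals_zero[OF \<Omega>])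
    show "locally_integrable_on (\<lambda>z. g z - g' z) \<Omega>"
      using li by (auto simp: locally_integrable_on_def)
    fix \<phi> assume \<phi>: "test_function \<Omega> \<phi>"
    have "(LINT z:\<Omega>|lebesgue. (partial_x ^^ a) ((partial_y ^^ b) \<phi>) z *\<^sub>R f z) =
        (- 1) ^ (a + b) * (LINT z:\<Omega>|lebesgue. \<phi> z *\<^sub>R g z)" if "weak_derivative \<Omega> \<alpha> f g" for g
      using that \<phi> by (simp add: weak_derivative_def \<alpha>)
    from this[OF g] this[OF g']
    have "(- 1) ^ (a + b) * (LINT z:\<Omega>|lebesgue. \<phi> z *\<^sub>R g z) = (- 1) ^ (a + b) * (LINT z:\<Omega>|lebesgue. \<phi> z *\<^sub>R g' z)"
      by (simp only:)
    then have "(LINT z:\<Omega>|lebesgue. \<phi> z *\<^sub>R g z) = (LINT z:\<Omega>|lebesgue. \<phi> z *\<^sub>R g' z)" by simp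
    then show "(LINT z:\<Omega>|lebesgue. \<phi> z *\<^sub>R (g z - g' z)) = 0"
      using set_integral_diff(2)[OF test_function_mult_integrable[OF \<phi> li(1)] test_function_mult_integrable[OF \<phi> li(2)]]
      by (simp add: scaleR_diff_right)
  qed
  then show ?thesis by eventually_elim simp
qed

section \<open>Sup bounds for Sobolev norms of smooth functions\<close>

lemma Lp_on_bounded:
  assumes cont: "continuous_on UNIV g" and p: "p \<ge> 0" and \<Omega>: "bounded \<Omega>" "open \<Omega>"
  shows "g \<in> Lp_on p \<Omega>"
proof -
  have "compact (g ` closure \<Omega>)"
    using cont \<Omega> by (intro compact_continuous_image) (auto intro: continuous_on_subset simp: compact_closure)
  then obtain B where B: "B > 0" "\<And>z. z \<in> closure \<Omega> \<Longrightarrow> norm (g z) \<le> B"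
    by (auto dest!: compact_imp_bounded simp: bounded_pos)
  have g: "g \<in> borel_measurable lebesgue"
    using cont by (simp add: borel_measurable_continuous_onI measurable_completion)
  have "\<Omega> \<in> lmeasurable" using \<Omega> by (intro bounded_set_imp_lmeasurable) auto
  then have \<Omega>': "\<Omega> \<in> sets lebesgue" "emeasure lebesgue \<Omega> < \<infinity>"
    unfolding fmeasurable_def by blast+
  have "set_borel_measurable lebesgue \<Omega> g"
    unfolding set_borel_measurable_def using g \<Omega>' by (intro borel_measurable_scaleR borel_measurable_indicator)
  moreover have "set_integrable lebesgue \<Omega> (\<lambda>z. norm (g z) powr p)"
  proof (rule set_integrable_bound)
    show "set_integrable lebesgue \<Omega> (\<lambda>z. B powr p)"
      using \<Omega>' by (simp add: set_integrable_def)
    show "set_borel_measurable lebesgue \<Omega> (\<lambda>z. norm (g z) powr p)"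
      unfolding set_borel_measurable_def using g \<Omega>'
      by (intro borel_measurable_scaleR borel_measurable_indicator powr_real_measurable borel_measurable_norm) auto
    show "AE z in lebesgue. z \<in> \<Omega> \<longrightarrow> norm (norm (g z) powr p) \<le> norm (B powr p)"
      using B(2) closure_subset[of \<Omega>] p by (auto intro!: AE_I2 powr_mono2)
  qed
  ultimately show ?thesis by (simp add: Lp_on_def)
qed

text \<open>The bound is assumed only almost everywhere because \<open>g\<close> will be an
  arbitrarily chosen weak derivative, known just up to null sets.\<close>

lemma Lp_norm_le:
  assumes le: "AE z in lebesgue. z \<in> \<Omega> \<longrightarrow> norm (g z) \<le> \<epsilon>" and p: "p > 0" and e: "\<epsilon> \<ge> 0"
    and \<Omega>: "\<Omega> \<in> lmeasurable"
  shows "Lp_norm p \<Omega> g \<le> \<epsilon> * measure lebesgue \<Omega> powr (1 / p)"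
proof -
  have fin: "emeasure lebesgue \<Omega> < \<infinity>" "\<Omega> \<in> sets lebesgue" using \<Omega> by (auto simp: fmeasurable_def)
  have "(LINT z:\<Omega>|lebesgue. norm (g z) powr p) \<le> (LINT z:\<Omega>|lebesgue. \<epsilon> powr p)"
    unfolding set_lebesgue_integral_def
  proof (rule integral_mono_AE')
    show "integrable lebesgue (\<lambda>z. indicat_real \<Omega> z *\<^sub>R \<epsilon> powr p)" using fin by simp
    show "AE z in lebesgue. indicat_real \<Omega> z *\<^sub>R norm (g z) powr p \<le> indicat_real \<Omega> z *\<^sub>R \<epsilon> powr p"
      using le by eventually_elim (use p in \<open>auto simp: indicator_def intro: powr_mono2\<close>)
  qed simp
  also have "\<dots> = measure lebesgue \<Omega> * \<epsilon> powr p"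
    using fin by (simp add: set_lebesgue_integral_def)
  finally have "Lp_norm p \<Omega> g \<le> (measure lebesgue \<Omega> * \<epsilon> powr p) powr (1 / p)"
    unfolding Lp_norm_def using p by (intro powr_mono2) (auto simp: set_lebesgue_integral_def intro!: integral_nonneg_AE)
  also have "\<dots> = \<epsilon> * measure lebesgue \<Omega> powr (1 / p)"
    using p e by (simp add: powr_mult powr_powr)
  finally show ?thesis .
qed

lemma sobolev_fun_smooth:
  assumes "smooth_on UNIV f" "p \<ge> 0" "bounded \<Omega>" "open \<Omega>"
  shows "f \<in> sobolev_fun m p \<Omega>"
proof -
  have "mixed_partial a b f \<in> Lp_on p \<Omega>" for a b
    using assms by (intro Lp_on_bounded smooth_on_imp_continuous_on smooth_on_mixed_partial) auto
  then show ?thesis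
    using weak_derivative_mixed_partial[OF assms(1)] unfolding sobolev_fun_def by blast
qed

lemma sobolev_fun_norm_le:
  assumes f: "smooth_on UNIV f" and p: "p > 0" and e: "\<epsilon> \<ge> 0" and \<Omega>: "bounded \<Omega>" "open \<Omega>"
    and le: "\<And>a b z. \<lbrakk>a + b \<le> m; z \<in> \<Omega>\<rbrakk> \<Longrightarrow> norm (mixed_partial a b f z) \<le> \<epsilon>"
  shows "sobolev_fun_norm m p \<Omega> f \<le> card {(a, b). a + b \<le> m} * measure lebesgue \<Omega> powr (1 / p) * \<epsilon>"
proof -
  have "Lp_norm p \<Omega> (SOME g. weak_derivative \<Omega> \<alpha> f g) \<le> \<epsilon> * measure lebesgue \<Omega> powr (1 / p)"
    if \<alpha>: "\<alpha> \<in> {(a, b). a + b \<le> m}" for \<alpha>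
  proof -
    obtain a b where ab: "\<alpha> = (a, b)" "a + b \<le> m" using \<alpha> by blast
    define g where "g = (SOME g. weak_derivative \<Omega> \<alpha> f g)"
    have w: "weak_derivative \<Omega> \<alpha> f (mixed_partial a b f)"
      unfolding ab by (rule weak_derivative_mixed_partial[OF f])
    then have "weak_derivative \<Omega> \<alpha> f g" unfolding g_def by (rule someI[of "weak_derivative \<Omega> \<alpha> f"])
    from weak_derivative_unique[OF \<Omega>(2) this w]
    have "AE z in lebesgue. z \<in> \<Omega> \<longrightarrow> norm (g z) \<le> \<epsilon>"
      by eventually_elim (use le[OF ab(2)] in auto)
    then show ?thesis
      unfolding g_def using p e \<Omega> by (intro Lp_norm_le) (auto intro: bounded_set_imp_lmeasurable)
  qed
  then have "sobolev_fun_norm m p \<Omega> f \<le> of_nat (card {(a, b). a + b \<le> m}) * (\<epsilon> * measure lebesgue \<Omega> powr (1 / p))"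
    unfolding sobolev_fun_norm_def by (rule sum_bounded_above)
  then show ?thesis by (simp add: mult_ac)
qed

lemma smooth_form_in_sobolev_forms:
  "\<lbrakk>smooth_form \<gamma>; p \<ge> 0\<rbrakk> \<Longrightarrow> \<gamma> \<in> sobolev_forms m p"
  unfolding smooth_form_def sobolev_forms_def by (auto intro: sobolev_fun_smooth)

lemma sobolev_norm_nonneg: "sobolev_norm m p \<gamma> \<ge> 0"
  unfolding sobolev_norm_def sobolev_fun_norm_def Lp_norm_def by (intro sum_nonneg) auto

text \<open>The sup is taken over closed discs although the norm uses open ones: later estimates are
  uniform on compact sets.\<close>

lemma sobolev_norm_le:
  assumes "p > 0"
  obtains C where "C > 0" "\<And>\<gamma> \<epsilon>. \<lbrakk>smooth_form \<gamma>; \<epsilon> \<ge> 0;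
    \<And>i a b z. \<lbrakk>a + b \<le> m; z \<in> cball 0 2\<rbrakk> \<Longrightarrow> norm (mixed_partial a b (coeff \<gamma> i) z) \<le> \<epsilon>\<rbrakk>
    \<Longrightarrow> sobolev_norm m p \<gamma> \<le> C * \<epsilon>"
proof -
  define C where "C = card {(a, b). a + b \<le> m} * measure lebesgue (ball (0::complex) 2) powr (1 / p)"
  \<comment> \<open>The factor 2 counts the charts; the summand 1 makes the constant positive, as it
    is divided by later.\<close>
  have "sobolev_norm m p \<gamma> \<le> (2 * C + 1) * \<epsilon>"
    if "smooth_form \<gamma>" "\<epsilon> \<ge> 0"
      "\<And>i a b z. \<lbrakk>a + b \<le> m; z \<in> cball 0 2\<rbrakk> \<Longrightarrow> norm (mixed_partial a b (coeff \<gamma> i) z) \<le> \<epsilon>" for \<gamma> \<epsilon>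
  proof -
    have "sobolev_fun_norm m p (ball 0 2) (coeff \<gamma> i) \<le> C * \<epsilon>" for i
      using that assms unfolding C_def by (intro sobolev_fun_norm_le) (auto simp: smooth_form_def)
    from this[of Z_chart] this[of W_chart] show ?thesis
      using that(2) by (simp add: sobolev_norm_def algebra_simps)
  qed
  moreover have "C \<ge> 0" by (simp add: C_def)
  ultimately show ?thesis using that[of "2 * C + 1"] by simp
qed

section \<open>Smooth functions depending on a parameter\<close>

abbreviation iter_dir_deriv :: "'a::euclidean_space \<Rightarrow> nat \<Rightarrow> ('a \<Rightarrow> 'b::real_normed_vector) \<Rightarrow> 'a \<Rightarrow> 'b" where
  "iter_dir_deriv k a \<equiv> (\<lambda>f. dir_deriv f k) ^^ a"

lemma smooth_on_iter_dir_deriv: "\<lbrakk>smooth_on W G; open W\<rbrakk> \<Longrightarrow> smooth_on W (iter_dir_deriv k a G)"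
proof (induction a)
  case (Suc a)
  then show ?case using smooth_on_dir_deriv[of W "iter_dir_deriv k a G" k] by simp
qed simp

text \<open>Symmetry of second derivatives, applied to each iterate. The identity holds on an open
  set and may therefore be differentiated again.\<close>

lemma iter_dir_deriv_commute:
  assumes W: "open W" and G: "smooth_on W G"
  shows "p \<in> W \<Longrightarrow> dir_deriv (iter_dir_deriv k a G) h p = iter_dir_deriv k a (dir_deriv G h) p"
proof (induction a arbitrary: p)
  case (Suc a)
  have "dir_deriv (iter_dir_deriv k (Suc a) G) h p = dir_deriv (dir_deriv (iter_dir_deriv k a G) h) k p"
    using dir_deriv_commute[OF smooth_onD[OF smooth_on_iter_dir_deriv[OF G W, of a k]] W Suc.prems, of k h] by simp
  also have "\<dots> = dir_deriv (iter_dir_deriv k a (dir_deriv G h)) k p"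
    by (rule dir_deriv_cong_open[OF W Suc.prems]) (rule Suc.IH)
  finally show ?case by simp
qed simp

lemma iter_dir_deriv_cong:
  assumes W: "open W"
  shows "\<lbrakk>p \<in> W; \<And>p. p \<in> W \<Longrightarrow> f p = g p\<rbrakk> \<Longrightarrow> iter_dir_deriv k a f p = iter_dir_deriv k a g p"
proof (induction a arbitrary: p)
  case (Suc a)
  then show ?case using dir_deriv_cong_open[OF W Suc.prems(1), of "iter_dir_deriv k a f" "iter_dir_deriv k a g" k] by simp
qed simp

lemma iter_dir_deriv_diff:
  fixes f g :: "'a::euclidean_space \<Rightarrow> 'b::real_normed_vector"
  assumes f: "smooth_on UNIV f" and g: "smooth_on UNIV g"
  shows "iter_dir_deriv k a (\<lambda>z. f z - g z) = (\<lambda>z. iter_dir_deriv k a f z - iter_dir_deriv k a g z)"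
proof (induction a)
  case (Suc a)
  have "dir_deriv (\<lambda>z. iter_dir_deriv k a f z - iter_dir_deriv k a g z) k z
      = dir_deriv (iter_dir_deriv k a f) k z - dir_deriv (iter_dir_deriv k a g) k z" for z
  proof -
    have "(iter_dir_deriv k a F has_derivative (\<lambda>h. dir_deriv (iter_dir_deriv k a F) h z)) (at z)"
      if "smooth_on UNIV F" for F :: "'a \<Rightarrow> 'b"
      using smooth_on_imp_differentiable[OF smooth_on_iter_dir_deriv[OF that]] by (intro dir_deriv_works) auto
    from dir_deriv_eq[OF has_derivative_diff[OF this[OF f] this[OF g]]] show ?thesis .
  qed
  then have "dir_deriv (\<lambda>z. iter_dir_deriv k a f z - iter_dir_deriv k a g z) k
      = (\<lambda>z. dir_deriv (iter_dir_deriv k a f) k z - dir_deriv (iter_dir_deriv k a g) k z)" by blast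
  then show ?case by (simp add: Suc)
qed simp

lemma Ck_on_Pair_right: "Ck_on n UNIV (\<lambda>u::'c::euclidean_space. (v::'a::euclidean_space, u))"
proof -
  have "Ck_on n UNIV (\<lambda>u::'c. (v, 0) + (0::'a, u))"
    by (intro Ck_on_add Ck_on_const Ck_on_linear bounded_linear_Pair bounded_linear_zero bounded_linear_ident open_UNIV)
  then show ?thesis by simp
qed

lemma smooth_on_fiber:
  assumes S: "open S" "v \<in> S" and G: "smooth_on (S \<times> UNIV) G"
  shows "smooth_on UNIV (\<lambda>u. G (v, u))"
proof (rule smooth_onI)
  fix n
  show "Ck_on n UNIV (\<lambda>u. G (v, u))"
    by (rule Ck_on_compose[OF open_UNIV _ _ smooth_onD[OF G] Ck_on_Pair_right]) (use S in \<open>auto simp: open_Times\<close>)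
qed

lemma dir_deriv_fiber:
  assumes "G differentiable (at (v, u))"
  shows "dir_deriv (\<lambda>u. G (v, u)) k u = dir_deriv G (0, k) (v, u)"
proof -
  have "((\<lambda>u. (v, u)) has_derivative (\<lambda>k. (0, k))) (at u)"
    by (auto intro!: derivative_eq_intros)
  from has_derivative_compose[OF this dir_deriv_works[OF assms]]
  show ?thesis by (rule dir_deriv_eq)
qed

lemma iter_dir_deriv_fiber:
  assumes S: "open S" "v \<in> S" and G: "smooth_on (S \<times> UNIV) G"
  shows "iter_dir_deriv k a (\<lambda>u. G (v, u)) = (\<lambda>u. iter_dir_deriv (0, k) a G (v, u))"
proof (induction a)
  case (Suc a)
  have "iter_dir_deriv (0, k) a G differentiable (at (v, u))" for u
    by (rule smooth_on_imp_differentiable[OF smooth_on_iter_dir_deriv[OF G]]) (use S in \<open>auto intro: open_Times\<close>)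
  from dir_deriv_fiber[OF this] show ?case by (simp add: Suc)
qed simp

text \<open>Counterpart of \<open>mixed_partial\<close> on the product space: u-derivatives become
  derivatives in the directions \<open>(0, 1)\<close> and \<open>(0, \<i>)\<close>, and the result
  can still be differentiated in the parameter.\<close>

definition fiber_partial :: "nat \<Rightarrow> nat \<Rightarrow> ('a::euclidean_space \<times> complex \<Rightarrow> complex) \<Rightarrow> 'a \<times> complex \<Rightarrow> complex" where
  "fiber_partial a b G = iter_dir_deriv (0, \<i>) b (iter_dir_deriv (0, 1) a G)"

lemma mixed_partial_eq_iter: "mixed_partial a b f = iter_dir_deriv \<i> b (iter_dir_deriv 1 a f)"
  by (simp add: mixed_partial_def partial_x_eq_dir_deriv[abs_def] partial_y_eq_dir_deriv[abs_def])

lemma mixed_partial_diff: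
  assumes "smooth_on UNIV f" "smooth_on UNIV g"
  shows "mixed_partial a b (\<lambda>z. f z - g z) z = mixed_partial a b f z - mixed_partial a b g z"
  unfolding mixed_partial_eq_iter iter_dir_deriv_diff[OF assms]
    iter_dir_deriv_diff[OF assms[THEN smooth_on_iter_dir_deriv[OF _ open_UNIV]]] ..

lemma smooth_on_fiber_partial: "\<lbrakk>smooth_on W G; open W\<rbrakk> \<Longrightarrow> smooth_on W (fiber_partial a b G)"
  unfolding fiber_partial_def by (intro smooth_on_iter_dir_deriv)

lemma mixed_partial_fiber:
  assumes "open S" "v \<in> S" "smooth_on (S \<times> UNIV) G"
  shows "mixed_partial a b (\<lambda>u. G (v, u)) u = fiber_partial a b G (v, u)"
proof -
  have "open (S \<times> (UNIV :: complex set))" using assms(1) by (simp add: open_Times)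
  note G = smooth_on_iter_dir_deriv[OF assms(3) this]
  show ?thesis
    unfolding mixed_partial_eq_iter fiber_partial_def iter_dir_deriv_fiber[OF assms]
      iter_dir_deriv_fiber[OF assms(1,2) G] ..
qed

lemma dir_deriv_fiber_partial:
  assumes W: "open W" and G: "smooth_on W G" and p: "p \<in> W"
  shows "dir_deriv (fiber_partial a b G) h p = fiber_partial a b (dir_deriv G h) p"
proof -
  let ?G = "iter_dir_deriv (0, 1) a G"
  have "dir_deriv (fiber_partial a b G) h p = iter_dir_deriv (0, \<i>) b (dir_deriv ?G h) p"
    unfolding fiber_partial_def by (rule iter_dir_deriv_commute[OF W smooth_on_iter_dir_deriv[OF G W] p])
  also have "\<dots> = fiber_partial a b (dir_deriv G h) p"
    unfolding fiber_partial_def by (rule iter_dir_deriv_cong[OF W p]) (rule iter_dir_deriv_commute[OF W G])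
  finally show ?thesis .
qed

section \<open>Estimates in the parameter, uniform over compact sets of the fibre variable\<close>

lemma dir_deriv_first_sum:
  fixes G :: "'a::euclidean_space \<times> 'c::euclidean_space \<Rightarrow> 'd::real_normed_vector"
  assumes "G differentiable (at p)"
  shows "dir_deriv G (h, 0) p = (\<Sum>b\<in>Basis. (h \<bullet> b) *\<^sub>R dir_deriv G (b, 0) p)"
proof -
  have "linear (\<lambda>h::'a. (h, 0::'c))"
    by (intro bounded_linear.linear bounded_linear_Pair bounded_linear_ident bounded_linear_zero)
  from linear_compose[OF this has_derivative_linear[OF dir_deriv_works[OF assms]]]
  have lin: "linear (\<lambda>h. dir_deriv G (h, 0) p)" by (simp only: o_def)
  have "dir_deriv G (h, 0) p = dir_deriv G ((\<Sum>b\<in>Basis. (h \<bullet> b) *\<^sub>R b), 0) p"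
    by (simp add: euclidean_representation)
  also have "\<dots> = (\<Sum>b\<in>Basis. (h \<bullet> b) *\<^sub>R dir_deriv G (b, 0) p)"
    using linear_sum[OF lin, of "\<lambda>b. (h \<bullet> b) *\<^sub>R b" Basis] linear_cmul[OF lin] by simp
  finally show ?thesis .
qed

text \<open>Together with \<open>dir_deriv_first_sum\<close>, this reduces bounds uniform in
  \<open>h\<close> to the finitely many basis directions, at the price of a factor
  \<open>DIM('a)\<close>.\<close>

lemma norm_sum_inner_Basis_le:
  fixes A :: "'a::euclidean_space \<Rightarrow> 'd::real_normed_vector" and e :: real
  assumes "\<And>b. b \<in> Basis \<Longrightarrow> norm (A b) \<le> e"
  shows "norm (\<Sum>b\<in>Basis. (h \<bullet> b) *\<^sub>R A b) \<le> DIM('a) * e * norm h"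
proof -
  have "norm (\<Sum>b\<in>Basis. (h \<bullet> b) *\<^sub>R A b) \<le> (\<Sum>b\<in>(Basis::'a set). norm h * e)"
    using assms Basis_le_norm by (intro sum_norm_le) (auto intro!: mult_mono)
  then show ?thesis by (simp add: mult_ac)
qed

lemma uniform_continuity_in_parameter:
  fixes G :: "'a::euclidean_space \<times> 'c::euclidean_space \<Rightarrow> 'd::real_normed_vector"
  assumes S: "open S" "x \<in> S" and G: "continuous_on (S \<times> UNIV) G" and C: "compact C" and e: "e > 0"
  shows "\<forall>\<^sub>F y in nhds x. y \<in> S \<and> (\<forall>z\<in>C. norm (G (y, z) - G (x, z)) \<le> e)"
proof -
  have "continuous_on (S \<times> C) G" using G by (rule continuous_on_subset) auto
  from continuous_on_prod_compactE[OF this C S(2) e] obtain X where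
    X: "x \<in> X" "open X" "\<forall>y\<in>X \<inter> S. \<forall>t\<in>C. dist (G (y, t)) (G (x, t)) \<le> e" by blast
  then show ?thesis
    using S unfolding eventually_nhds by (intro exI[of _ "X \<inter> S"]) (auto simp: dist_norm)
qed

lemma uniform_derivative_bound:
  fixes G :: "'a::euclidean_space \<times> 'c::euclidean_space \<Rightarrow> 'd::real_normed_vector"
  assumes S: "open S" "x \<in> S" and G: "smooth_on (S \<times> UNIV) G" and C: "compact C"
  shows "\<exists>M\<ge>0. \<forall>h. \<forall>z\<in>C. norm (dir_deriv G (h, 0) (x, z)) \<le> M * norm h"
proof -
  have W: "open (S \<times> (UNIV :: 'c set))" using S by (simp add: open_Times)
  have "\<exists>M. \<forall>z\<in>C. norm (dir_deriv G (b, 0) (x, z)) \<le> M" for b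
  proof -
    have "continuous_on C (\<lambda>z. dir_deriv G (b, 0) (x, z))"
      using S(2) by (intro continuous_on_compose2[OF smooth_on_imp_continuous_on[OF smooth_on_dir_deriv[OF G W] W]])
        (auto intro!: continuous_intros)
    then have "bounded ((\<lambda>z. dir_deriv G (b, 0) (x, z)) ` C)"
      using C by (intro compact_imp_bounded compact_continuous_image)
    then show ?thesis by (auto simp: bounded_iff)
  qed
  then obtain M where M: "\<And>b z. z \<in> C \<Longrightarrow> norm (dir_deriv G (b, 0) (x, z)) \<le> M b" by metis
  define K where "K = (\<Sum>b\<in>(Basis::'a set). \<bar>M b\<bar>)"
  have "norm (dir_deriv G (h, 0) (x, z)) \<le> DIM('a) * K * norm h" if z: "z \<in> C" for h z
  proof -
    have d: "G differentiable (at (x, z))" using S W by (intro smooth_on_imp_differentiable[OF G]) auto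
    have bd: "norm (dir_deriv G (b, 0) (x, z)) \<le> K" if "b \<in> Basis" for b
    proof -
      have "\<bar>M b\<bar> \<le> K" unfolding K_def by (rule member_le_sum) (use that in auto)
      with M[OF z, of b] show ?thesis by linarith
    qed
    show ?thesis
      by (subst dir_deriv_first_sum[OF d]) (rule norm_sum_inner_Basis_le[OF bd])
  qed
  moreover have "DIM('a) * K \<ge> 0" by (auto simp: K_def intro!: sum_nonneg)
  ultimately show ?thesis by blast
qed

text \<open>Subtract from \<open>G\<close> its parameter derivative frozen at \<open>x\<close> and
  apply the mean value inequality along the segment from \<open>x\<close> to \<open>x + h\<close>.
  What must be small is a difference of parameter derivatives at two nearby parameters, and
  continuity makes it small uniformly over the compact set \<open>C\<close>.\<close>

lemma uniform_first_order_expansion: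
  fixes G :: "'a::euclidean_space \<times> 'c::euclidean_space \<Rightarrow> 'd::real_normed_vector"
  assumes S: "open S" "x \<in> S" and G: "smooth_on (S \<times> UNIV) G" and C: "compact C" and e: "e > 0"
  shows "\<forall>\<^sub>F h in nhds 0. x + h \<in> S \<and>
    (\<forall>z\<in>C. norm (G (x + h, z) - G (x, z) - dir_deriv G (h, 0) (x, z)) \<le> e * norm h)"
proof -
  have W: "open (S \<times> (UNIV :: 'c set))" using S by (simp add: open_Times)
  \<comment> \<open>Compensates the factor \<open>DIM('a)\<close> of
    \<open>norm_sum_inner_Basis_le\<close>.\<close>
  define e' where "e' = e / DIM('a)"
  have e': "e' > 0" using e by (simp add: e'_def)
  have diff: "G differentiable (at (y, z))" if "y \<in> S" for y z
    using W that by (intro smooth_on_imp_differentiable[OF G]) auto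
  have "\<forall>\<^sub>F y in nhds x. \<forall>b\<in>Basis. y \<in> S \<and> (\<forall>z\<in>C. norm (dir_deriv G (b, 0) (y, z) - dir_deriv G (b, 0) (x, z)) \<le> e')"
    by (intro eventually_ball_finite ballI finite_Basis uniform_continuity_in_parameter S C e'
        smooth_on_imp_continuous_on smooth_on_dir_deriv G W)
  then obtain d where d: "d > 0" "\<And>y. dist y x < d \<Longrightarrow>
      \<forall>b\<in>Basis. y \<in> S \<and> (\<forall>z\<in>C. norm (dir_deriv G (b, 0) (y, z) - dir_deriv G (b, 0) (x, z)) \<le> e')"
    unfolding eventually_nhds_metric by blast
  have main: "x + h \<in> S \<and> (\<forall>z\<in>C. norm (G (x + h, z) - G (x, z) - dir_deriv G (h, 0) (x, z)) \<le> e * norm h)"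
    if h: "norm h < d" for h
  proof -
    have yS: "y \<in> S" if "dist y x < d" for y
      using d(2)[OF that] nonempty_Basis by blast
    have "norm (G (x + h, z) - G (x, z) - dir_deriv G (h, 0) (x, z)) \<le> e * norm h" if z: "z \<in> C" for z
    proof -
      \<comment> \<open>The linearisation is extended to the product space, ignoring the fibre
        component, so that \<open>G\<close> and \<open>L\<close> can be compared along the line in
        direction \<open>(h, 0)\<close>.\<close>
      define L where "L p = dir_deriv G (fst p, 0) (x, z)" for p :: "'a \<times> 'c"
      have "bounded_linear (\<lambda>p :: 'a \<times> 'c. (fst p, 0 :: 'c))"
        by (intro bounded_linear_Pair bounded_linear_fst bounded_linear_zero)
      then have L: "bounded_linear L"
        using bounded_linear_compose[OF has_derivative_bounded_linear[OF dir_deriv_works[OF diff[OF S(2)]]], of "\<lambda>p. (fst p, 0)" z]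
        by (simp add: L_def[abs_def])
      define g where "g p = G p - L p" for p
      have g: "(g has_derivative (\<lambda>k. dir_deriv G k (y, z) - L k)) (at (y, z))" if "y \<in> S" for y
        unfolding g_def
        by (intro has_derivative_diff dir_deriv_works diff that bounded_linear.has_derivative[OF L has_derivative_ident])
      have near: "dist (x + t *\<^sub>R h) x < d" if "t \<in> {0..1}" for t
      proof -
        have "norm (t *\<^sub>R h) \<le> norm h" unfolding norm_scaleR using that by (intro mult_left_le_one_le) auto
        then show ?thesis using h by (simp add: dist_norm)
      qed
      have "norm (g ((x, z) + 1 *\<^sub>R (h, 0)) - g (x, z)) \<le> (e * norm h) * 1"
      proof (rule norm_diff_le_along_line)
        fix t :: real assume t: "t \<in> {0..1}"
        have eq: "(x, z) + t *\<^sub>R (h, 0) = (x + t *\<^sub>R h, z)" by simp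
        have gt: "(g has_derivative (\<lambda>k. dir_deriv G k (x + t *\<^sub>R h, z) - L k)) (at (x + t *\<^sub>R h, z))"
          by (rule g[OF yS[OF near[OF t]]])
        then show "g differentiable (at ((x, z) + t *\<^sub>R (h, 0)))"
          unfolding differentiable_def eq by blast
        have "dir_deriv g (h, 0) ((x, z) + t *\<^sub>R (h, 0)) = dir_deriv G (h, 0) (x + t *\<^sub>R h, z) - dir_deriv G (h, 0) (x, z)"
          using dir_deriv_eq[OF gt, of "(h, 0)"] unfolding eq by (simp add: L_def)
        also have "\<dots> = (\<Sum>b\<in>Basis. (h \<bullet> b) *\<^sub>R (dir_deriv G (b, 0) (x + t *\<^sub>R h, z) - dir_deriv G (b, 0) (x, z)))"
          using diff yS[OF near[OF t]] S(2) by (simp add: dir_deriv_first_sum[of G _ h] scaleR_diff_right sum_subtractf)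
        also have "norm \<dots> \<le> DIM('a) * e' * norm h"
          by (rule norm_sum_inner_Basis_le) (use d(2)[OF near[OF t]] z in blast)
        finally show "norm (dir_deriv g (h, 0) ((x, z) + t *\<^sub>R (h, 0))) \<le> e * norm h"
          by (simp add: e'_def)
      qed simp
      moreover have "g ((x, z) + 1 *\<^sub>R (h, 0)) - g (x, z) = G (x + h, z) - G (x, z) - L (h, 0)"
        using bounded_linear.linear[OF L, THEN linear_add, of "(x, z)" "(h, 0)"] by (simp add: g_def)
      ultimately show ?thesis by (simp add: L_def)
    qed
    moreover have "x + h \<in> S" using yS[of "x + h"] h by (simp add: dist_norm)
    ultimately show ?thesis by blast
  qed
  then show ?thesis
    unfolding eventually_nhds_metric using d(1) by (intro exI[of _ d]) (simp add: dist_norm)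
qed

section \<open>Families of sections depending smoothly on a parameter\<close>

definition form_coeff :: "('a \<Rightarrow> form01) \<Rightarrow> rs_chart \<Rightarrow> 'a \<times> complex \<Rightarrow> complex" where
  "form_coeff \<Phi> i p = coeff (\<Phi> (fst p)) i (snd p)"

definition jointly_smooth :: "'a::euclidean_space set \<Rightarrow> ('a \<Rightarrow> form01) \<Rightarrow> bool" where
  "jointly_smooth S \<Phi> \<longleftrightarrow> (\<forall>i. smooth_on (S \<times> UNIV) (form_coeff \<Phi> i))"

text \<open>\<open>Abs_form01\<close> is meaningful only where the differentiated coefficients still
  satisfy the gluing condition; \<open>coeff_form_dir_deriv\<close> shows this for jointly smooth
  families.\<close>

definition form_dir_deriv :: "('a::euclidean_space \<Rightarrow> form01) \<Rightarrow> 'a \<Rightarrow> 'a \<Rightarrow> form01" where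
  "form_dir_deriv \<Phi> h x = Abs_form01 (\<lambda>i u. dir_deriv (form_coeff \<Phi> i) (h, 0) (x, u))"

lemma coeff_glue: "z \<noteq> 0 \<Longrightarrow> coeff \<gamma> Z_chart z = - coeff \<gamma> W_chart (inverse z) / (cnj z)\<^sup>2"
  using coeff[of \<gamma>] by auto

lemma smooth_form_fiber:
  assumes "jointly_smooth S \<Phi>" "open S" "v \<in> S"
  shows "smooth_form (\<Phi> v)"
  unfolding smooth_form_def
proof
  fix i
  have "smooth_on UNIV (\<lambda>u. form_coeff \<Phi> i (v, u))"
    using assms unfolding jointly_smooth_def by (intro smooth_on_fiber[of S]) auto
  then show "smooth_on UNIV (coeff (\<Phi> v) i)" by (simp add: form_coeff_def)
qed

lemma jointly_smooth_differentiable: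
  assumes "jointly_smooth S \<Phi>" "open S" "x \<in> S"
  shows "form_coeff \<Phi> i differentiable (at (x, u))"
  using assms unfolding jointly_smooth_def
  by (intro smooth_on_imp_differentiable[of "S \<times> UNIV"]) (auto simp: open_Times)

text \<open>At fixed \<open>z\<close> the gluing condition is a linear relation with constant
  factor, so it survives differentiation in the parameter along \<open>x + t *\<^sub>R h\<close>;
  uniqueness of the derivative yields the glued identity.\<close>

lemma coeff_form_dir_deriv:
  assumes \<Phi>: "jointly_smooth S \<Phi>" and S: "open S" "x \<in> S"
  shows "coeff (form_dir_deriv \<Phi> h x) i u = dir_deriv (form_coeff \<Phi> i) (h, 0) (x, u)"
proof -
  have line: "((\<lambda>t. coeff (\<Phi> (x + t *\<^sub>R h)) i u) has_vector_derivative dir_deriv (form_coeff \<Phi> i) (h, 0) (x, u)) (at 0)" for i u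
    using has_vector_derivative_along_line[of "form_coeff \<Phi> i" "(x, u)" 0 "(h, 0)" UNIV]
      jointly_smooth_differentiable[OF \<Phi> S, of i u]
    by (simp add: form_coeff_def)
  have "dir_deriv (form_coeff \<Phi> Z_chart) (h, 0) (x, z) = - dir_deriv (form_coeff \<Phi> W_chart) (h, 0) (x, inverse z) / (cnj z)\<^sup>2"
    if z: "z \<noteq> 0" for z
  proof (rule vector_derivative_unique_at[OF line])
    have "((\<lambda>t. (- 1 / (cnj z)\<^sup>2) * coeff (\<Phi> (x + t *\<^sub>R h)) W_chart (inverse z)) has_vector_derivative
      (- 1 / (cnj z)\<^sup>2) * dir_deriv (form_coeff \<Phi> W_chart) (h, 0) (x, inverse z)) (at 0)"
      by (rule has_vector_derivative_mult_right[OF line])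
    then show "((\<lambda>t. coeff (\<Phi> (x + t *\<^sub>R h)) Z_chart z) has_vector_derivative
      - dir_deriv (form_coeff \<Phi> W_chart) (h, 0) (x, inverse z) / (cnj z)\<^sup>2) (at 0)"
      by (simp add: coeff_glue[OF z])
  qed
  then show ?thesis
    unfolding form_dir_deriv_def by (subst Abs_form01_inverse) auto
qed

lemma jointly_smooth_form_dir_deriv:
  assumes \<Phi>: "jointly_smooth S \<Phi>" and S: "open S"
  shows "jointly_smooth S (form_dir_deriv \<Phi> h)"
  unfolding jointly_smooth_def
proof (intro allI smooth_onI)
  fix i n
  have W: "open (S \<times> (UNIV :: complex set))" using S by (simp add: open_Times)
  have "smooth_on (S \<times> UNIV) (dir_deriv (form_coeff \<Phi> i) (h, 0))"
    using \<Phi> W unfolding jointly_smooth_def by (intro smooth_on_dir_deriv) auto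
  from smooth_onD[OF this] show "Ck_on n (S \<times> UNIV) (form_coeff (form_dir_deriv \<Phi> h) i)"
    by (rule Ck_on_cong[OF W]) (auto simp: form_coeff_def coeff_form_dir_deriv[OF \<Phi> S])
qed

lemma smooth_form_diff: "\<lbrakk>smooth_form \<gamma>; smooth_form \<delta>\<rbrakk> \<Longrightarrow> smooth_form (\<gamma> - \<delta>)"
  unfolding smooth_form_def minus_form01.rep_eq
  by (intro allI smooth_onI Ck_on_diff open_UNIV) (auto intro: smooth_onD)

lemma mixed_partial_coeff_diff:
  assumes "smooth_form \<gamma>" "smooth_form \<delta>"
  shows "mixed_partial a b (coeff (\<gamma> - \<delta>) i) z = mixed_partial a b (coeff \<gamma> i) z - mixed_partial a b (coeff \<delta> i) z"
proof -
  have "coeff (\<gamma> - \<delta>) i = (\<lambda>z. coeff \<gamma> i z - coeff \<delta> i z)" by (simp add: minus_form01.rep_eq)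
  with mixed_partial_diff assms show ?thesis by (simp add: smooth_form_def)
qed

lemma mixed_partial_coeff:
  assumes "jointly_smooth S \<Phi>" "open S" "v \<in> S"
  shows "mixed_partial a b (coeff (\<Phi> v) i) u = fiber_partial a b (form_coeff \<Phi> i) (v, u)"
  using mixed_partial_fiber[OF assms(2,3), of "form_coeff \<Phi> i" a b u] assms(1)
  by (simp add: jointly_smooth_def form_coeff_def)

text \<open>Here commuting derivatives enter: the right-hand side is exactly the linear term of
  \<open>uniform_first_order_expansion\<close> for
  \<open>fiber_partial a b (form_coeff \<Phi> i)\<close>.\<close>

lemma mixed_partial_coeff_form_dir_deriv:
  assumes \<Phi>: "jointly_smooth S \<Phi>" and S: "open S" "x \<in> S"
  shows "mixed_partial a b (coeff (form_dir_deriv \<Phi> h x) i) u = dir_deriv (fiber_partial a b (form_coeff \<Phi> i)) (h, 0) (x, u)"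
proof -
  have W: "open (S \<times> (UNIV :: complex set))" using S by (simp add: open_Times)
  have G: "smooth_on (S \<times> UNIV) (form_coeff \<Phi> i)" using \<Phi> by (simp add: jointly_smooth_def)
  have "coeff (form_dir_deriv \<Phi> h x) i = (\<lambda>u. dir_deriv (form_coeff \<Phi> i) (h, 0) (x, u))"
    by (rule ext) (rule coeff_form_dir_deriv[OF \<Phi> S])
  then have "mixed_partial a b (coeff (form_dir_deriv \<Phi> h x) i) u
      = fiber_partial a b (dir_deriv (form_coeff \<Phi> i) (h, 0)) (x, u)"
    using mixed_partial_fiber[OF S smooth_on_dir_deriv[OF G W]] by (simp only:)
  also have "\<dots> = dir_deriv (fiber_partial a b (form_coeff \<Phi> i)) (h, 0) (x, u)"
    using S(2) by (intro dir_deriv_fiber_partial[OF W G, symmetric]) simp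
  finally show ?thesis .
qed

lemma linear_form_dir_deriv:
  assumes \<Phi>: "jointly_smooth S \<Phi>" and S: "open S" "x \<in> S"
  shows "linear (\<lambda>h. form_dir_deriv \<Phi> h x)"
proof -
  have lin: "linear (\<lambda>k. dir_deriv (form_coeff \<Phi> i) k (x, u))" for i u
    by (rule has_derivative_linear[OF dir_deriv_works[OF jointly_smooth_differentiable[OF \<Phi> S]]])
  have "coeff (form_dir_deriv \<Phi> (h + k) x) i u = coeff (form_dir_deriv \<Phi> h x + form_dir_deriv \<Phi> k x) i u" for h k i u
    using linear_add[OF lin[of i u], of "(h, 0)" "(k, 0)"]
    by (simp add: coeff_form_dir_deriv[OF \<Phi> S] plus_form01.rep_eq)
  moreover have "coeff (form_dir_deriv \<Phi> (r *\<^sub>R h) x) i u = coeff (r *\<^sub>R form_dir_deriv \<Phi> h x) i u" for h r i u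
    using linear_cmul[OF lin[of i u], of r "(h, 0)"]
    by (simp add: coeff_form_dir_deriv[OF \<Phi> S] scaleR_form01.rep_eq)
  ultimately show ?thesis by (intro linearI) (simp_all add: fun_eq_iff flip: coeff_inject)
qed

section \<open>Continuity and differentiability of families in the Sobolev norm\<close>

lemma finite_partial_indices: "finite ({(a, b). a + b \<le> (m::nat)} \<times> (UNIV :: rs_chart set))"
proof -
  have "{(a, b). a + b \<le> m} \<subseteq> {..m} \<times> {..m}" by auto
  then have "finite {(a, b). a + b \<le> m}" by (rule finite_subset) simp
  moreover have "(UNIV :: rs_chart set) = {Z_chart, W_chart}" using rs_chart.exhaust by auto
  then have "finite (UNIV :: rs_chart set)" by (metis finite.emptyI finite_insert)
  ultimately show ?thesis by simp
qed

text \<open>Each estimate holds near the limit point on a neighbourhood depending on the derivative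
  and the chart; only finitely many pairs occur, so a common one exists. The bound
  \<open>e y\<close> may vary with \<open>y\<close>, which serves both continuity (constant) and
  differentiability (a multiple of \<open>norm h\<close>).\<close>

lemma eventually_sobolev_le:
  assumes C: "\<And>\<gamma> \<epsilon>. \<lbrakk>smooth_form \<gamma>; \<epsilon> \<ge> 0;
      \<And>i a b z. \<lbrakk>a + b \<le> m; z \<in> cball 0 2\<rbrakk> \<Longrightarrow> norm (mixed_partial a b (coeff \<gamma> i) z) \<le> \<epsilon>\<rbrakk>
      \<Longrightarrow> sobolev_norm m p \<gamma> \<le> C * \<epsilon>"
    and ev: "\<And>i a b. \<forall>\<^sub>F y in F. smooth_form (\<Gamma> y) \<and> (\<forall>z\<in>cball 0 2. norm (mixed_partial a b (coeff (\<Gamma> y) i) z) \<le> e y)"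
    and e: "\<And>y. e y \<ge> 0"
  shows "\<forall>\<^sub>F y in F. sobolev_norm m p (\<Gamma> y) \<le> C * e y"
proof -
  have "\<forall>\<^sub>F y in F. \<forall>j\<in>{(a, b). a + b \<le> m} \<times> UNIV. smooth_form (\<Gamma> y) \<and>
      (\<forall>z\<in>cball 0 2. norm (mixed_partial (fst (fst j)) (snd (fst j)) (coeff (\<Gamma> y) (snd j)) z) \<le> e y)"
    by (intro eventually_ball_finite finite_partial_indices ballI ev)
  then show ?thesis
  proof eventually_elim
    case (elim y)
    have "smooth_form (\<Gamma> y)" using bspec[OF elim, of "((0, 0), Z_chart)"] by simp
    moreover have "norm (mixed_partial a b (coeff (\<Gamma> y) i) z) \<le> e y" if "a + b \<le> m" "z \<in> cball 0 2" for a b i z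
      using bspec[OF elim, of "((a, b), i)"] that by simp
    ultimately show ?case using e by (intro C)
  qed
qed

lemma sobolev_norm_continuous:
  assumes \<Phi>: "jointly_smooth S \<Phi>" and S: "open S" "x \<in> S" and p: "p > 0"
  shows "((\<lambda>y. sobolev_norm m p (\<Phi> y - \<Phi> x)) \<longlongrightarrow> 0) (nhds x)"
proof (rule tendstoI)
  fix e :: real assume e: "e > 0"
  have W: "open (S \<times> (UNIV :: complex set))" using S by (simp add: open_Times)
  obtain C where C: "C > 0" "\<And>\<gamma> \<epsilon>. \<lbrakk>smooth_form \<gamma>; \<epsilon> \<ge> 0;
      \<And>i a b z. \<lbrakk>a + b \<le> m; z \<in> cball 0 2\<rbrakk> \<Longrightarrow> norm (mixed_partial a b (coeff \<gamma> i) z) \<le> \<epsilon>\<rbrakk>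
      \<Longrightarrow> sobolev_norm m p \<gamma> \<le> C * \<epsilon>"
    using sobolev_norm_le[OF p, of m] by blast
  \<comment> \<open>Then \<open>C * e'\<close> is half of \<open>e\<close>, which turns the
    non-strict estimate into the strict one required.\<close>
  define e' where "e' = e / (2 * C)"
  have e': "e' > 0" using e C by (simp add: e'_def)
  have "\<forall>\<^sub>F y in nhds x. sobolev_norm m p (\<Phi> y - \<Phi> x) \<le> C * e'"
  proof (rule eventually_sobolev_le[OF C(2)])
    fix i a b
    have "continuous_on (S \<times> UNIV) (fiber_partial a b (form_coeff \<Phi> i))"
      using \<Phi> W by (auto simp: jointly_smooth_def intro!: smooth_on_imp_continuous_on smooth_on_fiber_partial)
    from uniform_continuity_in_parameter[OF S this compact_cball e', of 0 2]
    show "\<forall>\<^sub>F y in nhds x. smooth_form (\<Phi> y - \<Phi> x) \<and>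
      (\<forall>z\<in>cball 0 2. norm (mixed_partial a b (coeff (\<Phi> y - \<Phi> x) i) z) \<le> e')"
    proof eventually_elim
      case (elim y)
      then have y: "y \<in> S" by simp
      note sm = smooth_form_fiber[OF \<Phi> S(1) y] smooth_form_fiber[OF \<Phi> S]
      have "mixed_partial a b (coeff (\<Phi> y - \<Phi> x) i) z
          = fiber_partial a b (form_coeff \<Phi> i) (y, z) - fiber_partial a b (form_coeff \<Phi> i) (x, z)" for z
        unfolding mixed_partial_coeff_diff[OF sm] mixed_partial_coeff[OF \<Phi> S(1) y] mixed_partial_coeff[OF \<Phi> S] ..
      with elim smooth_form_diff[OF sm] show ?case by simp
    qed
  qed (use e' in auto)
  then show "\<forall>\<^sub>F y in nhds x. dist (sobolev_norm m p (\<Phi> y - \<Phi> x)) 0 < e"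
  proof eventually_elim
    case (elim y)
    have "C * e' < e" using C(1) e by (simp add: e'_def)
    with elim sobolev_norm_nonneg[of m p "\<Phi> y - \<Phi> x"] show ?case by simp
  qed
qed

lemma has_frechet_derivative_in_sobolev:
  assumes \<Phi>: "jointly_smooth S \<Phi>" and S: "open S" "x \<in> S" and p: "p > 0"
  shows "has_frechet_derivative_in (sobolev_forms m p) (sobolev_norm m p) \<Phi> (\<lambda>h. form_dir_deriv \<Phi> h x) x"
  unfolding has_frechet_derivative_in_def
proof (intro conjI)
  have W: "open (S \<times> (UNIV :: complex set))" using S by (simp add: open_Times)
  have G: "smooth_on (S \<times> UNIV) (fiber_partial a b (form_coeff \<Phi> i))" for a b i
    using \<Phi> W by (auto simp: jointly_smooth_def intro!: smooth_on_fiber_partial)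
  have sm: "smooth_form (form_dir_deriv \<Phi> h x)" for h
    by (rule smooth_form_fiber[OF jointly_smooth_form_dir_deriv[OF \<Phi> S(1)] S])
  obtain C where C: "C > 0" "\<And>\<gamma> \<epsilon>. \<lbrakk>smooth_form \<gamma>; \<epsilon> \<ge> 0;
      \<And>i a b z. \<lbrakk>a + b \<le> m; z \<in> cball 0 2\<rbrakk> \<Longrightarrow> norm (mixed_partial a b (coeff \<gamma> i) z) \<le> \<epsilon>\<rbrakk>
      \<Longrightarrow> sobolev_norm m p \<gamma> \<le> C * \<epsilon>"
    using sobolev_norm_le[OF p, of m] by blast
  show "linear (\<lambda>h. form_dir_deriv \<Phi> h x)" by (rule linear_form_dir_deriv[OF \<Phi> S])
  show "range (\<lambda>h. form_dir_deriv \<Phi> h x) \<subseteq> sobolev_forms m p"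
    using smooth_form_in_sobolev_forms[OF sm] p by auto
  show "\<exists>C. \<forall>h. sobolev_norm m p (form_dir_deriv \<Phi> h x) \<le> C * norm h"
  proof -
    have "\<exists>M\<ge>0. \<forall>h. \<forall>z\<in>cball 0 2. norm (dir_deriv (fiber_partial a b (form_coeff \<Phi> i)) (h, 0) (x, z)) \<le> M * norm h" for a b i
      by (rule uniform_derivative_bound[OF S G compact_cball])
    then obtain M where M: "\<And>a b i. M a b i \<ge> 0"
      "\<And>a b i h z. z \<in> cball 0 2 \<Longrightarrow> norm (dir_deriv (fiber_partial a b (form_coeff \<Phi> i)) (h, 0) (x, z)) \<le> M a b i * norm h"
      by metis
    \<comment> \<open>A single constant for all derivatives of order up to \<open>m\<close> in both
      charts: a finite sum of nonnegative bounds dominates each of them.\<close>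
    define K where "K = (\<Sum>j\<in>{(a, b). a + b \<le> m} \<times> UNIV. M (fst (fst j)) (snd (fst j)) (snd j))"
    have K: "M a b i \<le> K" if "a + b \<le> m" for a b i
      using member_le_sum[OF _ _ finite_partial_indices, of "((a, b), i)" m "\<lambda>j. M (fst (fst j)) (snd (fst j)) (snd j)"] that M(1)
      by (simp add: K_def)
    have K0: "K \<ge> 0" unfolding K_def by (intro sum_nonneg M(1))
    have "sobolev_norm m p (form_dir_deriv \<Phi> h x) \<le> C * (K * norm h)" for h
    proof (rule C(2)[OF sm])
      fix i a b and z :: complex assume "a + b \<le> m" and z: "z \<in> cball 0 2"
      have "norm (mixed_partial a b (coeff (form_dir_deriv \<Phi> h x) i) z) \<le> M a b i * norm h"
        unfolding mixed_partial_coeff_form_dir_deriv[OF \<Phi> S] by (rule M(2)[OF z])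
      also have "\<dots> \<le> K * norm h" by (intro mult_right_mono K) (use \<open>a + b \<le> m\<close> in auto)
      finally show "norm (mixed_partial a b (coeff (form_dir_deriv \<Phi> h x) i) z) \<le> K * norm h" .
    qed (use K0 in auto)
    then show ?thesis by (intro exI[of _ "C * K"]) (simp add: mult.assoc)
  qed
  show "((\<lambda>h. sobolev_norm m p (\<Phi> (x + h) - \<Phi> x - form_dir_deriv \<Phi> h x) / norm h) \<longlongrightarrow> 0) (at 0)"
  proof (rule tendstoI)
    fix e :: real assume e: "e > 0"
    define e' where "e' = e / (2 * C)"
    have e': "e' > 0" using e C by (simp add: e'_def)
    have "\<forall>\<^sub>F h in nhds 0. sobolev_norm m p (\<Phi> (x + h) - \<Phi> x - form_dir_deriv \<Phi> h x) \<le> C * (e' * norm h)"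
    proof (rule eventually_sobolev_le[OF C(2)])
      fix i a b
      from uniform_first_order_expansion[OF S G[of a b i] compact_cball e', of 0 2]
      show "\<forall>\<^sub>F h in nhds 0. smooth_form (\<Phi> (x + h) - \<Phi> x - form_dir_deriv \<Phi> h x) \<and>
        (\<forall>z\<in>cball 0 2. norm (mixed_partial a b (coeff (\<Phi> (x + h) - \<Phi> x - form_dir_deriv \<Phi> h x) i) z) \<le> e' * norm h)"
      proof eventually_elim
        case (elim h)
        then have y: "x + h \<in> S" by simp
        note smy = smooth_form_fiber[OF \<Phi> S(1) y] smooth_form_fiber[OF \<Phi> S]
        have "mixed_partial a b (coeff (\<Phi> (x + h) - \<Phi> x - form_dir_deriv \<Phi> h x) i) z
            = fiber_partial a b (form_coeff \<Phi> i) (x + h, z) - fiber_partial a b (form_coeff \<Phi> i) (x, z)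
              - dir_deriv (fiber_partial a b (form_coeff \<Phi> i)) (h, 0) (x, z)" for z
          unfolding mixed_partial_coeff_diff[OF smooth_form_diff[OF smy] sm] mixed_partial_coeff_diff[OF smy]
            mixed_partial_coeff[OF \<Phi> S(1) y] mixed_partial_coeff[OF \<Phi> S]
            mixed_partial_coeff_form_dir_deriv[OF \<Phi> S] ..
        with elim smooth_form_diff[OF smooth_form_diff[OF smy] sm] show ?case by simp
      qed
    qed (use e' in auto)
    then have "\<forall>\<^sub>F h in at 0. sobolev_norm m p (\<Phi> (x + h) - \<Phi> x - form_dir_deriv \<Phi> h x) \<le> C * (e' * norm h)"
      by (simp add: eventually_nhds_conv_at)
    moreover have "\<forall>\<^sub>F h in at (0::'a). h \<noteq> 0" by (simp add: eventually_at_filter)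
    ultimately show "\<forall>\<^sub>F h in at 0. dist (sobolev_norm m p (\<Phi> (x + h) - \<Phi> x - form_dir_deriv \<Phi> h x) / norm h) 0 < e"
    proof eventually_elim
      case (elim h)
      have "sobolev_norm m p (\<Phi> (x + h) - \<Phi> x - form_dir_deriv \<Phi> h x) / norm h \<le> C * e'"
        using elim by (simp add: pos_divide_le_eq mult.assoc)
      also have "\<dots> < e" using C(1) e by (simp add: e'_def)
      finally show ?case using sobolev_norm_nonneg[of m p "\<Phi> (x + h) - \<Phi> x - form_dir_deriv \<Phi> h x"] by simp
    qed
  qed
qed

theorem jointly_smooth_imp_smooth_into_sobolev:
  assumes S: "open S" and p: "p > 0" and \<Phi>: "jointly_smooth S \<Phi>"
  shows "smooth_into (sobolev_forms m p) (sobolev_norm m p) S \<Phi>"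
proof -
  have sub: "\<Phi> ` S \<subseteq> sobolev_forms m p" if "jointly_smooth S \<Phi>" for \<Phi>
    using smooth_form_in_sobolev_forms[OF smooth_form_fiber[OF that S]] p by auto
  have "jointly_smooth S \<Phi> \<Longrightarrow> Ck_into n (sobolev_forms m p) (sobolev_norm m p) S \<Phi>" for n \<Phi>
  proof (induction n arbitrary: \<Phi>)
    case 0
    have "((\<lambda>y. sobolev_norm m p (\<Phi> y - \<Phi> x)) \<longlongrightarrow> 0) (at x within S)" if "x \<in> S" for x
      by (rule filterlim_mono[OF sobolev_norm_continuous[OF 0 S that p]]) (auto intro: at_within_le_nhds)
    with sub[OF 0] show ?case by simp
  next
    case (Suc n)
    have "Ck_into n (sobolev_forms m p) (sobolev_norm m p) S (\<lambda>x. form_dir_deriv \<Phi> h x)" for h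
      using Suc.IH[OF jointly_smooth_form_dir_deriv[OF Suc.prems S]] .
    with sub[OF Suc.prems] has_frechet_derivative_in_sobolev[OF Suc.prems S _ p] show ?case
      unfolding Ck_into.simps by (intro conjI exI[of _ "\<lambda>x h. form_dir_deriv \<Phi> h x"]) auto
  qed
  with \<Phi> show ?thesis by (simp add: smooth_into_def)
qed

section \<open>The orbit map in charts\<close>

text \<open>In the charts \<open>i\<close> (source) and \<open>j\<close> (target), the map of the matrix \<open>A\<close> is
  \<open>u \<mapsto> (p u + q) / (r u + s)\<close>, where passing to the chart at infinity swaps the columns
  (for \<open>i\<close>) or the rows (for \<open>j\<close>) of \<open>A\<close>.\<close>

definition chart_index :: "rs_chart \<Rightarrow> 2" where
  "chart_index i = (case i of Z_chart \<Rightarrow> 1 | W_chart \<Rightarrow> 2)"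

definition other_index :: "rs_chart \<Rightarrow> 2" where
  "other_index i = (case i of Z_chart \<Rightarrow> 2 | W_chart \<Rightarrow> 1)"

definition moebius_num :: "rs_chart \<Rightarrow> rs_chart \<Rightarrow> complex^2^2 \<Rightarrow> complex \<Rightarrow> complex" where
  "moebius_num i j A u = A $ chart_index j $ chart_index i * u + A $ chart_index j $ other_index i"

definition moebius_den :: "rs_chart \<Rightarrow> rs_chart \<Rightarrow> complex^2^2 \<Rightarrow> complex \<Rightarrow> complex" where
  "moebius_den i j A u = A $ other_index j $ chart_index i * u + A $ other_index j $ other_index i"

text \<open>Equals \<open>det A\<close> for \<open>i = j\<close> and \<open>- det A\<close>
  otherwise, one sign for each swap of rows or columns; it is the numerator of the derivative of the
  chart representative.\<close>

definition moebius_chart_det :: "rs_chart \<Rightarrow> rs_chart \<Rightarrow> complex^2^2 \<Rightarrow> complex" where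
  "moebius_chart_det i j A = A $ chart_index j $ chart_index i * A $ other_index j $ other_index i
     - A $ chart_index j $ other_index i * A $ other_index j $ chart_index i"

lemma local_dom_moebius:
  assumes "det A \<noteq> 0"
  shows "u \<in> local_dom i j (moebius_map A) \<longleftrightarrow> moebius_den i j A u \<noteq> 0"
proof -
  have "A$1$1 * A$2$2 - A$1$2 * A$2$1 \<noteq> 0" using assms by (simp add: det_2)
  from moebius_rep_aux(1-4)[OF this, unfolded mat22_eta] show ?thesis
    by (cases i; cases j) (simp_all add: moebius_den_def chart_index_def other_index_def add.commute)
qed

lemma local_rep_moebius:
  assumes "det A \<noteq> 0" "moebius_den i j A u \<noteq> 0"
  shows "local_rep i j (moebius_map A) u = moebius_num i j A u / moebius_den i j A u"
proof -
  have "A$1$1 * A$2$2 - A$1$2 * A$2$1 \<noteq> 0" using assms by (simp add: det_2)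
  from moebius_rep_aux(5-8)[OF this, unfolded mat22_eta] assms(2) show ?thesis
    by (cases i; cases j) (simp_all add: moebius_den_def moebius_num_def chart_index_def other_index_def add.commute)
qed

lemma deriv_local_rep_moebius:
  assumes A: "det A \<noteq> 0" and u: "moebius_den i j A u \<noteq> 0"
  shows "deriv (local_rep i j (moebius_map A)) u = moebius_chart_det i j A / (moebius_den i j A u)\<^sup>2"
proof (rule DERIV_imp_deriv)
  have D: "((\<lambda>u. moebius_num i j A u / moebius_den i j A u) has_field_derivative
      moebius_chart_det i j A / (moebius_den i j A u)\<^sup>2) (at u)"
  proof -
    have "(moebius_num i j A has_field_derivative A $ chart_index j $ chart_index i) (at u)"
      "(moebius_den i j A has_field_derivative A $ other_index j $ chart_index i) (at u)"
      unfolding moebius_num_def moebius_den_def by (auto intro!: derivative_eq_intros)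
    from DERIV_divide[OF this u] show ?thesis
      by (simp add: moebius_chart_det_def moebius_num_def moebius_den_def power2_eq_square algebra_simps)
  qed
  have "open {u. moebius_den i j A u \<noteq> 0}"
    unfolding moebius_den_def by (intro open_Collect_neq continuous_intros)
  with D show "(local_rep i j (moebius_map A) has_field_derivative
      moebius_chart_det i j A / (moebius_den i j A u)\<^sup>2) (at u)"
    by (rule has_field_derivative_transform_within_open) (use u A in \<open>auto simp: local_rep_moebius\<close>)
qed

lemma Ck_on_psl_affine_entry:
  fixes m :: "complex \<times> complex \<times> complex \<Rightarrow> complex^2^2" and k l :: 2
  assumes m: "m \<in> psl_affine" and W: "open W"
  shows "Ck_on n W (\<lambda>v. m v $ k $ l)"
proof -
  have lin: "Ck_on n W fst" "Ck_on n W (\<lambda>v. fst (snd v))" "Ck_on n W (\<lambda>v. snd (snd v))"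
    by (intro Ck_on_linear W bounded_linear_fst bounded_linear_compose[OF bounded_linear_fst bounded_linear_snd]
        bounded_linear_compose[OF bounded_linear_snd bounded_linear_snd])+
  have "k = 1 \<or> k = 2" "l = 1 \<or> l = 2" by (rule exhaust_2)+
  then show ?thesis
    using m lin unfolding psl_affine_def by (auto simp: case_prod_beta)
qed

text \<open>In general no single target chart serves all parameters and points, and the quotient
  formula fails where its denominator vanishes. Smoothness is local, so near each
  \<open>(v, u)\<close> a chart containing the image point is fixed.\<close>

lemma jointly_smooth_pullback:
  assumes m: "m \<in> psl_affine" and \<gamma>: "smooth_form \<gamma>"
  shows "jointly_smooth (psl_chart_dom m) (\<lambda>v. pullback (psl_of (m v)) \<gamma>)"
  unfolding jointly_smooth_def
proof (intro allI smooth_onI)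
  fix i n
  define S where "S = psl_chart_dom m"
  define F where "F = form_coeff (\<lambda>v. pullback (psl_of (m v)) \<gamma>) i"
  have S: "open S" unfolding S_def by (rule open_psl_chart_dom[OF m])
  then have W: "open (S \<times> (UNIV :: complex set))" by (simp add: open_Times)
  have det: "det (m v) \<noteq> 0" if "v \<in> S" for v using that by (simp add: S_def psl_chart_dom_def)
  have entry: "Ck_on n U (\<lambda>p. m (fst p) $ k $ l)" if "open U" for k l :: 2 and n and U :: "((complex \<times> complex \<times> complex) \<times> complex) set"
    by (rule Ck_on_compose[OF that open_UNIV _ Ck_on_psl_affine_entry[OF m open_UNIV] Ck_on_linear[OF that bounded_linear_fst]]) simp
  have snd: "Ck_on n U snd" if "open U" for n and U :: "((complex \<times> complex \<times> complex) \<times> complex) set"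
    by (rule Ck_on_linear[OF that bounded_linear_snd])
  have num: "Ck_on n U (\<lambda>p. moebius_num i j (m (fst p)) (snd p))"
    and den: "Ck_on n U (\<lambda>p. moebius_den i j (m (fst p)) (snd p))"
    and dt: "Ck_on n U (\<lambda>p. moebius_chart_det i j (m (fst p)))" if "open U" for U n j
    unfolding moebius_num_def moebius_den_def moebius_chart_det_def
    by (intro Ck_on_add Ck_on_diff Ck_on_mult entry snd that)+
  have "\<exists>U. open U \<and> (v, u) \<in> U \<and> Ck_on n U F" if v: "v \<in> S" for v u
  proof -
    obtain j where j: "moebius_map (m v) (rs_param i u) \<in> rs_dom j"
      using rs_dom_Z rs_dom_W by (metis ComplI riemann_sphere.distinct(1) singletonD)
    \<comment> \<open>By \<open>local_dom_moebius\<close> this is exactly the set where the image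
      stays in chart \<open>j\<close>.\<close>
    define U where "U = (S \<times> UNIV) \<inter> {p. moebius_den i j (m (fst p)) (snd p) \<noteq> 0}"
    have "continuous_on UNIV (\<lambda>p. moebius_den i j (m (fst p)) (snd p))"
      using Ck_on_imp_continuous_on[OF den] by auto
    then have U: "open U" unfolding U_def by (intro open_Int W open_Collect_neq) auto
    have "(v, u) \<in> U" using v j local_dom_moebius[OF det[OF v], of u i j]
      by (simp add: U_def local_dom_def)
    \<comment> \<open>Quotients are written as products with \<open>inverse\<close>, the form in
      which the closure rules for C^n functions apply.\<close>
    have eq: "coeff \<gamma> j (moebius_num i j (m (fst p)) (snd p) * inverse (moebius_den i j (m (fst p)) (snd p))) *
        cnj (moebius_chart_det i j (m (fst p)) * (inverse (moebius_den i j (m (fst p)) (snd p)))\<^sup>2) = F p"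
      if "p \<in> U" for p
    proof -
      have p: "det (m (fst p)) \<noteq> 0" "moebius_den i j (m (fst p)) (snd p) \<noteq> 0"
        using that det by (auto simp: U_def)
      then have dom: "moebius_map (m (fst p)) (rs_param i (snd p)) \<in> rs_dom j"
        using local_dom_moebius[of "m (fst p)" "snd p" i j] by (simp add: local_dom_def)
      have "F p = coeff \<gamma> j (local_rep i j (moebius_map (m (fst p))) (snd p)) *
          cnj (deriv (local_rep i j (moebius_map (m (fst p)))) (snd p))"
        using coeff_pullback[of "psl_of (m (fst p))" i "snd p" j \<gamma>] dom p(1)
        by (simp add: F_def form_coeff_def psl_map_psl_of)
      then show ?thesis
        by (simp add: local_rep_moebius[OF p] deriv_local_rep_moebius[OF p] divide_inverse power_inverse)
    qed
    have nz: "\<And>p. p \<in> U \<Longrightarrow> moebius_den i j (m (fst p)) (snd p) \<noteq> 0" by (simp add: U_def)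
    have cf: "Ck_on n UNIV (coeff \<gamma> j)" using \<gamma> smooth_onD unfolding smooth_form_def by blast
    have "Ck_on n U (\<lambda>p. coeff \<gamma> j (moebius_num i j (m (fst p)) (snd p) * inverse (moebius_den i j (m (fst p)) (snd p))) *
        cnj (moebius_chart_det i j (m (fst p)) * (inverse (moebius_den i j (m (fst p)) (snd p)))\<^sup>2))"
      by (intro Ck_on_mult[OF U] Ck_on_compose[OF U open_UNIV _ cf] Ck_on_bounded_linear[OF U bounded_linear_cnj]
          Ck_on_power[OF U] Ck_on_inverse[OF U nz] num[OF U] den[OF U] dt[OF U]) auto
    then have "Ck_on n U F" by (rule Ck_on_cong[OF U _ eq])
    with U \<open>(v, u) \<in> U\<close> show ?thesis by blast
  qed
  then show "Ck_on n (psl_chart_dom m \<times> UNIV) (form_coeff (\<lambda>v. pullback (psl_of (m v)) \<gamma>) i)"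
    using W unfolding S_def[symmetric] F_def[symmetric] by (intro Ck_on_local) auto
qed

theorem lemma1p1:
  fixes k :: nat and p :: real and \<gamma> :: form01
  assumes "k \<ge> 1" and "p \<ge> 1" and "real k - 2 / p > 1"
    and "smooth_form \<gamma>"
  shows "smooth_on_PSL (sobolev_forms (k - 1) p) (sobolev_norm (k - 1) p) (\<lambda>\<phi>. pullback \<phi> \<gamma>)"
unfolding smooth_on_PSL_def
  using assms(2,4) by (auto intro!: jointly_smooth_imp_smooth_into_sobolev open_psl_chart_dom jointly_smooth_pullback)

end
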